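(* Let $d\ge 1$ be an integer, let $p>0$, let $\mu\in\mathcal{P}(\mathbb{R}^d)$, let $(X_k)_{k\ge1}$ be i.i.d. $\mu$-distributed random variables and, for $N\ge 1$, let $\mu_N=\frac1N\sum_{k=1}^N\delta_{X_k}$. Set $\varepsilon_p=\max\{2^{-1},2^{-p}\}$. (i) If $p>d/2$ and $q>2p$, then for all $m\in[1,\infty)\cup\{\infty\}$ and all $N\ge1$, $$\mathbb{E}[\mathcal{T}_p^{(m)}(\mu_N,\mu)]\le 2^p\frac{\kappa_{d,p}^{(m)}}{\sqrt N}[\mathcal{M}_q^{(m)}(\mu)]^{p/q}\,\theta_{d,p,q}^{(m)},\qquad \theta_{d,p,q}^{(m)}=H\Big(\frac{\varepsilon_p}{\kappa_{d,p}^{(m)}},2p,q\Big),$$ where $$\kappa_{d,p}^{(\infty)}=\frac{2^{d/2-1}}{1-2^{d/2-p}}$$ and, if $m\in[1,\infty)$, $\kappa_{d,p}^{(m)}=\min\{\kappa_{d,p,r}^{(m)}: r\ge2\}$ with $$\kappa_{d,p,r}^{(m)}=\sqrt{K_d^{(m)}}\,\frac{2^{p-1-d/2}r^{p+d/2}}{(r-1)^p(1-r^{d/2-p})}.$$ (ii) If $p=d/2$ and $q>2p$, then for all $m\in[1,\infty)\cup\{\infty\}$ and all $N\ge1$, $$\mathbb{E}[\mathcal{T}_p^{(m)}(\mu_N,\mu)]\le 2^p\frac{\kappa_{d,p,N}^{(m)}}{\sqrt N}[\mathcal{M}_q^{(m)}(\mu)]^{p/q}\,\theta_{d,p,q,N}^{(m)},\qquad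 \theta_{d,p,q,N}^{(m)}=H\Big(\frac{\varepsilon_p}{\kappa_{d,p,N}^{(m)}},2p,q\Big),$$ where (with $\log_+(x)=\max\{\log x,0\}$) $$\kappa_{d,p,N}^{(\infty)}=\frac{2^{p-1}}{p\log 2}\log_+\Big((2^{1-p}-2^{1-2p})\sqrt N\Big)+\frac{2^{p-1}}{1-2^{-p}}$$ and, if $m\in[1,\infty)$, $\kappa_{d,p,N}^{(m)}=\min\{\kappa_{d,p,N,r}^{(m)}: r\ge2\}$ with $$\kappa_{d,p,N,r}^{(m)}=\frac{\sqrt{K_d^{(m)}}}{2}\,\frac{r^{2p}}{(r-1)^p\,p\log r}\,\log_+\Big(2^{p+1}(r^{-p}-r^{-2p})\sqrt{\frac{N}{K_d^{(m)}}}\Big)+\frac{\sqrt{K_d^{(m)}}}{2}\,\frac{r^{3p}}{(r-1)^p(r^p-1)}.$$ (iii) If $p\in(0,d/2)$ and $q>dp/(d-p)$, then for all $m\in[1,\infty)\cup\{\infty\}$ and all $N\ge1$, $$\mathbb{E}[\mathcal{T}_p^{(m)}(\mu_N,\mu)]\le 2^p\frac{\kappa_{d,p}^{(m)}}{N^{p/d}}[\mathcal{M}_q^{(m)}(\mu)]^{p/q}\,\theta_{d,p,q}^{(m)},\qquad \theta_{d,p,q}^{(m)}=H\Big(\frac{2^{1-2p/d}\varepsilon_p}{\kappa_{d,p}^{(m)}},\frac{dp}{d-p},q\Big),$$ where $$\kappa_{d,p}^{(\infty)}=\frac{2^{p-2p/d}(1-2^{-d/2})^{1-2p/d}}{1-2^{p-d/2}}$$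 and, if $m\in[1,\infty)$, $\kappa_{d,p}^{(m)}=\min\{\kappa_{d,p,r}^{(m)}: r\ge2\}$ with $$\kappa_{d,p,r}^{(m)}=\Big(\frac{K_d^{(m)}}{4}\Big)^{p/d}\frac{r^{2p}(1-r^{-d/2})^{1-2p/d}}{(r-1)^p(1-r^{p-d/2})}.$$
   Context: $\mathcal{P}(\mathbb{R}^d)$ is the set of Borel probability measures on $\mathbb{R}^d$. For $x=(x_1,\dots,x_d)\in\mathbb{R}^d$, $|x|_m=(\sum_{i=1}^d|x_i|^m)^{1/m}$ for $m\in[1,\infty)$ and $|x|_\infty=\max\{|x_1|,\dots,|x_d|\}$. For $p>0$, $\mu,\nu\in\mathcal{P}(\mathbb{R}^d)$ and $m\in[1,\infty)\cup\{\infty\}$, $$\mathcal{T}_p^{(m)}(\mu,\nu)=\inf\Big\{\int_{\mathbb{R}^d\times\mathbb{R}^d}|x-y|_m^p\,\xi(dx,dy):\xi\in\mathcal{H}(\mu,\nu)\Big\},$$ where $\mathcal{H}(\mu,\nu)$ is the set of probability measures on $\mathbb{R}^d\times\mathbb{R}^d$ with marginals $\mu$ and $\nu$. For $q>0$, $\mathcal{M}_q^{(m)}(\mu)=\int_{\mathbb{R}^d}|x|_m^q\,\mu(dx)\in[0,\infty]$ (if it is infinite, the right-hand sides of the bounds are $+\infty$). For $x>0$ and $q>s>0$, $$H(x,s,q)=\Big(x\frac{q-s}{s}+(1+x)\Big(\frac{q}{s}\Big)^{q/(q-s)}\Big)^{s/q}\frac{q}{q-s}.$$ For $m\in[1,\infty)$,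 let $B_m(x,\varepsilon)=\{y\in\mathbb{R}^d:|x-y|_m<\varepsilon\}$; for $\varepsilon\in(0,1]$, $N_\varepsilon^{(m)}$ is the smallest $k\in\mathbb{N}$ such that there exist $x_1,\dots,x_k\in B_m(0,1)$ with $B_m(0,1)\subset\bigcup_{i=1}^kB_m(x_i,\varepsilon)$; and $K_d^{(m)}=\sup_{\varepsilon\in(0,1]}\varepsilon^dN_\varepsilon^{(m)}$. In the minima over $r\ge 2$, $r$ is a real number. *)

theory Defs
  imports "HOL-Probability.Probability"
begin

text \<open>
  The exponent \<open>m \<in> [1,\<infinity>) \<union> {\<infinity>}\<close> is an \<open>ereal\<close> with \<open>1 \<le> m\<close>. The dimension
  \<open>d\<close> is \<open>CARD('n)\<close>. Transport costs and moments take values in \<open>[0,\<infinity>]\<close>.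
\<close>

definition lnorm :: "ereal \<Rightarrow> real ^ 'n::finite \<Rightarrow> real" where
  "lnorm m x =
     (if m = \<infinity> then infnorm x
      else (\<Sum>i\<in>UNIV. \<bar>x $ i\<bar> powr real_of_ereal m) powr (1 / real_of_ereal m))"

definition couplings ::
  "(real ^ 'n::finite) measure \<Rightarrow> (real ^ 'n) measure \<Rightarrow> ((real ^ 'n) \<times> (real ^ 'n)) measure set" where
  "couplings \<mu> \<nu> =
     {\<xi>. prob_space \<xi> \<and> sets \<xi> = sets borel \<and> distr \<xi> borel fst = \<mu> \<and> distr \<xi> borel snd = \<nu>}"

definition transport_cost ::
  "real \<Rightarrow> ereal \<Rightarrow> (real ^ 'n::finite) measure \<Rightarrow> (real ^ 'n) measure \<Rightarrow> ennreal" where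
  "transport_cost p m \<mu> \<nu> =
     (INF \<xi>\<in>couplings \<mu> \<nu>. \<integral>\<^sup>+ (x, y). ennreal (lnorm m (x - y) powr p) \<partial>\<xi>)"

definition moment :: "real \<Rightarrow> ereal \<Rightarrow> (real ^ 'n::finite) measure \<Rightarrow> ennreal" where
  "moment q m \<mu> = (\<integral>\<^sup>+ x. ennreal (lnorm m x powr q) \<partial>\<mu>)"

text \<open>Powers of elements of \<open>[0,\<infinity>]\<close> with a positive real exponent, so that \<open>\<infinity>\<close> goes to \<open>\<infinity>\<close>.\<close>

definition ennpowr :: "ennreal \<Rightarrow> real \<Rightarrow> ennreal" where
  "ennpowr x a = (if x = \<infinity> then \<infinity> else ennreal (enn2real x powr a))"

definition empirical_measure :: "nat \<Rightarrow> (nat \<Rightarrow> real ^ 'n::finite) \<Rightarrow> (real ^ 'n) measure" where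
  "empirical_measure N x =
     measure_of UNIV (sets borel)
       (\<lambda>A. ennreal (1 / real N) * (\<Sum>k=1..N. emeasure (return borel (x k)) A))"

lemma sets_empirical_measure [simp]: "sets (empirical_measure N x) = sets borel"
  and space_empirical_measure [simp]: "space (empirical_measure N x) = UNIV"
  using sets.sigma_sets_eq[of borel]
  by (simp_all add: empirical_measure_def sets_measure_of_conv space_measure_of_conv)

text \<open>The set function above is a measure, so \<open>measure_of\<close> does not fall back to the null measure.\<close>

lemma emeasure_empirical_measure:
  fixes x :: "nat \<Rightarrow> real ^ 'n::finite"
  assumes A: "A \<in> sets borel"
  shows "emeasure (empirical_measure N x) A =
           ennreal (1 / real N) * (\<Sum>k=1..N. emeasure (return borel (x k)) A)"
proof (rule emeasure_measure_of[OF empirical_measure_def])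
  let ?f = "\<lambda>A. ennreal (1 / real N) * (\<Sum>k=1..N. emeasure (return borel (x k)) A)"
  show "positive (sets (empirical_measure N x)) ?f"
    by (simp add: positive_def)
  show "countably_additive (sets (empirical_measure N x)) ?f"
  proof (rule countably_additiveI)
    fix B :: "nat \<Rightarrow> (real ^ 'n) set"
    assume B: "range B \<subseteq> sets (empirical_measure N x)" "disjoint_family B"
    have "(\<Sum>i. ?f (B i)) = ennreal (1 / real N) *
            (\<Sum>i. \<Sum>k=1..N. emeasure (return borel (x k)) (B i))"
      by (rule ennreal_suminf_cmult)
    also have "(\<Sum>i. \<Sum>k=1..N. emeasure (return borel (x k)) (B i)) =
            (\<Sum>k=1..N. \<Sum>i. emeasure (return borel (x k)) (B i))"
      by (rule suminf_sum) simp
    also have "\<dots> = (\<Sum>k=1..N. emeasure (return borel (x k)) (\<Union>i. B i))"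
      using B by (intro sum.cong refl suminf_emeasure) auto
    finally show "(\<Sum>i. ?f (B i)) = ?f (\<Union>i. B i)" .
  qed
  show "sets borel \<subseteq> Pow UNIV" by simp
  show "A \<in> sets (empirical_measure N x)" using A by simp
qed

lemma prob_space_empirical_measure:
  assumes "N \<ge> 1"
  shows "prob_space (empirical_measure N x)"
proof
  have "emeasure (empirical_measure N x) UNIV = ennreal (1 / real N) * ennreal (real N)"
    by (simp add: emeasure_empirical_measure ennreal_of_nat_eq_real_of_nat)
  also have "\<dots> = 1"
    using assms by (simp flip: ennreal_mult)
  finally show "emeasure (empirical_measure N x) (space (empirical_measure N x)) = 1" by simp
qed

definition H :: "real \<Rightarrow> real \<Rightarrow> real \<Rightarrow> real" where
  "H x s q = (x * ((q - s) / s) + (1 + x) * (q / s) powr (q / (q - s))) powr (s / q) * (q / (q - s))"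

definition lball :: "ereal \<Rightarrow> real ^ 'n::finite \<Rightarrow> real \<Rightarrow> (real ^ 'n) set" where
  "lball m x \<epsilon> = {y. lnorm m (x - y) < \<epsilon>}"

definition cover_num :: "'n::finite itself \<Rightarrow> ereal \<Rightarrow> real \<Rightarrow> nat" where
  "cover_num _ m \<epsilon> =
     (LEAST k. \<exists>x :: nat \<Rightarrow> real ^ 'n.
        (\<forall>i\<in>{1..k}. x i \<in> lball m 0 1) \<and> lball m 0 1 \<subseteq> (\<Union>i\<in>{1..k}. lball m (x i) \<epsilon>))"

text \<open>The supremum is one of reals; the set is bounded above (by \<open>3 ^ d\<close>, comparing volumes).\<close>

definition cover_const :: "'n::finite itself \<Rightarrow> ereal \<Rightarrow> real" where
  "cover_const T m = (SUP \<epsilon>\<in>{0<..1}. \<epsilon> ^ CARD('n) * real (cover_num T m \<epsilon>))"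

definition eps_p :: "real \<Rightarrow> real" where
  "eps_p p = max (2 powr (-1)) (2 powr (-p))"

definition log_plus :: "real \<Rightarrow> real" where
  "log_plus x = max (ln x) 0"

text \<open>
  In the three constants below, the minimum over real \<open>r \<ge> 2\<close> is written as an infimum.
  It is attained: the expressions are positive, continuous in \<open>r\<close> on \<open>[2,\<infinity>)\<close>,
  and tend to \<open>\<infinity>\<close> as \<open>r\<close> does.
\<close>

definition kappa_super_r :: "'n::finite itself \<Rightarrow> real \<Rightarrow> ereal \<Rightarrow> real \<Rightarrow> real" where
  "kappa_super_r T p m r =
     (let d = real CARD('n) in
        sqrt (cover_const T m) *
        (2 powr (p - 1 - d / 2) * r powr (p + d / 2) /
         ((r - 1) powr p * (1 - r powr (d / 2 - p)))))"

definition kappa_super :: "'n::finite itself \<Rightarrow> real \<Rightarrow> ereal \<Rightarrow> real" where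
  "kappa_super T p m =
     (let d = real CARD('n) in
        if m = \<infinity> then 2 powr (d / 2 - 1) / (1 - 2 powr (d / 2 - p))
        else (INF r\<in>{2..}. kappa_super_r T p m r))"

definition kappa_crit_r :: "'n::finite itself \<Rightarrow> real \<Rightarrow> nat \<Rightarrow> ereal \<Rightarrow> real \<Rightarrow> real" where
  "kappa_crit_r T p N m r =
     (let K = cover_const T m in
        sqrt K / 2 * (r powr (2 * p) / ((r - 1) powr p * p * ln r)) *
          log_plus (2 powr (p + 1) * (r powr (-p) - r powr (-2 * p)) * sqrt (real N / K))
        + sqrt K / 2 * (r powr (3 * p) / ((r - 1) powr p * (r powr p - 1))))"

definition kappa_crit :: "'n::finite itself \<Rightarrow> real \<Rightarrow> nat \<Rightarrow> ereal \<Rightarrow> real" where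
  "kappa_crit T p N m =
     (if m = \<infinity> then
        2 powr (p - 1) / (p * ln 2) *
          log_plus ((2 powr (1 - p) - 2 powr (1 - 2 * p)) * sqrt (real N))
        + 2 powr (p - 1) / (1 - 2 powr (-p))
      else (INF r\<in>{2..}. kappa_crit_r T p N m r))"

definition kappa_sub_r :: "'n::finite itself \<Rightarrow> real \<Rightarrow> ereal \<Rightarrow> real \<Rightarrow> real" where
  "kappa_sub_r T p m r =
     (let d = real CARD('n) in
        (cover_const T m / 4) powr (p / d) *
        (r powr (2 * p) * (1 - r powr (- d / 2)) powr (1 - 2 * p / d) /
         ((r - 1) powr p * (1 - r powr (p - d / 2)))))"

definition kappa_sub :: "'n::finite itself \<Rightarrow> real \<Rightarrow> ereal \<Rightarrow> real" where
  "kappa_sub T p m =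
     (let d = real CARD('n) in
        if m = \<infinity> then
          2 powr (p - 2 * p / d) * (1 - 2 powr (- d / 2)) powr (1 - 2 * p / d) /
          (1 - 2 powr (p - d / 2))
        else (INF r\<in>{2..}. kappa_sub_r T p m r))"

definition theta_super :: "'n::finite itself \<Rightarrow> real \<Rightarrow> real \<Rightarrow> ereal \<Rightarrow> real" where
  "theta_super T p q m = H (eps_p p / kappa_super T p m) (2 * p) q"

definition theta_crit :: "'n::finite itself \<Rightarrow> real \<Rightarrow> real \<Rightarrow> nat \<Rightarrow> ereal \<Rightarrow> real" where
  "theta_crit T p q N m = H (eps_p p / kappa_crit T p N m) (2 * p) q"

definition theta_sub :: "'n::finite itself \<Rightarrow> real \<Rightarrow> real \<Rightarrow> ereal \<Rightarrow> real" where
  "theta_sub T p q m =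
     (let d = real CARD('n) in
        H (2 powr (1 - 2 * p / d) * eps_p p / kappa_sub T p m) (d * p / (d - p)) q)"

end

theory Submission
  imports Defs
begin

text \<open>
  The transport cost between the empirical measure \<open>\<mu>\<^sub>N\<close> and \<open>\<mu>\<close> is bounded by the cost of one explicit
  coupling, built from the bottom up on a tree of cells. Space is cut into the annuli
  \<open>t a\<^sup>i\<^sup>-\<^sup>1 \<le> |x| < t a\<^sup>i\<close>, and each annulus into finite partitions that refine one another; relative to the
  outer radius, level \<open>k \<ge> 1\<close> has at most \<open>A r\<^sup>d\<^sup>k\<close> cells, of diameter at most \<open>\<delta> r\<^sup>-\<^sup>k\<close>. Inside the finest cells as
  much mass of \<open>\<mu>\<^sub>N\<close> and \<open>\<mu>\<close> as possible is paired, what is left is paired inside the cells of the next coarser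
  level, and so on up to the annuli; the mass that is still unpaired travels between annuli
  (\<open>hierarchical_coupling\<close>). The mass left over at a level is the sum of the positive parts of
  \<open>\<mu>\<^sub>N(F) - \<mu>(F)\<close> over its cells \<open>F\<close>, whose expectations are at most \<open>min (\<mu>(F)) (sqrt (\<mu>(F)/N) / 2)\<close> because
  \<open>N \<mu>\<^sub>N(F)\<close> is binomial (\<open>expected_deviation\<close>).

  By Cauchy-Schwarz over the cells, an annulus of outer radius \<open>R\<close> and mass \<open>x\<close> contributes at most
  \<open>\<delta>\<^sup>p R\<^sup>p \<Sum>\<^sub>k (\<rho>\<^sup>k - \<rho>\<^sup>k\<^sup>+\<^sup>1) min x (sqrt (A r\<^sup>d\<^sup>(\<^sup>k\<^sup>+\<^sup>1\<^sup>) x / N) / 2)\<close> with \<open>\<rho> = r\<^sup>-\<^sup>p\<close>. The decay \<open>r\<^sup>-\<^sup>p\<close> competes with the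
  growth \<open>r\<^sup>d\<^sup>/\<^sup>2\<close>. For \<open>p > d/2\<close> the series is geometric and governed by its first term; for \<open>p = d/2\<close> its terms
  are constant up to the level at which the two arguments of the minimum cross, which gives the logarithm; for
  \<open>p < d/2\<close> the crossing level dominates, which changes the rate to \<open>N\<^sup>-\<^sup>p\<^sup>/\<^sup>d\<close> (lemmas \<open>level_sum_\<dots>\<close>). In all cases
  the annulus contributes a multiple of \<open>R\<^sup>p x\<^sup>p\<^sup>/\<^sup>s\<close>, where \<open>s = 2p\<close>, respectively \<open>s = dp/(d-p)\<close>.

  Markov's inequality turns the moment of order \<open>q > s\<close> into bounds for the masses of the annuli, so the sum
  over the annuli is again geometric. The choices \<open>a\<^sup>p\<^sup>(\<^sup>q\<^sup>-\<^sup>s\<^sup>)\<^sup>/\<^sup>s = q/s\<close> for the ratio, and then of the scale \<open>t\<close> that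
  balances the central ball against the remaining annuli, produce the factor \<open>H\<close> (\<open>cost_bound_from_moment\<close>).

  The partitions are dyadic cubes for \<open>m = \<infinity>\<close>, with \<open>r = 2\<close>, \<open>A = 1\<close>, \<open>\<delta> = 2\<close>. For \<open>m < \<infinity>\<close> and any real \<open>r \<ge> 2\<close> they
  come from optimal coverings by balls of radius \<open>2 r\<^sup>-\<^sup>k\<close>, with \<open>A = K 2\<^sup>-\<^sup>d\<close> and \<open>\<delta> = 4r/(r-1)\<close>. As the bound is
  continuous in \<open>\<kappa>\<close>, it passes from each \<open>r\<close> to the infimum over \<open>r\<close> (\<open>bound_at_Inf\<close>).
\<close>

section \<open>Hierarchical matching of two laws\<close>

text \<open>The excess collects, cell by cell, the mass that \<open>\<mu>\<close> has in surplus over \<open>\<nu>\<close>, weighted by \<open>\<phi>\<close>; subtraction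
  in \<open>[0,\<infinity>]\<close> is truncated, so it takes the positive part.\<close>

definition excess ::
  "('a \<Rightarrow> 'c) \<Rightarrow> ('c \<Rightarrow> ennreal) \<Rightarrow> 'a measure \<Rightarrow> 'a measure \<Rightarrow> ennreal" where
  "excess c \<phi> \<mu> \<nu> =
     (\<integral>\<^sup>+ i. \<phi> i * (emeasure \<mu> (c -` {i}) - emeasure \<nu> (c -` {i})) \<partial>count_space UNIV)"

text \<open>Fubini's theorem with the counting measure on the cells.\<close>

lemma nn_integral_by_cells:
  fixes c :: "'a \<Rightarrow> 'c::countable"
  assumes [measurable]: "c \<in> measurable \<mu> (count_space UNIV)" "u \<in> borel_measurable \<mu>"
  shows "(\<integral>\<^sup>+ x. \<phi> (c x) * u x \<partial>\<mu>) =
         (\<integral>\<^sup>+ i. \<phi> i * (\<integral>\<^sup>+ x. u x * indicator (c -` {i}) x \<partial>\<mu>) \<partial>count_space UNIV)"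
proof -
  have pt: "\<phi> (c x) * u x = (\<integral>\<^sup>+ i. \<phi> i * (u x * indicator (c -` {i}) x) \<partial>count_space UNIV)" for x
  proof -
    have "(\<integral>\<^sup>+ i. \<phi> i * (u x * indicator (c -` {i}) x) \<partial>count_space UNIV)
        = (\<integral>\<^sup>+ i. (\<phi> i * u x) * indicator {c x} i \<partial>count_space UNIV)"
      by (intro nn_integral_cong) (auto simp: indicator_def)
    also have "\<dots> = \<phi> (c x) * u x" by (subst nn_integral_indicator_singleton) auto
    finally show ?thesis by simp
  qed
  have [measurable]: "indicator (c -` {i}) \<in> borel_measurable \<mu>" for i
  proof -
    have "(\<lambda>x. indicator {i} (c x) :: ennreal) \<in> borel_measurable \<mu>"
      by measurable
    moreover have "(\<lambda>x. indicator {i} (c x) :: ennreal) = indicator (c -` {i})"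
      by (auto simp: indicator_def fun_eq_iff)
    ultimately show ?thesis by simp
  qed
  have "(\<integral>\<^sup>+ x. \<phi> (c x) * u x \<partial>\<mu>) =
      (\<integral>\<^sup>+ x. \<integral>\<^sup>+ i. \<phi> i * (u x * indicator (c -` {i}) x) \<partial>count_space UNIV \<partial>\<mu>)"
    using pt by simp
  also have "\<dots> = (\<integral>\<^sup>+ i. \<integral>\<^sup>+ x. \<phi> i * (u x * indicator (c -` {i}) x) \<partial>\<mu> \<partial>count_space UNIV)"
    by (rule nn_integral_count_space_nn_integral) auto
  also have "\<dots> = (\<integral>\<^sup>+ i. \<phi> i * (\<integral>\<^sup>+ x. u x * indicator (c -` {i}) x \<partial>\<mu>) \<partial>count_space UNIV)"
    by (intro nn_integral_cong nn_integral_cmult) auto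
  finally show ?thesis .
qed

text \<open>The arithmetic of matching a mass \<open>a\<close> with a mass \<open>b\<close> proportionally: the coupling density is divided by
  \<open>max a b\<close>, so that the smaller mass is used up and the truncated difference remains of the larger. The value
  \<open>0\<close> for an empty cell replaces \<open>1 / 0 = \<infinity>\<close>.\<close>

lemma proportional_remainder:
  fixes a b lam :: ennreal
  assumes "a < \<infinity>" "b < \<infinity>"
    and lam: "lam = (if max a b = 0 then 0 else 1 / max a b)"
  shows "lam * b \<le> 1" "a * (1 - lam * b) = a - b"
proof -
  obtain s where s: "a = ennreal s" "0 \<le> s" using assms(1) by (cases a) auto
  obtain t where t: "b = ennreal t" "0 \<le> t" using assms(2) by (cases b) auto
  have "lam * b \<le> 1 \<and> a * (1 - lam * b) = a - b"
  proof (cases "max a b = 0")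
    case True
    then show ?thesis by (simp add: lam max_def split: if_splits)
  next
    case False
    have m: "max a b = ennreal (max s t)" using s t by (simp add: max_def ennreal_le_iff)
    have pos: "max s t > 0" using False m s t by (auto simp: less_max_iff_disj less_le)
    have l: "lam = ennreal (1 / max s t)"
      using False m pos by (simp add: lam divide_ennreal flip: ennreal_1)
    have lb: "lam * b = ennreal (t / max s t)"
      using l t pos by (simp flip: ennreal_mult)
    have le1: "t / max s t \<le> 1" using pos t by (simp add: divide_le_eq)
    have "1 - lam * b = ennreal (1 - t / max s t)"
      using lb t pos by (simp add: ennreal_minus flip: ennreal_1)
    then have "a * (1 - lam * b) = ennreal (s * (1 - t / max s t))"
      using s le1 by (simp add: ennreal_mult)
    also have "\<dots> = ennreal (s - t)"
    proof (cases "s \<ge> t")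
      case True
      then show ?thesis using pos by (simp add: max_def field_simps)
    next
      case False
      then show ?thesis using pos s t by (simp add: max_def ennreal_neg)
    qed
    also have "\<dots> = a - b" using s t by (simp add: ennreal_minus)
    finally show ?thesis using lb le1 by (simp add: ennreal_le_1)
  qed
  then show "lam * b \<le> 1" "a * (1 - lam * b) = a - b" by auto
qed

locale two_laws =
  fixes \<mu> \<nu> :: "'a::second_countable_topology measure"
  assumes prob_first: "prob_space \<mu>" and prob_second: "prob_space \<nu>"
    and sets_first [measurable_cong, simp]: "sets \<mu> = sets borel"
    and sets_second [measurable_cong, simp]: "sets \<nu> = sets borel"
begin

sublocale first: prob_space \<mu> by (rule prob_first)
sublocale second: prob_space \<nu> by (rule prob_second)
sublocale pair: pair_prob_space \<mu> \<nu> ..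

lemma space_first [simp]: "space \<mu> = UNIV"
  using sets_eq_imp_space_eq[OF sets_first] by simp

lemma space_second [simp]: "space \<nu> = UNIV"
  using sets_eq_imp_space_eq[OF sets_second] by simp

text \<open>A partial plan is a density \<open>h\<close> of already transported mass with respect to \<open>\<mu> \<Otimes> \<nu>\<close>; \<open>u\<close> and \<open>v\<close> are the
  densities, with respect to \<open>\<mu>\<close> and \<open>\<nu>\<close>, of the mass that is still to be transported. All couplings below
  are absolutely continuous with respect to the product, so plain functions replace sums of measures.\<close>

definition partial_plan ::
  "('a \<Rightarrow> 'a \<Rightarrow> ennreal) \<Rightarrow> ('a \<Rightarrow> ennreal) \<Rightarrow> ('a \<Rightarrow> ennreal) \<Rightarrow> bool" where
  "partial_plan h u v \<longleftrightarrow>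
     case_prod h \<in> borel_measurable (\<mu> \<Otimes>\<^sub>M \<nu>) \<and>
     u \<in> borel_measurable borel \<and> v \<in> borel_measurable borel \<and>
     (\<forall>x. u x + (\<integral>\<^sup>+ y. h x y \<partial>\<nu>) = 1) \<and> (\<forall>y. v y + (\<integral>\<^sup>+ x. h x y \<partial>\<mu>) = 1)"

definition plan_cost :: "('a \<Rightarrow> 'a \<Rightarrow> ennreal) \<Rightarrow> ('a \<Rightarrow> 'a \<Rightarrow> ennreal) \<Rightarrow> ennreal" where
  "plan_cost cst h = (\<integral>\<^sup>+ x. \<integral>\<^sup>+ y. cst x y * h x y \<partial>\<nu> \<partial>\<mu>)"

lemma plan_cost_add:
  assumes [measurable]: "case_prod cst \<in> borel_measurable (\<mu> \<Otimes>\<^sub>M \<nu>)"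
    "case_prod h \<in> borel_measurable (\<mu> \<Otimes>\<^sub>M \<nu>)" "case_prod t \<in> borel_measurable (\<mu> \<Otimes>\<^sub>M \<nu>)"
  shows "plan_cost cst (\<lambda>x y. h x y + t x y) = plan_cost cst h + plan_cost cst t"
  unfolding plan_cost_def by (simp add: distrib_left nn_integral_add)

text \<open>As long as mass has only moved within cells, each cell has sent out as much as it has received. Hence the
  difference of the two remaining masses of a cell is the original difference \<open>\<mu> - \<nu>\<close>, whatever the plan was.\<close>

lemma mass_split_by_cells:
  fixes c :: "'a \<Rightarrow> 'c::countable"
  assumes plan: "partial_plan h u v"
    and c [measurable]: "c \<in> measurable borel (count_space UNIV)"
    and within: "\<And>x y. h x y \<noteq> 0 \<Longrightarrow> c x = c y"
  obtains m where
    "(\<integral>\<^sup>+ x. u x * indicator (c -` {i}) x \<partial>\<mu>) + m = emeasure \<mu> (c -` {i})"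
    "(\<integral>\<^sup>+ y. v y * indicator (c -` {i}) y \<partial>\<nu>) + m = emeasure \<nu> (c -` {i})"
proof -
  have [measurable]: "case_prod h \<in> borel_measurable (\<mu> \<Otimes>\<^sub>M \<nu>)"
    "u \<in> borel_measurable borel" "v \<in> borel_measurable borel"
    and hu: "\<And>x. u x + (\<integral>\<^sup>+ y. h x y \<partial>\<nu>) = 1" and hv: "\<And>y. v y + (\<integral>\<^sup>+ x. h x y \<partial>\<mu>) = 1"
    using plan by (auto simp: partial_plan_def)
  have S [measurable]: "c -` {i} \<in> sets borel"
    using measurable_sets[OF c, of "{i}"] by simp
  define m where "m = (\<integral>\<^sup>+ x. \<integral>\<^sup>+ y. h x y * indicator (c -` {i}) x \<partial>\<nu> \<partial>\<mu>)"
  have m2: "m = (\<integral>\<^sup>+ y. \<integral>\<^sup>+ x. h x y * indicator (c -` {i}) y \<partial>\<mu> \<partial>\<nu>)"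
  proof -
    have "m = (\<integral>\<^sup>+ x. \<integral>\<^sup>+ y. h x y * indicator (c -` {i}) y \<partial>\<nu> \<partial>\<mu>)"
      unfolding m_def
    proof (intro nn_integral_cong)
      fix x y
      show "h x y * indicator (c -` {i}) x = h x y * indicator (c -` {i}) y"
        using within[of x y] by (cases "h x y = 0") (auto simp: indicator_def)
    qed
    also have "\<dots> = (\<integral>\<^sup>+ y. \<integral>\<^sup>+ x. h x y * indicator (c -` {i}) y \<partial>\<mu> \<partial>\<nu>)"
      by (intro pair.Fubini'[symmetric]) measurable
    finally show ?thesis .
  qed
  have "(\<integral>\<^sup>+ x. u x * indicator (c -` {i}) x \<partial>\<mu>) + m = 
     (\<integral>\<^sup>+ x. u x * indicator (c -` {i}) x + (\<integral>\<^sup>+ y. h x y * indicator (c -` {i}) x \<partial>\<nu>) \<partial>\<mu>)"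
    unfolding m_def by (subst nn_integral_add) auto
  also have "\<dots> = (\<integral>\<^sup>+ x. indicator (c -` {i}) x \<partial>\<mu>)"
  proof (intro nn_integral_cong)
    fix x
    have "(\<integral>\<^sup>+ y. h x y * indicator (c -` {i}) x \<partial>\<nu>) = (\<integral>\<^sup>+ y. h x y \<partial>\<nu>) * indicator (c -` {i}) x"
      by (rule nn_integral_multc) measurable
    then show "u x * indicator (c -` {i}) x + (\<integral>\<^sup>+ y. h x y * indicator (c -` {i}) x \<partial>\<nu>) = indicator (c -` {i}) x"
      using hu[of x] by (simp flip: distrib_right)
  qed
  finally have 1: "(\<integral>\<^sup>+ x. u x * indicator (c -` {i}) x \<partial>\<mu>) + m = emeasure \<mu> (c -` {i})" by simp
  have "(\<integral>\<^sup>+ y. v y * indicator (c -` {i}) y \<partial>\<nu>) + m = 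
     (\<integral>\<^sup>+ y. v y * indicator (c -` {i}) y + (\<integral>\<^sup>+ x. h x y * indicator (c -` {i}) y \<partial>\<mu>) \<partial>\<nu>)"
    unfolding m2 by (subst nn_integral_add) auto
  also have "\<dots> = (\<integral>\<^sup>+ y. indicator (c -` {i}) y \<partial>\<nu>)"
  proof (intro nn_integral_cong)
    fix y
    have "(\<integral>\<^sup>+ x. h x y * indicator (c -` {i}) y \<partial>\<mu>) = (\<integral>\<^sup>+ x. h x y \<partial>\<mu>) * indicator (c -` {i}) y"
      by (rule nn_integral_multc) measurable
    then show "v y * indicator (c -` {i}) y + (\<integral>\<^sup>+ x. h x y * indicator (c -` {i}) y \<partial>\<mu>) = indicator (c -` {i}) y"
      using hv[of y] by (simp flip: distrib_right)
  qed
  finally have 2: "(\<integral>\<^sup>+ y. v y * indicator (c -` {i}) y \<partial>\<nu>) + m = emeasure \<nu> (c -` {i})" by simp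
  show ?thesis using 1 2 that by blast
qed

text \<open>A plan that is finished at the level of \<open>c\<close>: mass has moved within cells only, and in each cell what remains
  is the surplus of one law over the other.\<close>

definition level_plan ::
  "('a \<Rightarrow> 'c) \<Rightarrow> ('a \<Rightarrow> 'a \<Rightarrow> ennreal) \<Rightarrow> ('a \<Rightarrow> ennreal) \<Rightarrow> ('a \<Rightarrow> ennreal) \<Rightarrow> bool" where
  "level_plan c h u v \<longleftrightarrow> partial_plan h u v \<and> (\<forall>x y. h x y \<noteq> 0 \<longrightarrow> c x = c y) \<and>
    (\<forall>i. (\<integral>\<^sup>+ x. u x * indicator (c -` {i}) x \<partial>\<mu>) = emeasure \<mu> (c -` {i}) - emeasure \<nu> (c -` {i})) \<and>
    (\<forall>i. (\<integral>\<^sup>+ y. v y * indicator (c -` {i}) y \<partial>\<nu>) = emeasure \<nu> (c -` {i}) - emeasure \<mu> (c -` {i}))"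

lemma level_planD:
  assumes "level_plan c h u v"
  shows "partial_plan h u v" "h x y \<noteq> 0 \<Longrightarrow> c x = c y"
    "(\<integral>\<^sup>+ x. u x * indicator (c -` {i}) x \<partial>\<mu>) = emeasure \<mu> (c -` {i}) - emeasure \<nu> (c -` {i})"
    "(\<integral>\<^sup>+ y. v y * indicator (c -` {i}) y \<partial>\<nu>) = emeasure \<nu> (c -` {i}) - emeasure \<mu> (c -` {i})"
  using assms unfolding level_plan_def by blast+

text \<open>One matching step: in every cell as much as possible of the remaining mass is paired by the product of the
  two remaining densities. Afterwards each cell keeps exactly the positive part of its difference, and this
  depends on the cell only, not on the steps before.\<close>

lemma match_within_cells:
  fixes c :: "'a \<Rightarrow> 'c::countable"
  assumes plan: "partial_plan h u v"
    and c [measurable]: "c \<in> measurable borel (count_space UNIV)"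
    and within: "\<And>x y. h x y \<noteq> 0 \<Longrightarrow> c x = c y"
  shows "\<exists>t u' v'. case_prod t \<in> borel_measurable (\<mu> \<Otimes>\<^sub>M \<nu>) \<and>
    level_plan c (\<lambda>x y. h x y + t x y) u' v' \<and>
    (\<forall>x y. t x y \<noteq> 0 \<longrightarrow> c x = c y) \<and>
    (\<forall>x. u' x + (\<integral>\<^sup>+ y. t x y \<partial>\<nu>) = u x) \<and> (\<forall>y. v' y + (\<integral>\<^sup>+ x. t x y \<partial>\<mu>) = v y)"
proof -
  have [measurable]: "case_prod h \<in> borel_measurable (\<mu> \<Otimes>\<^sub>M \<nu>)"
    "u \<in> borel_measurable borel" "v \<in> borel_measurable borel"
    and hu: "\<And>x. u x + (\<integral>\<^sup>+ y. h x y \<partial>\<nu>) = 1" and hv: "\<And>y. v y + (\<integral>\<^sup>+ x. h x y \<partial>\<mu>) = 1"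
    using plan by (auto simp: partial_plan_def)
  have S [measurable]: "c -` {i} \<in> sets borel" for i
    using measurable_sets[OF c, of "{i}"] by simp
  define a where "a i = (\<integral>\<^sup>+ x. u x * indicator (c -` {i}) x \<partial>\<mu>)" for i
  define b where "b i = (\<integral>\<^sup>+ y. v y * indicator (c -` {i}) y \<partial>\<nu>)" for i
  have ab: "a i - b i = emeasure \<mu> (c -` {i}) - emeasure \<nu> (c -` {i})"
    "b i - a i = emeasure \<nu> (c -` {i}) - emeasure \<mu> (c -` {i})"
    "a i < \<infinity>" "b i < \<infinity>" for i
  proof -
    obtain m where m: "a i + m = emeasure \<mu> (c -` {i})" "b i + m = emeasure \<nu> (c -` {i})"
      using mass_split_by_cells[OF plan c within] unfolding a_def b_def by metis
    have "a i + m < \<infinity>" "b i + m < \<infinity>"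
      using m by (auto simp: first.emeasure_finite second.emeasure_finite less_top[symmetric])
    then show "a i < \<infinity>" "b i < \<infinity>" by auto
    have "m < \<infinity>" using \<open>a i + m < \<infinity>\<close> by auto
    then show "a i - b i = emeasure \<mu> (c -` {i}) - emeasure \<nu> (c -` {i})"
      "b i - a i = emeasure \<nu> (c -` {i}) - emeasure \<mu> (c -` {i})"
      unfolding m[symmetric]
      by (cases "a i"; cases "b i"; cases m; simp add: ennreal_minus flip: ennreal_plus)+
  qed
  (* The remaining masses a i and b i are at most 1, so lam i is finite, also for an empty cell. *)
  define lam where "lam i = (if max (a i) (b i) = 0 then 0 else 1 / max (a i) (b i))" for i
  have rem1: "lam i * b i \<le> 1" "a i * (1 - lam i * b i) = a i - b i" for i
    using proportional_remainder[OF ab(3,4)[of i] lam_def] by auto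
  have rem2: "lam i * a i \<le> 1" "b i * (1 - lam i * a i) = b i - a i" for i
    using proportional_remainder[OF ab(4,3)[of i], of "lam i"] by (auto simp: lam_def max.commute)
  define t where "t x y = (if c x = c y then u x * v y * lam (c x) else 0)" for x y
  define u' where "u' x = u x * (1 - lam (c x) * b (c x))" for x
  define v' where "v' y = v y * (1 - lam (c y) * a (c y))" for y
  have t_meas [measurable]: "case_prod t \<in> borel_measurable (\<mu> \<Otimes>\<^sub>M \<nu>)"
    unfolding t_def by measurable
  have [measurable]: "u' \<in> borel_measurable borel" "v' \<in> borel_measurable borel"
    unfolding u'_def v'_def by measurable
  have tu: "(\<integral>\<^sup>+ y. t x y \<partial>\<nu>) = u x * (lam (c x) * b (c x))" for x
  proof -
    have "(\<integral>\<^sup>+ y. t x y \<partial>\<nu>) = (\<integral>\<^sup>+ y. (u x * lam (c x)) * (v y * indicator (c -` {c x}) y) \<partial>\<nu>)"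
      by (intro nn_integral_cong) (auto simp: t_def indicator_def ac_simps)
    also have "\<dots> = u x * (lam (c x) * b (c x))"
      by (subst nn_integral_cmult) (auto simp: b_def ac_simps)
    finally show ?thesis .
  qed
  have tv: "(\<integral>\<^sup>+ x. t x y \<partial>\<mu>) = v y * (lam (c y) * a (c y))" for y
  proof -
    have "(\<integral>\<^sup>+ x. t x y \<partial>\<mu>) = (\<integral>\<^sup>+ x. (v y * lam (c y)) * (u x * indicator (c -` {c y}) x) \<partial>\<mu>)"
      by (intro nn_integral_cong) (auto simp: t_def indicator_def ac_simps)
    also have "\<dots> = v y * (lam (c y) * a (c y))"
      by (subst nn_integral_cmult) (auto simp: a_def ac_simps)
    finally show ?thesis .
  qed
  have u't: "u' x + (\<integral>\<^sup>+ y. t x y \<partial>\<nu>) = u x" for x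
    unfolding tu u'_def using rem1(1)[of "c x"]
    by (simp add: diff_add_cancel_ennreal flip: distrib_left)
  have v't: "v' y + (\<integral>\<^sup>+ x. t x y \<partial>\<mu>) = v y" for y
    unfolding tv v'_def using rem2(1)[of "c y"]
    by (simp add: diff_add_cancel_ennreal flip: distrib_left)
  have plan': "partial_plan (\<lambda>x y. h x y + t x y) u' v'"
    unfolding partial_plan_def
  proof (intro conjI allI)
    fix x
    have "(\<integral>\<^sup>+ y. h x y + t x y \<partial>\<nu>) = (\<integral>\<^sup>+ y. h x y \<partial>\<nu>) + (\<integral>\<^sup>+ y. t x y \<partial>\<nu>)"
      by (rule nn_integral_add) measurable
    then show "u' x + (\<integral>\<^sup>+ y. h x y + t x y \<partial>\<nu>) = 1"
      using u't[of x] hu[of x] by (simp add: ac_simps) (metis add.assoc add.commute)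
  next
    fix y
    have "(\<integral>\<^sup>+ x. h x y + t x y \<partial>\<mu>) = (\<integral>\<^sup>+ x. h x y \<partial>\<mu>) + (\<integral>\<^sup>+ x. t x y \<partial>\<mu>)"
      by (rule nn_integral_add) measurable
    then show "v' y + (\<integral>\<^sup>+ x. h x y + t x y \<partial>\<mu>) = 1"
      using v't[of y] hv[of y] by (simp add: ac_simps) (metis add.assoc add.commute)
  qed measurable
  have u'i: "(\<integral>\<^sup>+ x. u' x * indicator (c -` {i}) x \<partial>\<mu>) = emeasure \<mu> (c -` {i}) - emeasure \<nu> (c -` {i})" for i
  proof -
    have "(\<integral>\<^sup>+ x. u' x * indicator (c -` {i}) x \<partial>\<mu>)
        = (\<integral>\<^sup>+ x. (u x * indicator (c -` {i}) x) * (1 - lam i * b i) \<partial>\<mu>)"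
      by (intro nn_integral_cong) (auto simp: u'_def indicator_def)
    also have "\<dots> = a i * (1 - lam i * b i)"
      by (subst nn_integral_multc) (auto simp: a_def)
    finally show ?thesis using rem1(2) ab(1) by simp
  qed
  have v'i: "(\<integral>\<^sup>+ y. v' y * indicator (c -` {i}) y \<partial>\<nu>) = emeasure \<nu> (c -` {i}) - emeasure \<mu> (c -` {i})" for i
  proof -
    have "(\<integral>\<^sup>+ y. v' y * indicator (c -` {i}) y \<partial>\<nu>)
        = (\<integral>\<^sup>+ y. (v y * indicator (c -` {i}) y) * (1 - lam i * a i) \<partial>\<nu>)"
      by (intro nn_integral_cong) (auto simp: v'_def indicator_def)
    also have "\<dots> = b i * (1 - lam i * a i)"
      by (subst nn_integral_multc) (auto simp: b_def)
    finally show ?thesis using rem2(2) ab(2) by simp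
  qed
  have tc: "t x y \<noteq> 0 \<longrightarrow> c x = c y" for x y by (auto simp: t_def split: if_splits)
  have "h x y + t x y \<noteq> 0 \<longrightarrow> c x = c y" for x y using tc[of x y] within[of x y] by auto
  then have "level_plan c (\<lambda>x y. h x y + t x y) u' v'"
    unfolding level_plan_def by (intro conjI allI plan' u'i v'i)
  then show ?thesis
    by (intro exI conjI allI) (rule t_meas, assumption, rule tc, rule u't, rule v't)
qed

text \<open>The matching steps are iterated from the finest level \<open>L\<close> to level \<open>k\<close>. Mass that is paired at level \<open>k\<close> pays
  \<open>d k\<close>, weighted by \<open>G\<close>. The argument follows a potential, the cost so far plus \<open>d k\<close> times the weighted
  remaining mass: a step at level \<open>k\<close> does not increase it, and passing from \<open>d (k+1)\<close> to \<open>d k\<close> adds the price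
  difference for the mass that remains after level \<open>k+1\<close>. This is summation by parts without subtracting
  masses that might be infinite.\<close>

lemma hierarchical_matching:
  fixes C :: "nat \<Rightarrow> 'a \<Rightarrow> 'c::countable" and d :: "nat \<Rightarrow> real"
  assumes C [measurable]: "\<And>k. k \<le> L \<Longrightarrow> C k \<in> measurable borel (count_space UNIV)"
    and nested: "\<And>k x y. k < L \<Longrightarrow> C (Suc k) x = C (Suc k) y \<Longrightarrow> C k x = C k y"
    and d: "\<And>k. k < L \<Longrightarrow> d (Suc k) \<le> d k" "\<And>k. k \<le> L \<Longrightarrow> 0 \<le> d k"
    and G: "\<And>k x. k \<le> L \<Longrightarrow> G x = \<phi> k (C k x)" and [measurable]: "G \<in> borel_measurable borel"
    and cst [measurable]: "case_prod cst \<in> borel_measurable (\<mu> \<Otimes>\<^sub>M \<nu>)"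
    and bound: "\<And>k x y. k \<le> L \<Longrightarrow> C k x = C k y \<Longrightarrow> cst x y \<le> ennreal (d k) * G x"
    and k: "k \<le> L"
  shows "\<exists>h u v. level_plan (C k) h u v \<and>
     plan_cost cst h + ennreal (d k) * (\<integral>\<^sup>+ x. G x * u x \<partial>\<mu>)
       \<le> ennreal (d L) * (\<integral>\<^sup>+ x. G x \<partial>\<mu>) +
          (\<Sum>j\<in>{k..<L}. ennreal (d j - d (Suc j)) * excess (C (Suc j)) (\<phi> (Suc j)) \<mu> \<nu>)"
proof -
  have step: "\<exists>h' u' v'. level_plan (C k) h' u' v' \<and>
     plan_cost cst h' + ennreal (d k) * (\<integral>\<^sup>+ x. G x * u' x \<partial>\<mu>)
       \<le> plan_cost cst h + ennreal (d k) * (\<integral>\<^sup>+ x. G x * u x \<partial>\<mu>)"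
    if k: "k \<le> L" and plan: "partial_plan h u v" and within: "\<forall>x y. h x y \<noteq> 0 \<longrightarrow> C k x = C k y"
    for k h u v
  proof -
    obtain t u' v' where t: "case_prod t \<in> borel_measurable (\<mu> \<Otimes>\<^sub>M \<nu>)"
      "level_plan (C k) (\<lambda>x y. h x y + t x y) u' v'"
      "\<forall>x y. t x y \<noteq> 0 \<longrightarrow> C k x = C k y"
      "\<forall>x. u' x + (\<integral>\<^sup>+ y. t x y \<partial>\<nu>) = u x" "\<forall>y. v' y + (\<integral>\<^sup>+ x. t x y \<partial>\<mu>) = v y"
      using match_within_cells[OF plan C[OF k] within[rule_format]] by blast
    note [measurable] = t(1)
    have [measurable]: "case_prod h \<in> borel_measurable (\<mu> \<Otimes>\<^sub>M \<nu>)" "u' \<in> borel_measurable borel"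
      using plan level_planD(1)[OF t(2)] by (auto simp: partial_plan_def)
    have "plan_cost cst t + ennreal (d k) * (\<integral>\<^sup>+ x. G x * u' x \<partial>\<mu>)
        \<le> ennreal (d k) * (\<integral>\<^sup>+ x. G x * u x \<partial>\<mu>)"
    proof -
      have "plan_cost cst t \<le> (\<integral>\<^sup>+ x. \<integral>\<^sup>+ y. (ennreal (d k) * G x) * t x y \<partial>\<nu> \<partial>\<mu>)"
        unfolding plan_cost_def
      proof (intro nn_integral_mono)
        fix x y
        show "cst x y * t x y \<le> (ennreal (d k) * G x) * t x y"
          using bound[OF k t(3)[rule_format, of x y]] by (cases "t x y = 0") (auto intro: mult_right_mono)
      qed
      also have "\<dots> = (\<integral>\<^sup>+ x. ennreal (d k) * (G x * (\<integral>\<^sup>+ y. t x y \<partial>\<nu>)) \<partial>\<mu>)"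
        by (intro nn_integral_cong) (simp add: nn_integral_cmult mult.assoc)
      also have "\<dots> = ennreal (d k) * (\<integral>\<^sup>+ x. G x * (\<integral>\<^sup>+ y. t x y \<partial>\<nu>) \<partial>\<mu>)"
        by (rule nn_integral_cmult) measurable
      finally have "plan_cost cst t + ennreal (d k) * (\<integral>\<^sup>+ x. G x * u' x \<partial>\<mu>)
         \<le> ennreal (d k) * ((\<integral>\<^sup>+ x. G x * (\<integral>\<^sup>+ y. t x y \<partial>\<nu>) \<partial>\<mu>) + (\<integral>\<^sup>+ x. G x * u' x \<partial>\<mu>))"
        by (simp add: distrib_left add_right_mono)
      also have "(\<integral>\<^sup>+ x. G x * (\<integral>\<^sup>+ y. t x y \<partial>\<nu>) \<partial>\<mu>) + (\<integral>\<^sup>+ x. G x * u' x \<partial>\<mu>)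
         = (\<integral>\<^sup>+ x. G x * (\<integral>\<^sup>+ y. t x y \<partial>\<nu>) + G x * u' x \<partial>\<mu>)"
        by (rule nn_integral_add[symmetric]) measurable
      also have "\<dots> = (\<integral>\<^sup>+ x. G x * u x \<partial>\<mu>)"
        by (intro nn_integral_cong) (simp add: t(4)[rule_format, symmetric] distrib_left add.commute)
      finally show ?thesis .
    qed
    then have "plan_cost cst (\<lambda>x y. h x y + t x y) + ennreal (d k) * (\<integral>\<^sup>+ x. G x * u' x \<partial>\<mu>)
       \<le> plan_cost cst h + ennreal (d k) * (\<integral>\<^sup>+ x. G x * u x \<partial>\<mu>)"
      by (simp add: plan_cost_add add.assoc add_left_mono)
    with t(2) show ?thesis by (intro exI conjI)
  qed
  show ?thesis
    using k
  proof (induction "L - k" arbitrary: k)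
    case 0
    then have [simp]: "k = L" by simp
    have pl: "partial_plan (\<lambda>_ _. 0) (\<lambda>_. 1) (\<lambda>_. 1)" by (simp add: partial_plan_def)
    have w: "\<forall>x y. (0::ennreal) \<noteq> 0 \<longrightarrow> C L x = C L y" by simp
    from step[OF order_refl pl w] show ?case by (simp add: plan_cost_def)
  next
    case (Suc n)
    then have k: "k < L" by simp
    have nk: "n = L - Suc k" "Suc k \<le> L" using Suc.hyps(2) k by auto
    from Suc.hyps(1)[OF nk] obtain h u v where h: "level_plan (C (Suc k)) h u v"
      "plan_cost cst h + ennreal (d (Suc k)) * (\<integral>\<^sup>+ x. G x * u x \<partial>\<mu>)
       \<le> ennreal (d L) * (\<integral>\<^sup>+ x. G x \<partial>\<mu>) +
          (\<Sum>j\<in>{Suc k..<L}. ennreal (d j - d (Suc j)) * excess (C (Suc j)) (\<phi> (Suc j)) \<mu> \<nu>)"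
      by (elim exE conjE)
    have [measurable]: "u \<in> borel_measurable borel"
      using level_planD(1)[OF h(1)] by (auto simp: partial_plan_def)
    have "(\<integral>\<^sup>+ x. G x * u x \<partial>\<mu>) = (\<integral>\<^sup>+ x. \<phi> (Suc k) (C (Suc k) x) * u x \<partial>\<mu>)"
      using G[of "Suc k"] k by simp
    also have "\<dots> = excess (C (Suc k)) (\<phi> (Suc k)) \<mu> \<nu>"
      unfolding excess_def level_planD(3)[OF h(1), symmetric] using C[of "Suc k"] k
      by (intro nn_integral_by_cells) auto
    finally have ex: "(\<integral>\<^sup>+ x. G x * u x \<partial>\<mu>) = excess (C (Suc k)) (\<phi> (Suc k)) \<mu> \<nu>" .
    have dk: "ennreal (d k) = ennreal (d (Suc k)) + ennreal (d k - d (Suc k))"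
      using d(1)[OF k] d(2)[of "Suc k"] k by (simp flip: ennreal_plus)
    have "plan_cost cst h + ennreal (d k) * (\<integral>\<^sup>+ x. G x * u x \<partial>\<mu>) =
       (plan_cost cst h + ennreal (d (Suc k)) * (\<integral>\<^sup>+ x. G x * u x \<partial>\<mu>))
       + ennreal (d k - d (Suc k)) * excess (C (Suc k)) (\<phi> (Suc k)) \<mu> \<nu>"
      unfolding dk by (simp add: ex distrib_right add.assoc)
    also have "\<dots> \<le> ennreal (d L) * (\<integral>\<^sup>+ x. G x \<partial>\<mu>) +
          (\<Sum>j\<in>{k..<L}. ennreal (d j - d (Suc j)) * excess (C (Suc j)) (\<phi> (Suc j)) \<mu> \<nu>)"
      using h(2) k by (subst sum.atLeast_Suc_lessThan) (auto simp: ac_simps intro: add_mono)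
    finally have bd: "plan_cost cst h + ennreal (d k) * (\<integral>\<^sup>+ x. G x * u x \<partial>\<mu>) \<le> \<dots>" .
    have w: "\<forall>x y. h x y \<noteq> 0 \<longrightarrow> C k x = C k y" using nested[OF k level_planD(2)[OF h(1)]] by blast
    from step[OF less_imp_le[OF k] level_planD(1)[OF h(1)] w] obtain h' u' v' where h': "level_plan (C k) h' u' v'"
      "plan_cost cst h' + ennreal (d k) * (\<integral>\<^sup>+ x. G x * u' x \<partial>\<mu>)
       \<le> plan_cost cst h + ennreal (d k) * (\<integral>\<^sup>+ x. G x * u x \<partial>\<mu>)"
      by (elim exE conjE)
    show ?case by (intro exI conjI) (rule h'(1), rule order_trans[OF h'(2) bd])
  qed
qed

text \<open>A plan that leaves nothing behind is the density of a coupling.\<close>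

lemma coupling_of_complete_plan:
  assumes plan: "partial_plan h u v"
    and u: "(\<integral>\<^sup>+ x. u x \<partial>\<mu>) = 0" and v: "(\<integral>\<^sup>+ y. v y \<partial>\<nu>) = 0"
    and cst [measurable]: "case_prod cst \<in> borel_measurable (\<mu> \<Otimes>\<^sub>M \<nu>)"
  shows "\<exists>\<xi>. prob_space \<xi> \<and> sets \<xi> = sets borel \<and> distr \<xi> borel fst = \<mu> \<and> distr \<xi> borel snd = \<nu> \<and>
    (\<integral>\<^sup>+ (x, y). cst x y \<partial>\<xi>) = plan_cost cst h"
proof -
  have [measurable]: "case_prod h \<in> borel_measurable (\<mu> \<Otimes>\<^sub>M \<nu>)"
    "u \<in> borel_measurable borel" "v \<in> borel_measurable borel"
    and hu: "\<And>x. u x + (\<integral>\<^sup>+ y. h x y \<partial>\<nu>) = 1" and hv: "\<And>y. v y + (\<integral>\<^sup>+ x. h x y \<partial>\<mu>) = 1"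
    using plan by (auto simp: partial_plan_def)
  have "AE x in \<mu>. u x = 0" using u by (subst nn_integral_0_iff_AE[symmetric]) auto
  then have h1: "AE x in \<mu>. (\<integral>\<^sup>+ y. h x y \<partial>\<nu>) = 1" by eventually_elim (metis hu add_0)
  have "AE y in \<nu>. v y = 0" using v by (subst nn_integral_0_iff_AE[symmetric]) auto
  then have h2: "AE y in \<nu>. (\<integral>\<^sup>+ x. h x y \<partial>\<mu>) = 1" by eventually_elim (metis hv add_0)
  define \<xi> where "\<xi> = density (\<mu> \<Otimes>\<^sub>M \<nu>) (case_prod h)"
  have sets_\<xi>: "sets \<xi> = sets borel"
    unfolding \<xi>_def by (simp add: borel_prod[symmetric] cong: sets_pair_measure_cong)
  have [measurable_cong]: "sets \<xi> = sets (\<mu> \<Otimes>\<^sub>M \<nu>)" by (simp add: \<xi>_def)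
  have int: "(\<integral>\<^sup>+ (x, y). f x y \<partial>\<xi>) = (\<integral>\<^sup>+ x. \<integral>\<^sup>+ y. f x y * h x y \<partial>\<nu> \<partial>\<mu>)"
    if [measurable]: "case_prod f \<in> borel_measurable (\<mu> \<Otimes>\<^sub>M \<nu>)" for f
  proof -
    have "(\<integral>\<^sup>+ (x, y). f x y \<partial>\<xi>) = (\<integral>\<^sup>+ z. (case z of (x, y) \<Rightarrow> f x y * h x y) \<partial>(\<mu> \<Otimes>\<^sub>M \<nu>))"
      unfolding \<xi>_def by (subst nn_integral_density) (auto intro!: nn_integral_cong simp: mult.commute)
    also have "\<dots> = (\<integral>\<^sup>+ x. \<integral>\<^sup>+ y. f x y * h x y \<partial>\<nu> \<partial>\<mu>)"
      by (subst second.nn_integral_fst[symmetric]) auto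
    finally show ?thesis .
  qed
  have fst: "distr \<xi> borel fst = \<mu>"
  proof (rule measure_eqI)
    fix A assume "A \<in> sets (distr \<xi> borel fst)"
    then have A [measurable]: "A \<in> sets borel" by simp
    have "emeasure (distr \<xi> borel fst) A = (\<integral>\<^sup>+ z. indicator A (fst z) \<partial>\<xi>)"
      by (subst nn_integral_distr[symmetric, of fst \<xi> borel]) (simp_all, measurable)
    also have "\<dots> = (\<integral>\<^sup>+ (x, y). indicator A x \<partial>\<xi>)"
      by (intro nn_integral_cong) (auto split: prod.split)
    also have "\<dots> = (\<integral>\<^sup>+ x. \<integral>\<^sup>+ y. indicator A x * h x y \<partial>\<nu> \<partial>\<mu>)"
      by (rule int) measurable
    also have "\<dots> = (\<integral>\<^sup>+ x. indicator A x * (\<integral>\<^sup>+ y. h x y \<partial>\<nu>) \<partial>\<mu>)"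
      by (intro nn_integral_cong nn_integral_cmult) measurable
    also have "\<dots> = (\<integral>\<^sup>+ x. indicator A x \<partial>\<mu>)"
      by (rule nn_integral_cong_AE) (use h1 in eventually_elim, simp)
    finally show "emeasure (distr \<xi> borel fst) A = emeasure \<mu> A" by simp
  qed simp
  have snd: "distr \<xi> borel snd = \<nu>"
  proof (rule measure_eqI)
    fix A assume "A \<in> sets (distr \<xi> borel snd)"
    then have A [measurable]: "A \<in> sets borel" by simp
    have "emeasure (distr \<xi> borel snd) A = (\<integral>\<^sup>+ z. indicator A (snd z) \<partial>\<xi>)"
      by (subst nn_integral_distr[symmetric, of snd \<xi> borel]) (simp_all, measurable)
    also have "\<dots> = (\<integral>\<^sup>+ (x, y). indicator A y \<partial>\<xi>)"
      by (intro nn_integral_cong) (auto split: prod.split)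
    also have "\<dots> = (\<integral>\<^sup>+ x. \<integral>\<^sup>+ y. indicator A y * h x y \<partial>\<nu> \<partial>\<mu>)"
      by (rule int) measurable
    also have "\<dots> = (\<integral>\<^sup>+ y. \<integral>\<^sup>+ x. indicator A y * h x y \<partial>\<mu> \<partial>\<nu>)"
      by (rule pair.Fubini'[symmetric]) measurable
    also have "\<dots> = (\<integral>\<^sup>+ y. indicator A y * (\<integral>\<^sup>+ x. h x y \<partial>\<mu>) \<partial>\<nu>)"
      by (intro nn_integral_cong nn_integral_cmult) measurable
    also have "\<dots> = (\<integral>\<^sup>+ y. indicator A y \<partial>\<nu>)"
      by (rule nn_integral_cong_AE) (use h2 in eventually_elim, simp)
    finally show "emeasure (distr \<xi> borel snd) A = emeasure \<nu> A" by simp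
  qed simp
  have "prob_space \<xi>"
  proof
    have "emeasure \<xi> (space \<xi>) = emeasure (distr \<xi> borel fst) UNIV"
      by (subst emeasure_distr) (simp_all, measurable)
    then show "emeasure \<xi> (space \<xi>) = 1" unfolding fst using first.emeasure_space_1 by simp
  qed
  then show ?thesis using sets_\<xi> fst snd int[OF cst] unfolding plan_cost_def by blast
qed

text \<open>After the coarsest level the remaining mass is matched arbitrarily. Its cost is estimated by the distances
  of both points to the origin, and these are bounded by a function \<open>\<psi>\<close> of the coarsest cell.\<close>

lemma hierarchical_coupling:
  fixes C :: "nat \<Rightarrow> 'a \<Rightarrow> 'c::countable" and d :: "nat \<Rightarrow> real"
  assumes C [measurable]: "\<And>k. k \<le> L \<Longrightarrow> C k \<in> measurable borel (count_space UNIV)"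
    and nested: "\<And>k x y. k < L \<Longrightarrow> C (Suc k) x = C (Suc k) y \<Longrightarrow> C k x = C k y"
    and d: "\<And>k. k < L \<Longrightarrow> d (Suc k) \<le> d k" "\<And>k. k \<le> L \<Longrightarrow> 0 \<le> d k"
    and G: "\<And>k x. k \<le> L \<Longrightarrow> G x = \<phi> k (C k x)" and [measurable]: "G \<in> borel_measurable borel"
    and cst [measurable]: "case_prod cst \<in> borel_measurable (\<mu> \<Otimes>\<^sub>M \<nu>)"
    and bound: "\<And>k x y. k \<le> L \<Longrightarrow> C k x = C k y \<Longrightarrow> cst x y \<le> ennreal (d k) * G x"
    and far: "\<And>x y. cst x y \<le> \<psi> (C 0 x) + \<psi> (C 0 y)"
  shows "\<exists>\<xi>. prob_space \<xi> \<and> sets \<xi> = sets borel \<and> distr \<xi> borel fst = \<mu> \<and> distr \<xi> borel snd = \<nu> \<and>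
    (\<integral>\<^sup>+ (x, y). cst x y \<partial>\<xi>) \<le> ennreal (d L) * (\<integral>\<^sup>+ x. G x \<partial>\<mu>) +
        (\<Sum>j<L. ennreal (d j - d (Suc j)) * excess (C (Suc j)) (\<phi> (Suc j)) \<mu> \<nu>)
        + excess (C 0) \<psi> \<mu> \<nu> + excess (C 0) \<psi> \<nu> \<mu>"
proof -
  have [measurable]: "C 0 \<in> measurable borel (count_space UNIV)" using C[of 0] by simp
  have "\<exists>h u v. level_plan (C 0) h u v \<and>
     plan_cost cst h + ennreal (d 0) * (\<integral>\<^sup>+ x. G x * u x \<partial>\<mu>)
       \<le> ennreal (d L) * (\<integral>\<^sup>+ x. G x \<partial>\<mu>) +
          (\<Sum>j\<in>{0..<L}. ennreal (d j - d (Suc j)) * excess (C (Suc j)) (\<phi> (Suc j)) \<mu> \<nu>)"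
    by (rule hierarchical_matching[where \<phi> = \<phi> and d = d and cst = cst and G = G and L = L];
        (fact C nested d G cst bound | measurable | simp))
  then obtain h u v where h0: "level_plan (C 0) h u v" and cost0:
      "plan_cost cst h + ennreal (d 0) * (\<integral>\<^sup>+ x. G x * u x \<partial>\<mu>)
       \<le> ennreal (d L) * (\<integral>\<^sup>+ x. G x \<partial>\<mu>) +
          (\<Sum>j\<in>{0..<L}. ennreal (d j - d (Suc j)) * excess (C (Suc j)) (\<phi> (Suc j)) \<mu> \<nu>)"
    by (elim exE conjE)
  note h = level_planD(1,3,4)[OF h0]
  have h4: "plan_cost cst h \<le> ennreal (d L) * (\<integral>\<^sup>+ x. G x \<partial>\<mu>) +
          (\<Sum>j<L. ennreal (d j - d (Suc j)) * excess (C (Suc j)) (\<phi> (Suc j)) \<mu> \<nu>)"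
    using order_trans[OF _ cost0, of "plan_cost cst h"] by (simp add: atLeast0LessThan add_increasing2)
  (* What is left is matched at once, inside the single cell of the trivial partition. *)
  define c0 where "c0 = (\<lambda>_ :: 'a. 0 :: nat)"
  have c0: "c0 \<in> measurable borel (count_space UNIV)" by (simp add: c0_def)
  have within: "c0 x = c0 y" for x y by (simp add: c0_def)
  obtain t u' v' where t: "case_prod t \<in> borel_measurable (\<mu> \<Otimes>\<^sub>M \<nu>)"
      "level_plan c0 (\<lambda>x y. h x y + t x y) u' v'"
      "\<forall>x. u' x + (\<integral>\<^sup>+ y. t x y \<partial>\<nu>) = u x"
      "\<forall>y. v' y + (\<integral>\<^sup>+ x. t x y \<partial>\<mu>) = v y"
    using match_within_cells[OF h(1) c0 within] by (elim exE conjE)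
  note [measurable] = t(1)
  have [measurable]: "case_prod h \<in> borel_measurable (\<mu> \<Otimes>\<^sub>M \<nu>)"
    "u \<in> borel_measurable borel" "v \<in> borel_measurable borel"
    using h(1) by (auto simp: partial_plan_def)
  have c0v: "c0 -` {0} = UNIV" by (auto simp: c0_def)
  have zero: "(\<integral>\<^sup>+ x. u' x \<partial>\<mu>) = 0" "(\<integral>\<^sup>+ y. v' y \<partial>\<nu>) = 0"
    using level_planD(3,4)[OF t(2), of 0] first.emeasure_space_1 second.emeasure_space_1 by (simp_all add: c0v)
  have [measurable]: "(\<lambda>x. \<psi> (C 0 x)) \<in> borel_measurable borel" by measurable
  have "plan_cost cst t \<le> (\<integral>\<^sup>+ x. \<integral>\<^sup>+ y. \<psi> (C 0 x) * t x y + \<psi> (C 0 y) * t x y \<partial>\<nu> \<partial>\<mu>)"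
    unfolding plan_cost_def by (intro nn_integral_mono) (auto simp: far mult_right_mono simp flip: distrib_right)
  also have "\<dots> = (\<integral>\<^sup>+ x. \<integral>\<^sup>+ y. \<psi> (C 0 x) * t x y \<partial>\<nu> \<partial>\<mu>) + (\<integral>\<^sup>+ x. \<integral>\<^sup>+ y. \<psi> (C 0 y) * t x y \<partial>\<nu> \<partial>\<mu>)"
    by (simp add: nn_integral_add)
  also have "(\<integral>\<^sup>+ x. \<integral>\<^sup>+ y. \<psi> (C 0 y) * t x y \<partial>\<nu> \<partial>\<mu>) = (\<integral>\<^sup>+ y. \<integral>\<^sup>+ x. \<psi> (C 0 y) * t x y \<partial>\<mu> \<partial>\<nu>)"
    by (rule pair.Fubini'[symmetric]) measurable
  also have "\<dots> = (\<integral>\<^sup>+ y. \<psi> (C 0 y) * (\<integral>\<^sup>+ x. t x y \<partial>\<mu>) \<partial>\<nu>)"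
    by (intro nn_integral_cong nn_integral_cmult) measurable
  also have "\<dots> \<le> (\<integral>\<^sup>+ y. \<psi> (C 0 y) * v y \<partial>\<nu>)"
    by (intro nn_integral_mono mult_left_mono) (auto simp: t(4)[rule_format, symmetric])
  also have "\<dots> = excess (C 0) \<psi> \<nu> \<mu>"
    unfolding excess_def h(3)[symmetric] by (intro nn_integral_by_cells) auto
  also have "(\<integral>\<^sup>+ x. \<integral>\<^sup>+ y. \<psi> (C 0 x) * t x y \<partial>\<nu> \<partial>\<mu>) = (\<integral>\<^sup>+ x. \<psi> (C 0 x) * (\<integral>\<^sup>+ y. t x y \<partial>\<nu>) \<partial>\<mu>)"
    by (intro nn_integral_cong nn_integral_cmult) measurable
  also have "\<dots> \<le> (\<integral>\<^sup>+ x. \<psi> (C 0 x) * u x \<partial>\<mu>)"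
    by (intro nn_integral_mono mult_left_mono) (auto simp: t(3)[rule_format, symmetric])
  also have "\<dots> = excess (C 0) \<psi> \<mu> \<nu>"
    unfolding excess_def h(2)[symmetric] by (intro nn_integral_by_cells) auto
  finally have ct: "plan_cost cst t \<le> excess (C 0) \<psi> \<mu> \<nu> + excess (C 0) \<psi> \<nu> \<mu>"
    by (simp add: add_mono)
  have "plan_cost cst (\<lambda>x y. h x y + t x y) = plan_cost cst h + plan_cost cst t"
    by (rule plan_cost_add) measurable
  then have cost: "plan_cost cst (\<lambda>x y. h x y + t x y) \<le> ennreal (d L) * (\<integral>\<^sup>+ x. G x \<partial>\<mu>) +
        (\<Sum>j<L. ennreal (d j - d (Suc j)) * excess (C (Suc j)) (\<phi> (Suc j)) \<mu> \<nu>)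
        + excess (C 0) \<psi> \<mu> \<nu> + excess (C 0) \<psi> \<nu> \<mu>"
    using add_mono[OF h4 ct] by (simp add: add.assoc)
  obtain \<xi> where \<xi>: "prob_space \<xi>" "sets \<xi> = sets borel" "distr \<xi> borel fst = \<mu>"
    "distr \<xi> borel snd = \<nu>"
    "(\<integral>\<^sup>+ (x, y). cst x y \<partial>\<xi>) = plan_cost cst (\<lambda>x y. h x y + t x y)"
    using coupling_of_complete_plan[OF level_planD(1)[OF t(2)] zero cst] by (elim exE conjE)
  show ?thesis
    by (rule exI[of _ \<xi>], intro conjI \<xi>(1-4), subst \<xi>(5), rule cost)
qed

end

section \<open>Empirical masses of an independent sample\<close>

lemma emeasure_empirical_measure_indicator:
  assumes "A \<in> sets borel"
  shows "emeasure (empirical_measure N x) A = ennreal ((\<Sum>k=1..N. indicator A (x k)) / real N)"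
proof -
  have "emeasure (empirical_measure N x) A = ennreal (1 / real N) * (\<Sum>k=1..N. ennreal (indicator A (x k)))"
    using assms by (simp add: emeasure_empirical_measure ennreal_indicator)
  also have "\<dots> = ennreal ((\<Sum>k=1..N. indicator A (x k)) / real N)"
    by (subst sum_ennreal) (auto simp flip: ennreal_mult simp: sum_nonneg)
  finally show ?thesis .
qed

lemma nn_integral_empirical_measure:
  assumes "f \<in> borel_measurable borel"
  shows "(\<integral>\<^sup>+ y. f y \<partial>empirical_measure N x) = ennreal (1 / real N) * (\<Sum>k=1..N. f (x k))"
  using assms
  proof (induction f rule: borel_measurable_induct)
  case (cong f g)
  then show ?case by (simp cong: nn_integral_cong)
  next
  case (set A)
  then show ?case by (simp add: emeasure_empirical_measure)
  next
  case (mult u v)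
  then show ?case by (subst nn_integral_cmult) (simp_all add: sum_distrib_left ac_simps measurable_def)
  next
  case (add u v)
  then show ?case by (subst nn_integral_add) (simp_all add: sum.distrib distrib_left measurable_def)
  next
  case (seq U)
  have "(\<integral>\<^sup>+ y. (SUP i. U i) y \<partial>empirical_measure N x) = (SUP i. \<integral>\<^sup>+ y. U i y \<partial>empirical_measure N x)"
    unfolding SUP_apply by (intro nn_integral_monotone_convergence_SUP) (use seq in \<open>simp_all add: measurable_def\<close>)
  also have "\<dots> = (SUP i. ennreal (1 / real N) * (\<Sum>k=1..N. U i (x k)))" using seq by simp
  also have "\<dots> = ennreal (1 / real N) * (\<Sum>k=1..N. (SUP i. U i (x k)))"
    using seq by (subst SUP_mult_left_ennreal[symmetric], subst ennreal_SUP_sum)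
      (auto simp: incseq_def le_fun_def)
  finally show ?case by (simp add: SUP_apply image_image)
  qed

locale iid_sample = prob_space M for M :: "'w measure" +
  fixes X :: "nat \<Rightarrow> 'w \<Rightarrow> real ^ 'n::finite" and \<mu> :: "(real ^ 'n) measure" and N :: nat
  assumes indep: "indep_vars (\<lambda>_. borel) X {1..}"
    and law: "\<And>k. k \<ge> 1 \<Longrightarrow> distr M borel (X k) = \<mu>"
    and prob_law: "prob_space \<mu>" and sets_law [measurable_cong, simp]: "sets \<mu> = sets borel"
    and N_pos: "N \<ge> 1"
begin

sublocale law: prob_space \<mu> by (rule prob_law)

abbreviation emp :: "'w \<Rightarrow> (real ^ 'n) measure" where
  "emp \<omega> \<equiv> empirical_measure N (\<lambda>k. X k \<omega>)"

lemma X_measurable [measurable]: "k \<ge> 1 \<Longrightarrow> X k \<in> measurable M borel"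
  using indep unfolding indep_vars_def2 by auto

lemma emp_measurable [measurable]:
  assumes [measurable]: "A \<in> sets borel"
  shows "(\<lambda>\<omega>. emeasure (emp \<omega>) A) \<in> borel_measurable M"
proof -
  have [measurable]: "(\<lambda>\<omega>. indicat_real A (X k \<omega>)) \<in> borel_measurable M" if "k \<in> {1..N}" for k
    using X_measurable[of k] that by simp
  show ?thesis
    using assms by (simp add: emeasure_empirical_measure_indicator)
qed

lemma prob_X:
  assumes [measurable]: "A \<in> sets borel" and k: "k \<ge> 1"
  shows "expectation (\<lambda>\<omega>. indicator A (X k \<omega>)) = measure \<mu> A"
proof -
  note [measurable] = X_measurable[OF k]
  have "measure \<mu> A = (\<integral>x. indicat_real A x \<partial>(distr M borel (X k)))"
    unfolding law[OF k] using assms by (simp add: sets_eq_imp_space_eq[OF sets_law])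
  also have "\<dots> = expectation (\<lambda>\<omega>. indicator A (X k \<omega>))"
    by (subst integral_distr) auto
  finally show ?thesis by simp
qed

text \<open>The cross terms vanish by independence, so this is the variance of a binomial frequency.\<close>

lemma second_moment_deviation:
  assumes A [measurable]: "A \<in> sets borel"
  shows "expectation (\<lambda>\<omega>. ((\<Sum>k=1..N. indicator A (X k \<omega>)) / real N - measure \<mu> A)\<^sup>2)
           \<le> measure \<mu> A / real N"
proof -
  define m where "m = measure \<mu> A"
  define Y where "Y k \<omega> = indicat_real A (X k \<omega>) - m" for k \<omega>
  have [measurable]: "(\<lambda>\<omega>. indicat_real A (X k \<omega>)) \<in> borel_measurable M" if "k \<ge> 1" for k
    using X_measurable[of k] that by simp
  have Y_int: "integrable M (Y k)" if "k \<ge> 1" for k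
    unfolding Y_def using that
    by (intro Bochner_Integration.integrable_diff integrable_const integrable_const_bound[where B=1]) auto
  have EY: "expectation (Y k) = 0" if "k \<ge> 1" for k
    unfolding Y_def using that prob_X[OF A that]
    by (subst Bochner_Integration.integral_diff)
      (auto simp: m_def prob_space intro!: integrable_const_bound[where B=1])
  have YY: "integrable M (\<lambda>\<omega>. Y i \<omega> * Y j \<omega>)" if "i \<ge> 1" "j \<ge> 1" for i j
  proof (rule integrable_const_bound[where B="(1 + \<bar>m\<bar>) * (1 + \<bar>m\<bar>)"])
    have b: "\<bar>Y k \<omega>\<bar> \<le> 1 + \<bar>m\<bar>" for k \<omega> by (auto simp: Y_def indicator_def)
    show "AE \<omega> in M. norm (Y i \<omega> * Y j \<omega>) \<le> (1 + \<bar>m\<bar>) * (1 + \<bar>m\<bar>)"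
      using b by (auto simp: abs_mult intro!: mult_mono)
    show "(\<lambda>\<omega>. Y i \<omega> * Y j \<omega>) \<in> borel_measurable M"
      using that unfolding Y_def by measurable
  qed
  have cross: "expectation (\<lambda>\<omega>. Y i \<omega> * Y j \<omega>) = 0" if "i \<ge> 1" "j \<ge> 1" "i \<noteq> j" for i j
  proof -
    have "indep_vars (\<lambda>_. borel) (\<lambda>k. (\<lambda>x. indicat_real A x - m) \<circ> X k) {1..}"
      using indep by (rule indep_vars_compose) simp
    then have "indep_vars (\<lambda>_. borel) Y {1..}"
      by (simp add: Y_def[abs_def] comp_def)
    then have "indep_vars (\<lambda>_. borel) Y {i, j}"
      by (rule indep_vars_subset) (use that in auto)
    then have "expectation (\<lambda>\<omega>. \<Prod>k\<in>{i, j}. Y k \<omega>) = (\<Prod>k\<in>{i, j}. expectation (Y k))"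
      by (intro indep_vars_lebesgue_integral) (use Y_int that in auto)
    then show ?thesis using EY that by simp
  qed
  have sq: "expectation (\<lambda>\<omega>. Y k \<omega> * Y k \<omega>) \<le> m" if "k \<ge> 1" for k
  proof -
    have "Y k \<omega> * Y k \<omega> = (1 - 2 * m) * indicator A (X k \<omega>) + m\<^sup>2" for \<omega>
      by (auto simp: Y_def indicator_def power2_eq_square algebra_simps)
    then have "expectation (\<lambda>\<omega>. Y k \<omega> * Y k \<omega>)
        = expectation (\<lambda>\<omega>. (1 - 2 * m) * indicator A (X k \<omega>) + m\<^sup>2)"
      by simp
    also have "\<dots> = (1 - 2 * m) * m + m\<^sup>2"
      using prob_X[OF A that] that
      by (subst Bochner_Integration.integral_add)
        (auto simp: m_def prob_space intro!: integrable_const_bound[where B=1])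
    also have "\<dots> \<le> m" by (simp add: power2_eq_square algebra_simps)
    finally show ?thesis .
  qed
  have "(\<Sum>k=1..N. indicator A (X k \<omega>)) / real N - m = (\<Sum>k=1..N. Y k \<omega>) / real N" for \<omega>
    using N_pos by (simp add: Y_def sum_subtractf diff_divide_distrib)
  then have "expectation (\<lambda>\<omega>. ((\<Sum>k=1..N. indicator A (X k \<omega>)) / real N - m)\<^sup>2)
     = expectation (\<lambda>\<omega>. (\<Sum>i=1..N. \<Sum>j=1..N. Y i \<omega> * Y j \<omega>) / (real N)\<^sup>2)"
    by (simp add: power_divide power2_eq_square sum_product)
  also have "\<dots> = expectation (\<lambda>\<omega>. \<Sum>i=1..N. \<Sum>j=1..N. Y i \<omega> * Y j \<omega>) / (real N)\<^sup>2"
    by simp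
  also have "expectation (\<lambda>\<omega>. \<Sum>i=1..N. \<Sum>j=1..N. Y i \<omega> * Y j \<omega>)
      = (\<Sum>i=1..N. expectation (\<lambda>\<omega>. \<Sum>j=1..N. Y i \<omega> * Y j \<omega>))"
    by (intro Bochner_Integration.integral_sum Bochner_Integration.integrable_sum YY) auto
  also have "\<dots> = (\<Sum>i=1..N. \<Sum>j=1..N. expectation (\<lambda>\<omega>. Y i \<omega> * Y j \<omega>))"
    by (intro sum.cong refl Bochner_Integration.integral_sum YY) auto
  also have "\<dots> = (\<Sum>i=1..N. \<Sum>j=1..N. if j = i then expectation (\<lambda>\<omega>. Y i \<omega> * Y i \<omega>) else 0)"
    by (intro sum.cong refl) (auto simp: cross)
  also have "\<dots> = (\<Sum>i=1..N. expectation (\<lambda>\<omega>. Y i \<omega> * Y i \<omega>))"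
    by (simp add: sum.delta)
  also have "\<dots> \<le> (\<Sum>i=1..N. m)" by (intro sum_mono sq) auto
  finally show ?thesis using N_pos by (simp add: m_def power2_eq_square divide_right_mono field_simps)
qed

text \<open>A centred variable has a positive part of mean \<open>E|Z| / 2\<close>, and \<open>E|Z|\<close> is at most the standard deviation;
  this is where the factor \<open>1/2\<close> in all constants comes from. The trivial bound by the mass itself wins in
  cells whose expected number of sample points is below \<open>1/4\<close>.\<close>

lemma expected_deviation:
  assumes A [measurable]: "A \<in> sets borel"
  shows "(\<integral>\<^sup>+ \<omega>. emeasure (emp \<omega>) A - emeasure \<mu> A \<partial>M)
          \<le> ennreal (min (measure \<mu> A) (sqrt (measure \<mu> A / real N) / 2))" (is ?upper)
    and "(\<integral>\<^sup>+ \<omega>. emeasure \<mu> A - emeasure (emp \<omega>) A \<partial>M)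
          \<le> ennreal (min (measure \<mu> A) (sqrt (measure \<mu> A / real N) / 2))" (is ?lower)
proof -
  define m where "m = measure \<mu> A"
  define e where "e \<omega> = (\<Sum>k=1..N. indicat_real A (X k \<omega>)) / real N" for \<omega>
  define Z where "Z \<omega> = e \<omega> - m" for \<omega>
  have m0: "m \<ge> 0" by (simp add: m_def)
  have [measurable]: "(\<lambda>\<omega>. indicat_real A (X k \<omega>)) \<in> borel_measurable M" if "k \<in> {1..N}" for k
    using X_measurable[of k] that by simp
  have [measurable]: "e \<in> borel_measurable M" unfolding e_def by measurable
  have [measurable]: "Z \<in> borel_measurable M" unfolding Z_def by measurable
  have e01: "0 \<le> e \<omega>" "e \<omega> \<le> 1" for \<omega>
  proof -
    have "(\<Sum>k=1..N. indicat_real A (X k \<omega>)) \<le> (\<Sum>k=1..N. 1)" by (intro sum_mono) auto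
    then show "e \<omega> \<le> 1" using N_pos by (simp add: e_def divide_le_eq)
    show "0 \<le> e \<omega>" by (auto simp: e_def intro!: divide_nonneg_nonneg sum_nonneg)
  qed
  have e_int: "integrable M e" by (rule integrable_const_bound[where B=1]) (use e01 in auto)
  have Ee: "expectation e = m"
  proof -
    have "expectation e = (\<Sum>k=1..N. expectation (\<lambda>\<omega>. indicat_real A (X k \<omega>))) / real N"
      unfolding e_def
      by (simp, subst Bochner_Integration.integral_sum) (auto intro!: integrable_const_bound[where B=1])
    also have "\<dots> = m" using prob_X[OF A] N_pos by (simp add: m_def)
    finally show ?thesis .
  qed
  have Z_int: "integrable M Z" unfolding Z_def using e_int by auto
  have EZ: "expectation Z = 0" unfolding Z_def using e_int Ee by (simp add: prob_space)
  have Z_bd: "\<bar>Z \<omega>\<bar> \<le> 1 + m" for \<omega> using e01[of \<omega>] m0 by (auto simp: Z_def)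
  have Z2_int: "integrable M (\<lambda>\<omega>. (Z \<omega>)\<^sup>2)"
    by (rule integrable_const_bound[where B="(1 + m)\<^sup>2"])
      (use Z_bd m0 in \<open>auto simp: abs_le_square_iff[symmetric]\<close>)
  have EZ2: "expectation (\<lambda>\<omega>. (Z \<omega>)\<^sup>2) \<le> m / real N"
    using second_moment_deviation[OF A] by (simp add: Z_def e_def m_def)
  have EZabs: "expectation (\<lambda>\<omega>. \<bar>Z \<omega>\<bar>) \<le> sqrt (m / real N)"
  proof -
    have "0 \<le> variance (\<lambda>\<omega>. \<bar>Z \<omega>\<bar>)" by (rule variance_positive)
    also have "\<dots> = expectation (\<lambda>\<omega>. \<bar>Z \<omega>\<bar>\<^sup>2) - (expectation (\<lambda>\<omega>. \<bar>Z \<omega>\<bar>))\<^sup>2"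
      by (rule variance_eq) (use Z_int Z2_int in auto)
    finally have "(expectation (\<lambda>\<omega>. \<bar>Z \<omega>\<bar>))\<^sup>2 \<le> m / real N" using EZ2 by simp
    then show ?thesis by (simp add: real_le_rsqrt)
  qed
  have emp_e: "emeasure (emp \<omega>) A = ennreal (e \<omega>)" for \<omega>
    by (simp add: emeasure_empirical_measure_indicator e_def)
  have mu_m: "emeasure \<mu> A = ennreal m" by (simp add: m_def law.emeasure_eq_measure)
  have half: "(\<integral>\<^sup>+ \<omega>. ennreal (max (Z' \<omega>) 0) \<partial>M) \<le> ennreal (sqrt (m / real N) / 2)"
    if Z': "Z' = Z \<or> Z' = (\<lambda>\<omega>. - Z \<omega>)" for Z'
  proof -
    have int: "integrable M Z'" and E: "expectation Z' = 0" and ab: "\<And>\<omega>. \<bar>Z' \<omega>\<bar> = \<bar>Z \<omega>\<bar>"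
      using Z' Z_int EZ by auto
    have mx: "max (Z' \<omega>) 0 = (Z' \<omega> + \<bar>Z' \<omega>\<bar>) / 2" for \<omega> by auto
    have "(\<integral>\<^sup>+ \<omega>. ennreal (max (Z' \<omega>) 0) \<partial>M) = ennreal (expectation (\<lambda>\<omega>. max (Z' \<omega>) 0))"
      by (rule nn_integral_eq_integral) (use int in auto)
    also have "expectation (\<lambda>\<omega>. max (Z' \<omega>) 0) = expectation (\<lambda>\<omega>. \<bar>Z \<omega>\<bar>) / 2"
      using int E by (simp add: mx ab[symmetric])
    finally show ?thesis using EZabs by (simp add: ennreal_leI)
  qed
  have up: "emeasure (emp \<omega>) A - emeasure \<mu> A = ennreal (max (Z \<omega>) 0)" for \<omega>
    unfolding emp_e mu_m using m0 by (simp add: ennreal_minus Z_def max_def ennreal_neg)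
  have lo: "emeasure \<mu> A - emeasure (emp \<omega>) A = ennreal (max (- Z \<omega>) 0)" for \<omega>
    unfolding emp_e mu_m using e01 by (simp add: ennreal_minus Z_def max_def ennreal_neg)
  have "(\<integral>\<^sup>+ \<omega>. emeasure (emp \<omega>) A - emeasure \<mu> A \<partial>M) \<le> (\<integral>\<^sup>+ \<omega>. ennreal (e \<omega>) \<partial>M)"
    by (intro nn_integral_mono) (auto simp: emp_e)
  also have "\<dots> = ennreal m"
    using e_int e01 by (subst nn_integral_eq_integral) (auto simp: Ee)
  finally have u1: "(\<integral>\<^sup>+ \<omega>. emeasure (emp \<omega>) A - emeasure \<mu> A \<partial>M) \<le> ennreal m" .
  have "(\<integral>\<^sup>+ \<omega>. emeasure \<mu> A - emeasure (emp \<omega>) A \<partial>M) \<le> (\<integral>\<^sup>+ \<omega>. ennreal m \<partial>M)"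
    by (intro nn_integral_mono) (auto simp: mu_m)
  also have "\<dots> = ennreal m" by (simp add: emeasure_space_1)
  finally have l1: "(\<integral>\<^sup>+ \<omega>. emeasure \<mu> A - emeasure (emp \<omega>) A \<partial>M) \<le> ennreal m" .
  show ?upper using u1 half[of Z] unfolding up m_def[symmetric] by (simp add: min_def)
  show ?lower using l1 half[of "\<lambda>\<omega>. - Z \<omega>"] unfolding lo m_def[symmetric] by (simp add: min_def)
qed

text \<open>The empirical measure is unbiased.\<close>

lemma nn_integral_emp:
  assumes [measurable]: "f \<in> borel_measurable borel"
  shows "(\<integral>\<^sup>+ \<omega>. (\<integral>\<^sup>+ x. f x \<partial>emp \<omega>) \<partial>M) = (\<integral>\<^sup>+ x. f x \<partial>\<mu>)"
proof -
  have "(\<integral>\<^sup>+ x. f x \<partial>emp \<omega>) = ennreal (1 / real N) * (\<Sum>k=1..N. f (X k \<omega>))" for \<omega>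
    using assms by (rule nn_integral_empirical_measure)
  then have "(\<integral>\<^sup>+ \<omega>. (\<integral>\<^sup>+ x. f x \<partial>emp \<omega>) \<partial>M) = (\<integral>\<^sup>+ \<omega>. ennreal (1 / real N) * (\<Sum>k=1..N. f (X k \<omega>)) \<partial>M)"
    by simp
  also have "\<dots> = ennreal (1 / real N) * (\<Sum>k=1..N. \<integral>\<^sup>+ \<omega>. f (X k \<omega>) \<partial>M)"
    by (subst nn_integral_cmult; (subst nn_integral_sum)?) auto
  also have "(\<Sum>k=1..N. \<integral>\<^sup>+ \<omega>. f (X k \<omega>) \<partial>M) = (\<Sum>k=1..N. \<integral>\<^sup>+ x. f x \<partial>\<mu>)"
  proof (intro sum.cong refl)
    fix k assume "k \<in> {1..N}"
    then have k: "k \<ge> 1" by simp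
    note [measurable] = X_measurable[OF k]
    show "(\<integral>\<^sup>+ \<omega>. f (X k \<omega>) \<partial>M) = (\<integral>\<^sup>+ x. f x \<partial>\<mu>)"
      unfolding law[OF k, symmetric] by (subst nn_integral_distr) auto
  qed
  also have "ennreal (1 / real N) * \<dots> = (\<integral>\<^sup>+ x. f x \<partial>\<mu>)"
    using N_pos by (simp add: ennreal_of_nat_eq_real_of_nat mult.assoc[symmetric] flip: ennreal_mult)
  finally show ?thesis .
qed

lemma nn_integral_emp_measurable:
  assumes [measurable]: "f \<in> borel_measurable borel"
  shows "(\<lambda>\<omega>. \<integral>\<^sup>+ x. f x \<partial>emp \<omega>) \<in> borel_measurable M"
proof -
  have [measurable]: "(\<lambda>\<omega>. f (X k \<omega>)) \<in> borel_measurable M" if "k \<in> {1..N}" for k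
    using measurable_compose[OF X_measurable[of k] assms] that by simp
  show ?thesis by (simp add: nn_integral_empirical_measure)
qed

end

section \<open>Norms, coverings and nested partitions of the unit ball\<close>

text \<open>Convexity on the open half line is extended to the end point \<open>0\<close>, which occurs when a coordinate vanishes.\<close>

lemma powr_convex_nonneg:
  fixes a b u m :: real
  assumes "m \<ge> 1" "a \<ge> 0" "b \<ge> 0" "0 \<le> u" "u \<le> 1"
  shows "(u * a + (1 - u) * b) powr m \<le> u * a powr m + (1 - u) * b powr m"
proof -
  have scale: "(v * c) powr m \<le> v * c powr m" if "0 \<le> v" "v \<le> 1" "0 \<le> c" for v c :: real
  proof -
    have "v powr m \<le> v powr 1" using that assms(1) by (intro powr_mono') auto
    then show ?thesis using that by (simp add: powr_mult mult_right_mono)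
  qed
  consider "a = 0" | "b = 0" | "a > 0" "b > 0" using assms by linarith
  then show ?thesis
  proof cases
    case 1
    then show ?thesis using scale[of "1 - u" b] assms by simp
  next
    case 2
    then show ?thesis using scale[of u a] assms by simp
  next
    case 3
    then show ?thesis
      using convex_onD[OF powr_convex[OF assms(1)], of u b a] assms
      by (simp add: algebra_simps)
  qed
qed

lemma lnorm_ereal: "lnorm (ereal r) x = (\<Sum>i\<in>UNIV. \<bar>x $ i\<bar> powr r) powr (1 / r)"
  by (simp add: lnorm_def)

lemma lnorm_infinity: "lnorm \<infinity> x = infnorm x"
  by (simp add: lnorm_def)

lemma exponent_cases:
  fixes m :: ereal
  assumes "m \<ge> 1"
  obtains "m = \<infinity>" | r where "m = ereal r" "r \<ge> 1"
  using assms by (cases m) auto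

lemma lnorm_nonneg: "0 \<le> lnorm m x"
  by (simp add: lnorm_def infnorm_pos_le)

lemma lnorm_minus: "lnorm m (- x) = lnorm m x"
  by (simp add: lnorm_def infnorm_neg)

lemma lnorm_minus_commute: "lnorm m (x - y) = lnorm m (y - x)"
  using lnorm_minus[of m "x - y"] by simp

lemma lnorm_scaleR:
  assumes "m \<ge> 1"
  shows "lnorm m (c *\<^sub>R x) = \<bar>c\<bar> * lnorm m x"
  using assms
proof (cases rule: exponent_cases)
  case 1
  then show ?thesis by (simp add: lnorm_infinity infnorm_mul)
next
  case (2 r)
  have "(\<Sum>i\<in>UNIV. \<bar>(c *\<^sub>R x) $ i\<bar> powr r) = \<bar>c\<bar> powr r * (\<Sum>i\<in>UNIV. \<bar>x $ i\<bar> powr r)"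
    by (simp add: abs_mult powr_mult sum_distrib_left)
  then show ?thesis using 2 by (simp add: lnorm_ereal powr_mult powr_powr sum_nonneg)
qed

lemma lnorm_zero: "m \<ge> 1 \<Longrightarrow> lnorm m 0 = 0"
  using lnorm_scaleR[of m 0 0] by simp

lemma component_le_lnorm:
  fixes x :: "real ^ 'n::finite"
  assumes "m \<ge> 1"
  shows "\<bar>x $ i\<bar> \<le> lnorm m x"
  using assms
proof (cases rule: exponent_cases)
  case 1
  then show ?thesis by (simp add: lnorm_infinity component_le_infnorm_cart)
next
  case (2 r)
  have "\<bar>x $ i\<bar> = (\<bar>x $ i\<bar> powr r) powr (1 / r)" using 2 by (simp add: powr_powr)
  also have "\<dots> \<le> (\<Sum>i\<in>UNIV. \<bar>x $ i\<bar> powr r) powr (1 / r)"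
    using 2 by (intro powr_mono2 member_le_sum) auto
  finally show ?thesis using 2 by (simp add: lnorm_ereal)
qed

lemma infnorm_le:
  fixes x :: "real ^ 'n::finite"
  assumes "\<And>i. \<bar>x $ i\<bar> \<le> s"
  shows "infnorm x \<le> s"
  unfolding infnorm_cart by (rule cSup_least) (use assms in auto)

lemma lnorm_le_card:
  fixes x :: "real ^ 'n::finite"
  assumes "m \<ge> 1" and le: "\<And>i. \<bar>x $ i\<bar> \<le> s"
  shows "lnorm m x \<le> real CARD('n) * s"
proof -
  have s: "0 \<le> s" using le[of undefined] by linarith
  have c: "real CARD('n) \<ge> 1" by (simp add: Suc_leI)
  from assms(1) show ?thesis
  proof (cases rule: exponent_cases)
    case 1
    have "infnorm x \<le> 1 * s" using infnorm_le[OF le] by simp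
    also have "\<dots> \<le> real CARD('n) * s" using c s by (intro mult_right_mono) auto
    finally show ?thesis using 1 by (simp add: lnorm_infinity)
  next
    case (2 r)
    have "(\<Sum>i\<in>UNIV. \<bar>x $ i\<bar> powr r) \<le> (\<Sum>i\<in>(UNIV :: 'n set). s powr r)"
      using le 2 by (intro sum_mono powr_mono2) auto
    then have "lnorm m x \<le> (real CARD('n) * s powr r) powr (1 / r)"
      using 2 by (simp add: lnorm_ereal powr_mono2 sum_nonneg)
    also have "\<dots> = real CARD('n) powr (1 / r) * s" using 2 s by (simp add: powr_mult powr_powr)
    also have "\<dots> \<le> real CARD('n) powr 1 * s"
      using 2 s c by (intro mult_right_mono powr_mono) auto
    finally show ?thesis by simp
  qed
qed

lemma lnorm_pos:
  assumes "m \<ge> 1" "x \<noteq> 0"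
  shows "0 < lnorm m x"
proof -
  obtain i where "x $ i \<noteq> 0" using assms(2) by (auto simp: vec_eq_iff)
  then show ?thesis using component_le_lnorm[OF assms(1), of x i] by linarith
qed

text \<open>Minkowski's inequality: both vectors are normalized, and convexity of \<open>z powr r\<close> is applied in every
  coordinate, with the weights \<open>S/(S+T)\<close> and \<open>T/(S+T)\<close>.\<close>

lemma lnorm_triangle:
  fixes x y :: "real ^ 'n::finite"
  assumes m: "m \<ge> 1"
  shows "lnorm m (x + y) \<le> lnorm m x + lnorm m y"
proof (cases "x = 0 \<or> y = 0")
  case True
  then show ?thesis using m by (auto simp: lnorm_zero)
next
  case False
  then have pos: "0 < lnorm m x" "0 < lnorm m y" using lnorm_pos[OF m] by auto
  from m show ?thesis
  proof (cases rule: exponent_cases)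
    case 1
    then show ?thesis by (simp add: lnorm_infinity infnorm_triangle)
  next
    case (2 r)
    define S T where "S = lnorm m x" and "T = lnorm m y"
    have ST: "S > 0" "T > 0" using pos by (auto simp: S_def T_def)
    define u where "u = S / (S + T)"
    have u: "0 \<le> u" "u \<le> 1" "1 - u = T / (S + T)" using ST by (auto simp: u_def field_simps)
    have S: "(\<Sum>i\<in>UNIV. (\<bar>x $ i\<bar> / S) powr r) = 1"
    proof -
      have "(\<Sum>i\<in>UNIV. \<bar>x $ i\<bar> powr r) = S powr r"
        using 2 by (simp add: S_def lnorm_ereal powr_powr sum_nonneg)
      then show ?thesis using ST by (simp add: powr_divide flip: sum_divide_distrib)
    qed
    have T: "(\<Sum>i\<in>UNIV. (\<bar>y $ i\<bar> / T) powr r) = 1"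
    proof -
      have "(\<Sum>i\<in>UNIV. \<bar>y $ i\<bar> powr r) = T powr r"
        using 2 by (simp add: T_def lnorm_ereal powr_powr sum_nonneg)
      then show ?thesis using ST by (simp add: powr_divide flip: sum_divide_distrib)
    qed
    have "(\<Sum>i\<in>UNIV. \<bar>(x + y) $ i\<bar> powr r)
        \<le> (\<Sum>i\<in>UNIV. (S + T) powr r * (u * (\<bar>x $ i\<bar> / S) powr r + (1 - u) * (\<bar>y $ i\<bar> / T) powr r))"
    proof (intro sum_mono)
      fix i
      have "\<bar>(x + y) $ i\<bar> \<le> (S + T) * (u * (\<bar>x $ i\<bar> / S) + (1 - u) * (\<bar>y $ i\<bar> / T))"
      proof -
        have "u * (\<bar>x $ i\<bar> / S) = \<bar>x $ i\<bar> / (S + T)" using ST by (simp add: u_def)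
        moreover have "(1 - u) * (\<bar>y $ i\<bar> / T) = \<bar>y $ i\<bar> / (S + T)" using ST by (simp add: u(3))
        ultimately have "(S + T) * (u * (\<bar>x $ i\<bar> / S) + (1 - u) * (\<bar>y $ i\<bar> / T)) = \<bar>x $ i\<bar> + \<bar>y $ i\<bar>"
          using ST by (simp flip: add_divide_distrib)
        then show ?thesis by simp
      qed
      then have "\<bar>(x + y) $ i\<bar> powr r \<le> ((S + T) * (u * (\<bar>x $ i\<bar> / S) + (1 - u) * (\<bar>y $ i\<bar> / T))) powr r"
        using 2 by (intro powr_mono2) auto
      also have "\<dots> = (S + T) powr r * (u * (\<bar>x $ i\<bar> / S) + (1 - u) * (\<bar>y $ i\<bar> / T)) powr r"
        using ST u by (simp add: powr_mult)
      also have "\<dots> \<le> (S + T) powr r * (u * (\<bar>x $ i\<bar> / S) powr r + (1 - u) * (\<bar>y $ i\<bar> / T) powr r)"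
        using 2 ST u by (intro mult_left_mono powr_convex_nonneg) auto
      finally show "\<bar>(x + y) $ i\<bar> powr r \<le> \<dots>" .
    qed
    also have "\<dots> = (S + T) powr r * (u * (\<Sum>i\<in>UNIV. (\<bar>x $ i\<bar> / S) powr r) + (1 - u) * (\<Sum>i\<in>UNIV. (\<bar>y $ i\<bar> / T) powr r))"
      by (simp add: sum_distrib_left[symmetric] sum.distrib)
    also have "\<dots> = (S + T) powr r" unfolding S T by simp
    finally have "(\<Sum>i\<in>UNIV. \<bar>(x + y) $ i\<bar> powr r) powr (1 / r) \<le> ((S + T) powr r) powr (1 / r)"
      using 2 by (intro powr_mono2) (auto intro: sum_nonneg)
    then show ?thesis using 2 ST by (simp add: lnorm_ereal powr_powr flip: S_def T_def) (simp add: S_def T_def lnorm_ereal 2)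
  qed
qed

lemma lnorm_triangle_diff:
  assumes "m \<ge> 1"
  shows "lnorm m (x - z) \<le> lnorm m (x - y) + lnorm m (y - z)"
  using lnorm_triangle[OF assms, of "x - y" "y - z"] by simp

lemma borel_measurable_lnorm [measurable]: "lnorm m \<in> borel_measurable borel"
proof (cases "m = \<infinity>")
  case True
  then have "lnorm m = (infnorm :: real ^ 'a \<Rightarrow> real)" by (simp add: fun_eq_iff lnorm_infinity)
  then show ?thesis by (simp add: borel_measurable_continuous_onI continuous_on_infnorm)
next
  case False
  have [measurable]: "(\<lambda>x :: real ^ 'a. x $ i) \<in> borel_measurable borel" for i
    by (rule borel_measurable_continuous_onI) (intro continuous_intros)
  have "lnorm m = (\<lambda>x :: real ^ 'a. (\<Sum>i\<in>UNIV. \<bar>x $ i\<bar> powr real_of_ereal m) powr (1 / real_of_ereal m))"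
    using False by (simp add: fun_eq_iff lnorm_def)
  then show ?thesis by simp
qed

lemma in_unit_lball: "y \<in> lball m 0 1 \<longleftrightarrow> lnorm m y < 1"
  by (simp add: lball_def lnorm_minus)

lemma card_integer_box:
  assumes "a \<le> b"
  shows "finite {f :: 'n::finite \<Rightarrow> int. \<forall>i. f i \<in> {a..<b}}"
    and "card {f :: 'n::finite \<Rightarrow> int. \<forall>i. f i \<in> {a..<b}} = nat (b - a) ^ CARD('n)"
proof -
  have eq: "{f :: 'n \<Rightarrow> int. \<forall>i. f i \<in> {a..<b}} = (\<Pi>\<^sub>E i\<in>UNIV. {a..<b})" by (auto simp: PiE_def)
  show "finite {f :: 'n \<Rightarrow> int. \<forall>i. f i \<in> {a..<b}}" unfolding eq by (intro finite_PiE) auto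
  show "card {f :: 'n \<Rightarrow> int. \<forall>i. f i \<in> {a..<b}} = nat (b - a) ^ CARD('n)"
    unfolding eq by (subst card_PiE) auto
qed

definition covers :: "ereal \<Rightarrow> real \<Rightarrow> nat \<Rightarrow> (nat \<Rightarrow> real ^ 'n::finite) \<Rightarrow> bool" where
  "covers m \<epsilon> k x \<longleftrightarrow> (\<forall>i\<in>{1..k}. x i \<in> lball m 0 1) \<and> lball m 0 1 \<subseteq> (\<Union>i\<in>{1..k}. lball m (x i) \<epsilon>)"

text \<open>A covering by grid cells shows that the covering numbers are attained and that the supremum in the definition
  of \<open>cover_const\<close> is over a bounded set; for both purposes any finite bound serves.\<close>

lemma grid_cover:
  assumes m: "m \<ge> 1" and e: "0 < \<epsilon>" "\<epsilon> \<le> 1"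
  shows "\<exists>k (x :: nat \<Rightarrow> real ^ 'n::finite). covers m \<epsilon> k x \<and>
           \<epsilon> ^ CARD('n) * real k \<le> (4 * real CARD('n) + 2) ^ CARD('n)"
proof -
  define D where "D = real CARD('n)"
  have D: "D \<ge> 1" by (simp add: D_def Suc_leI)
  (* Points of one grid cell differ by at most h in each coordinate, hence by D * h < \<epsilon> in the norm. *)
  define h where "h = \<epsilon> / (2 * D)"
  have h: "h > 0" using e D by (simp add: h_def)
  define B where "B = (lball m 0 1 :: (real ^ 'n) set)"
  define f :: "real ^ 'n \<Rightarrow> 'n \<Rightarrow> int" where "f x = (\<lambda>i. \<lfloor>x $ i / h\<rfloor>)" for x
  define b where "b = \<lceil>1 / h\<rceil>"
  have "0 \<le> 1 / h" using h by simp
  then have b: "b \<ge> 0" using ceiling_mono[of 0 "1 / h"] by (simp only: b_def ceiling_zero)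
  have "f ` B \<subseteq> {g. \<forall>i. g i \<in> {-b..<b}}"
  proof safe
    fix x i assume "x \<in> B"
    then have "\<bar>x $ i\<bar> < 1"
      using component_le_lnorm[OF m, of x i] by (simp add: B_def in_unit_lball)
    then have "- (1 / h) < x $ i / h" "x $ i / h < 1 / h"
      using h by (auto simp: field_simps)
    moreover have "1 / h \<le> of_int b" unfolding b_def by (rule le_of_int_ceiling)
    ultimately show "f x i \<in> {-b..<b}"
      unfolding f_def by (auto simp: le_floor_iff floor_less_iff)
  qed
  note sub = this
  have fin: "finite (f ` B)" using finite_subset[OF sub card_integer_box(1)] b by simp
  have "card (f ` B) \<le> nat (b - - b) ^ CARD('n)"
    using card_mono[OF card_integer_box(1) sub] card_integer_box(2)[of "-b" b, where 'n='n] b by simp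
  then have "real (card (f ` B)) \<le> (2 * of_int b) ^ CARD('n)"
  proof -
    assume "card (f ` B) \<le> nat (b - - b) ^ CARD('n)"
    then have "real (card (f ` B)) \<le> real (nat (2 * b) ^ CARD('n))" by simp
    also have "\<dots> = (2 * of_int b) ^ CARD('n)" using b by simp
    finally show ?thesis .
  qed
  also have "\<dots> \<le> ((4 * D + 2) / \<epsilon>) ^ CARD('n)"
  proof (rule power_mono)
    have "of_int b \<le> 1 / h + 1" unfolding b_def by linarith
    then have "2 * of_int b \<le> 4 * D / \<epsilon> + 2" using e D by (simp add: h_def)
    also have "\<dots> \<le> (4 * D + 2) / \<epsilon>" using e D by (simp add: field_simps)
    finally show "2 * of_int b \<le> (4 * D + 2) / \<epsilon>" .
  qed (use b in simp)
  finally have "\<epsilon> ^ CARD('n) * real (card (f ` B)) \<le> \<epsilon> ^ CARD('n) * ((4 * D + 2) / \<epsilon>) ^ CARD('n)"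
    using e by (intro mult_left_mono) auto
  also have "\<dots> = (4 * D + 2) ^ CARD('n)" using e by (simp add: power_divide)
  finally have count: "\<epsilon> ^ CARD('n) * real (card (f ` B)) \<le> (4 * D + 2) ^ CARD('n)" .
  obtain g where g: "bij_betw g {1..card (f ` B)} (f ` B)"
    using ex_bij_betw_nat_finite_1[OF fin] by blast
  define x where "x j = (SOME y. y \<in> B \<and> f y = g j)" for j
  have x: "x j \<in> B \<and> f (x j) = g j" if "j \<in> {1..card (f ` B)}" for j
  proof -
    have "g j \<in> f ` B" using g that by (auto simp: bij_betw_def)
    then show ?thesis unfolding x_def by (intro someI_ex[where P="\<lambda>y. y \<in> B \<and> f y = g j"]) auto
  qed
  have "covers m \<epsilon> (card (f ` B)) x"
    unfolding covers_def
  proof (intro conjI ballI subsetI)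
    fix y :: "real ^ 'n" assume y: "y \<in> lball m 0 1"
    then have "f y \<in> f ` B" by (simp add: B_def)
    then have "f y \<in> g ` {1..card (f ` B)}" using bij_betw_imp_surj_on[OF g] by simp
    then obtain j where j: "j \<in> {1..card (f ` B)}" "g j = f y" by force
    have "\<bar>(x j - y) $ i\<bar> \<le> h" for i
    proof -
      have "\<lfloor>x j $ i / h\<rfloor> = \<lfloor>y $ i / h\<rfloor>" using x[OF j(1)] j(2) by (simp add: f_def fun_eq_iff)
      then have "\<bar>x j $ i / h - y $ i / h\<bar> \<le> 1" by linarith
      then show ?thesis using h by (simp add: field_simps flip: diff_divide_distrib)
    qed
    then have "lnorm m (x j - y) \<le> D * h" unfolding D_def by (rule lnorm_le_card[OF m])
    also have "\<dots> < \<epsilon>" using e D by (simp add: h_def)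
    finally show "y \<in> (\<Union>i\<in>{1..card (f ` B)}. lball m (x i) \<epsilon>)" using j by (auto simp: lball_def)
  qed (use x in \<open>auto simp: B_def\<close>)
  then show ?thesis using count unfolding D_def by blast
qed

lemma cover_num_eq: "cover_num TYPE('n::finite) m \<epsilon> = (LEAST k. \<exists>x :: nat \<Rightarrow> real ^ 'n. covers m \<epsilon> k x)"
  by (simp add: cover_num_def covers_def)

lemma cover_num_covers:
  assumes "m \<ge> 1" "0 < \<epsilon>" "\<epsilon> \<le> 1"
  shows "\<exists>x :: nat \<Rightarrow> real ^ 'n::finite. covers m \<epsilon> (cover_num TYPE('n) m \<epsilon>) x"
  unfolding cover_num_eq
  by (rule LeastI_ex[where P = "\<lambda>k. \<exists>x :: nat \<Rightarrow> real ^ 'n. covers m \<epsilon> k x"])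
    (use grid_cover[OF assms, where 'n='n] in blast)

lemma bdd_above_cover_num:
  assumes "m \<ge> 1"
  shows "bdd_above ((\<lambda>\<epsilon>. \<epsilon> ^ CARD('n) * real (cover_num TYPE('n::finite) m \<epsilon>)) ` {0<..1})"
proof (rule bdd_aboveI2)
  fix \<epsilon> :: real assume "\<epsilon> \<in> {0<..1}"
  then have e: "0 < \<epsilon>" "\<epsilon> \<le> 1" by auto
  obtain k and x :: "nat \<Rightarrow> real ^ 'n" where k: "covers m \<epsilon> k x"
    "\<epsilon> ^ CARD('n) * real k \<le> (4 * real CARD('n) + 2) ^ CARD('n)"
    using grid_cover[OF assms e] by blast
  have "cover_num TYPE('n) m \<epsilon> \<le> k" unfolding cover_num_eq using k(1) by (intro Least_le) blast
  then have "\<epsilon> ^ CARD('n) * real (cover_num TYPE('n) m \<epsilon>) \<le> \<epsilon> ^ CARD('n) * real k"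
    using e by (intro mult_left_mono) auto
  then show "\<epsilon> ^ CARD('n) * real (cover_num TYPE('n) m \<epsilon>) \<le> (4 * real CARD('n) + 2) ^ CARD('n)"
    using k(2) by linarith
qed

lemma cover_num_le_cover_const:
  assumes "m \<ge> 1" "0 < \<epsilon>" "\<epsilon> \<le> 1"
  shows "\<epsilon> ^ CARD('n) * real (cover_num TYPE('n::finite) m \<epsilon>) \<le> cover_const TYPE('n) m"
  unfolding cover_const_def using assms by (intro cSUP_upper bdd_above_cover_num) auto

lemma cover_const_ge_1:
  assumes "m \<ge> 1"
  shows "1 \<le> cover_const TYPE('n::finite) m"
proof -
  obtain x :: "nat \<Rightarrow> real ^ 'n" where "covers m 1 (cover_num TYPE('n) m 1) x"
    using cover_num_covers[of m 1] assms by auto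
  moreover have "(0 :: real ^ 'n) \<in> lball m 0 1" using assms by (simp add: in_unit_lball lnorm_zero)
  ultimately have "cover_num TYPE('n) m 1 \<ge> 1" by (cases "cover_num TYPE('n) m 1") (auto simp: covers_def)
  then show ?thesis using cover_num_le_cover_const[of m 1, where 'n='n] assms by auto
qed

text \<open>Partitions of the unit ball are given by labels: \<open>c k x\<close> names the cell of level \<open>k\<close> that contains \<open>x\<close>.
  Nestedness says that the label at level \<open>k+1\<close> determines the one at level \<open>k\<close>.\<close>

definition nested_cells ::
  "ereal \<Rightarrow> real \<Rightarrow> real \<Rightarrow> real \<Rightarrow> nat \<Rightarrow> (nat \<Rightarrow> real ^ 'n::finite \<Rightarrow> nat) \<Rightarrow> bool" where
  "nested_cells m r A \<delta> L c \<longleftrightarrow>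
     (\<forall>k\<le>L. c k \<in> measurable borel (count_space UNIV)) \<and>
     (\<forall>x\<in>lball m 0 1. c 0 x = 0) \<and>
     (\<forall>k<L. \<forall>x\<in>lball m 0 1. \<forall>y\<in>lball m 0 1. c (Suc k) x = c (Suc k) y \<longrightarrow> c k x = c k y) \<and>
     (\<forall>k\<in>{1..L}. finite (c k ` lball m 0 1) \<and>
        real (card (c k ` lball m 0 1)) \<le> A * r powr (real CARD('n) * real k)) \<and>
     (\<forall>k\<le>L. \<forall>x\<in>lball m 0 1. \<forall>y\<in>lball m 0 1. c k x = c k y \<longrightarrow> lnorm m (x - y) \<le> \<delta> * r powr (- real k))"

lemma nested_cellsD:
  fixes c :: "nat \<Rightarrow> real ^ 'n::finite \<Rightarrow> nat"
  assumes "nested_cells m r A \<delta> L c"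
  shows "k \<le> L \<Longrightarrow> c k \<in> measurable borel (count_space UNIV)"
    and "x \<in> lball m 0 1 \<Longrightarrow> c 0 x = 0"
    and "k < L \<Longrightarrow> x \<in> lball m 0 1 \<Longrightarrow> y \<in> lball m 0 1 \<Longrightarrow> c (Suc k) x = c (Suc k) y \<Longrightarrow> c k x = c k y"
    and "k \<in> {1..L} \<Longrightarrow> finite (c k ` lball m 0 1)"
    and "k \<in> {1..L} \<Longrightarrow> real (card (c k ` lball m 0 1)) \<le> A * r powr (real CARD('n) * real k)"
    and "k \<le> L \<Longrightarrow> x \<in> lball m 0 1 \<Longrightarrow> y \<in> lball m 0 1 \<Longrightarrow> c k x = c k y \<Longrightarrow>
      lnorm m (x - y) \<le> \<delta> * r powr (- real k)"
  using assms unfolding nested_cells_def by blast+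

text \<open>The cells of level \<open>k\<close> are the half-open cubes of side \<open>2\<^sup>1\<^sup>-\<^sup>k\<close> that tile \<open>[-1,1)\<^sup>d\<close>; they are nested
  since halving commutes with the floor function.\<close>

lemma dyadic_cells: "\<exists>c :: nat \<Rightarrow> real ^ 'n::finite \<Rightarrow> nat. nested_cells \<infinity> 2 1 2 L c"
proof -
  define g :: "nat \<Rightarrow> real ^ 'n \<Rightarrow> 'n \<Rightarrow> int" where "g k x = (\<lambda>i. \<lfloor>2 ^ k * ((x $ i + 1) / 2)\<rfloor>)" for k x
  define c where "c k x = (if k = 0 then 0 else to_nat (g k x))" for k x
  have range: "g k x \<in> {f. \<forall>i. f i \<in> {0..<2 ^ k}}" if "x \<in> lball \<infinity> 0 1" for k x
  proof safe
    fix i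
    have "\<bar>x $ i\<bar> < 1"
      using component_le_infnorm_cart[of x i] that by (simp add: in_unit_lball lnorm_infinity)
    then have "0 \<le> 2 ^ k * ((x $ i + 1) / 2)" "2 ^ k * ((x $ i + 1) / 2) < 2 ^ k"
      by auto
    then show "g k x i \<in> {0..<2 ^ k}" by (simp add: g_def le_floor_iff floor_less_iff)
  qed
  have meas: "g k \<in> measurable borel (count_space UNIV)" for k
  proof (subst measurable_count_space_eq_countable)
    have [measurable]: "(\<lambda>x :: real ^ 'n. x $ i) \<in> borel_measurable borel" for i
      by (rule borel_measurable_continuous_onI) (intro continuous_intros)
    have "g k -` {f} = (\<Inter>i. {x :: real ^ 'n. \<lfloor>2 ^ k * ((x $ i + 1) / 2)\<rfloor> = f i})" for f
      by (auto simp: g_def fun_eq_iff)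
    moreover have "{x :: real ^ 'n. \<lfloor>2 ^ k * ((x $ i + 1) / 2)\<rfloor> = f i} \<in> sets borel" for f :: "'n \<Rightarrow> int" and i
      by measurable
    ultimately show "g k \<in> space borel \<rightarrow> UNIV \<and> (\<forall>a\<in>UNIV. g k -` {a} \<inter> space borel \<in> sets borel)"
      by (auto intro!: sets.finite_INT)
  qed auto
  have nest: "g k x = g k y" if "g (Suc k) x = g (Suc k) y" for k x y
  proof
    fix i
    have half: "g k z i = g (Suc k) z i div 2" for z
    proof -
      have "g k z i = \<lfloor>2 ^ Suc k * ((z $ i + 1) / 2) / real_of_int 2\<rfloor>" by (simp add: g_def)
      also have "\<dots> = g (Suc k) z i div 2" by (subst floor_divide_real_eq_div) (auto simp: g_def)
      finally show ?thesis .
    qed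
    show "g k x i = g k y i" unfolding half using that by simp
  qed
  have diam: "lnorm \<infinity> (x - y) \<le> 2 * 2 powr - real k" if "g k x = g k y" for k x y
    unfolding lnorm_infinity
  proof (rule infnorm_le)
    fix i
    have "\<lfloor>2 ^ k * ((x $ i + 1) / 2)\<rfloor> = \<lfloor>2 ^ k * ((y $ i + 1) / 2)\<rfloor>"
      using that by (simp add: g_def fun_eq_iff)
    then have "\<bar>2 ^ k * ((x $ i + 1) / 2) - 2 ^ k * ((y $ i + 1) / 2)\<bar> \<le> 1" by linarith
    then have "2 ^ k * (\<bar>x $ i - y $ i\<bar> / 2) \<le> 1"
      by (simp add: abs_mult flip: right_diff_distrib diff_divide_distrib)
    then show "\<bar>(x - y) $ i\<bar> \<le> 2 * 2 powr - real k"
      by (simp add: powr_minus powr_realpow field_simps)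
  qed
  have "nested_cells \<infinity> 2 1 2 L c"
    unfolding nested_cells_def
  proof (intro conjI allI ballI impI)
    fix k
    have "(\<lambda>x. to_nat (g k x)) \<in> measurable borel (count_space UNIV)"
      by (rule measurable_compose[OF meas]) simp
    then show "c k \<in> measurable borel (count_space UNIV)" by (cases "k = 0") (simp_all add: c_def[abs_def])
  next
    fix k x y assume "c (Suc k) x = c (Suc k) y"
    then show "c k x = c k y" using nest[of k x y] by (simp add: c_def split: if_splits)
  next
    fix k assume k: "k \<in> {1..L}"
    have sub: "c k ` lball \<infinity> 0 1 \<subseteq> to_nat ` {f :: 'n \<Rightarrow> int. \<forall>i. f i \<in> {0..<2 ^ k}}"
      using range[of _ k] k by (auto simp: c_def)
    have fin: "finite {f :: 'n \<Rightarrow> int. \<forall>i. f i \<in> {0..<2 ^ k}}" by (rule card_integer_box) simp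
    show "finite (c k ` lball \<infinity> 0 1)" using finite_subset[OF sub] fin by blast
    have "card (c k ` lball \<infinity> 0 1) \<le> card (to_nat ` {f :: 'n \<Rightarrow> int. \<forall>i. f i \<in> {0..<2 ^ k}})"
      by (rule card_mono) (use sub fin in auto)
    also have "\<dots> \<le> card {f :: 'n \<Rightarrow> int. \<forall>i. f i \<in> {0..<2 ^ k}}" using fin by (rule card_image_le)
    also have "\<dots> = nat (2 ^ k - 0) ^ CARD('n)" by (rule card_integer_box) simp
    also have "\<dots> = 2 ^ (CARD('n) * k)" by (simp add: nat_power_eq mult.commute flip: power_mult)
    finally have "real (card (c k ` lball \<infinity> 0 1)) \<le> 2 ^ (CARD('n) * k)"
      using of_nat_mono by fastforce
    then show "real (card (c k ` lball \<infinity> 0 1)) \<le> 1 * 2 powr (real CARD('n) * real k)"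
      by (simp add: powr_realpow flip: of_nat_mult)
  next
    fix k and x y :: "real ^ 'n" assume xy: "x \<in> lball \<infinity> 0 1" "y \<in> lball \<infinity> 0 1" "c k x = c k y"
    show "lnorm \<infinity> (x - y) \<le> 2 * 2 powr - real k"
    proof (cases "k = 0")
      case True
      have "lnorm \<infinity> (x - y) \<le> lnorm \<infinity> (x - 0) + lnorm \<infinity> (0 - y)" by (rule lnorm_triangle_diff) simp
      then show ?thesis using xy True by (simp add: in_unit_lball lnorm_minus)
    next
      case False
      then show ?thesis using xy(3) diam[of k x y] by (simp add: c_def)
    qed
  qed (simp add: c_def)
  then show ?thesis by blast
qed

text \<open>Coverings at different scales are not nested. Nested cells are obtained from the finest covering upwards:
  a point gets the first ball of the finest covering that contains it, and thereafter each centre of level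
  \<open>k+1\<close> is assigned to a ball of level \<open>k\<close>, all points of its cell following it. A point is then no further from its
  centre of level \<open>k\<close> than \<open>\<epsilon>\<^sub>k + \<epsilon>\<^sub>k\<^sub>+\<^sub>1 + \<dots> \<le> \<epsilon>\<^sub>k r / (r - 1)\<close>. Recursive choice in this direction has to start
  at a last level \<open>L\<close>, which is why partitions have finite depth. Radii \<open>\<epsilon>\<^sub>k = 2 r\<^sup>-\<^sup>k\<close> are at most \<open>1\<close> for \<open>k \<ge> 1\<close>
  because \<open>r \<ge> 2\<close>.\<close>

lemma cover_cells:
  assumes m: "m \<ge> 1" and r: "r \<ge> 2"
  shows "\<exists>c :: nat \<Rightarrow> real ^ 'n::finite \<Rightarrow> nat.
    nested_cells m r (cover_const TYPE('n) m * 2 powr (- real CARD('n))) (4 * r / (r - 1)) L c"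
proof -
  define \<epsilon> where "\<epsilon> k = 2 * r powr (- real k)" for k :: nat
  have \<epsilon>0: "\<epsilon> k > 0" for k using r by (simp add: \<epsilon>_def)
  have \<epsilon>1: "\<epsilon> k \<le> 1" if "k \<ge> 1" for k
  proof -
    have "r powr (- real k) \<le> r powr (-1)" using that r by (intro powr_mono) auto
    also have "\<dots> \<le> 1 / 2" using r by (simp add: powr_minus field_simps)
    finally show ?thesis by (simp add: \<epsilon>_def)
  qed
  have \<epsilon>_Suc: "\<epsilon> (Suc k) = \<epsilon> k / r" for k
  proof -
    have "- real (Suc k) = - real k - 1" by simp
    then show ?thesis using r by (simp only: \<epsilon>_def powr_diff) simp
  qed
  define n where "n k = cover_num TYPE('n) m (\<epsilon> k)" for k
  define P where "P k = (SOME x :: nat \<Rightarrow> real ^ 'n. covers m (\<epsilon> k) (n k) x)" for k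
  have P: "covers m (\<epsilon> k) (n k) (P k)" if "k \<ge> 1" for k
  proof -
    have "\<exists>x :: nat \<Rightarrow> real ^ 'n. covers m (\<epsilon> k) (n k) x"
      unfolding n_def by (rule cover_num_covers) (use m \<epsilon>0 \<epsilon>1[OF that] in auto)
    then show ?thesis unfolding P_def by (rule someI_ex)
  qed
  define idx where "idx k y = (LEAST j. 1 \<le> j \<and> lnorm m (P k j - y) < \<epsilon> k)" for k y
  have idx: "idx k y \<in> {1..n k} \<and> lnorm m (P k (idx k y) - y) < \<epsilon> k"
    if k: "k \<ge> 1" and y: "y \<in> lball m 0 1" for k y
  proof -
    obtain j where j: "j \<in> {1..n k}" "lnorm m (P k j - y) < \<epsilon> k"
      using P[OF k] y by (auto simp: covers_def lball_def)
    then have ex: "1 \<le> j \<and> lnorm m (P k j - y) < \<epsilon> k" by auto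
    from LeastI[where P="\<lambda>j. 1 \<le> j \<and> lnorm m (P k j - y) < \<epsilon> k", OF ex]
    have "1 \<le> idx k y \<and> lnorm m (P k (idx k y) - y) < \<epsilon> k" unfolding idx_def .
    moreover have "idx k y \<le> j" unfolding idx_def using ex by (rule Least_le)
    ultimately show ?thesis using j by auto
  qed
  have P_in: "P k j \<in> lball m 0 1" if "k \<ge> 1" "j \<in> {1..n k}" for k j
    using P[OF that(1)] that(2) by (auto simp: covers_def)
  (* The labels are built from the finest level down: a j belongs to level L - j. *)
  define a where "a = rec_nat (idx L) (\<lambda>j f x. idx (L - Suc j) (P (L - j) (f x)))"
  have a0: "a 0 = idx L" by (simp add: a_def)
  have aS: "a (Suc j) x = idx (L - Suc j) (P (L - j) (a j x))" for j x by (simp add: a_def)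
  have a_meas: "a j \<in> measurable borel (count_space UNIV)" for j
  proof (induction j)
    case 0
    show ?case unfolding a0 idx_def by measurable
  next
    case (Suc j)
    have "(\<lambda>x. idx (L - Suc j) (P (L - j) (a j x))) \<in> measurable borel (count_space UNIV)"
      by (rule measurable_compose[OF Suc]) simp
    then show ?case by (simp add: aS[abs_def] cong: measurable_cong)
  qed
  have a_prop: "a j x \<in> {1..n (L - j)} \<and> lnorm m (P (L - j) (a j x) - x) \<le> \<epsilon> (L - j) * (r / (r - 1))"
    if "j < L" "x \<in> lball m 0 1" for j x
    using that(1)
  proof (induction j)
    case 0
    have "1 \<le> r / (r - 1)" using r by (simp add: field_simps)
    then have "\<epsilon> L * 1 \<le> \<epsilon> L * (r / (r - 1))" using \<epsilon>0[of L] by (intro mult_left_mono) auto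
    then show ?case using idx[of L x] 0 that(2) by (auto simp: a0)
  next
    case (Suc j)
    then have IH: "a j x \<in> {1..n (L - j)}" "lnorm m (P (L - j) (a j x) - x) \<le> \<epsilon> (L - j) * (r / (r - 1))"
      by auto
    define z where "z = P (L - j) (a j x)"
    have z: "z \<in> lball m 0 1" unfolding z_def using Suc.prems IH by (intro P_in) auto
    have i: "idx (L - Suc j) z \<in> {1..n (L - Suc j)}" "lnorm m (P (L - Suc j) (idx (L - Suc j) z) - z) < \<epsilon> (L - Suc j)"
      using idx[of "L - Suc j" z] z Suc.prems by auto
    have "lnorm m (P (L - Suc j) (idx (L - Suc j) z) - x)
        \<le> lnorm m (P (L - Suc j) (idx (L - Suc j) z) - z) + lnorm m (z - x)"
      by (rule lnorm_triangle_diff[OF m])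
    also have "\<dots> \<le> \<epsilon> (L - Suc j) + \<epsilon> (L - j) * (r / (r - 1))"
      using i IH by (simp add: z_def)
    also have "\<epsilon> (L - j) = \<epsilon> (L - Suc j) / r"
      using \<epsilon>_Suc[of "L - Suc j"] Suc.prems by (simp add: Suc_diff_Suc)
    also have "\<epsilon> (L - Suc j) + \<epsilon> (L - Suc j) / r * (r / (r - 1)) = \<epsilon> (L - Suc j) * (r / (r - 1))"
      using r by (simp add: field_simps)
    finally show ?case using i by (simp add: aS flip: z_def)
  qed
  define c where "c k x = (if k = 0 then 0 else a (L - k) x)" for k x
  have c_prop: "c k x \<in> {1..n k}" "lnorm m (P k (c k x) - x) \<le> \<epsilon> k * (r / (r - 1))"
    if "k \<in> {1..L}" "x \<in> lball m 0 1" for k x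
    using a_prop[of "L - k" x] that by (auto simp: c_def)
  have "nested_cells m r (cover_const TYPE('n) m * 2 powr (- real CARD('n))) (4 * r / (r - 1)) L c"
    unfolding nested_cells_def
  proof (intro conjI allI ballI impI)
    fix k show "c k \<in> measurable borel (count_space UNIV)"
      using a_meas by (cases "k = 0") (simp_all add: c_def[abs_def])
  next
    fix k x y assume k: "k < L" and "c (Suc k) x = c (Suc k) y"
    then have eq: "a (L - Suc k) x = a (L - Suc k) y" by (simp add: c_def)
    have "a (L - k) z = idx k (P (Suc k) (a (L - Suc k) z))" for z
      using aS[of "L - Suc k" z] k by (simp add: Suc_diff_Suc)
    then show "c k x = c k y" using eq by (simp add: c_def)
  next
    fix k assume k: "k \<in> {1..L}"
    have sub: "c k ` lball m 0 1 \<subseteq> {1..n k}" using c_prop(1)[OF k] by auto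
    show "finite (c k ` lball m 0 1)" using finite_subset[OF sub] by simp
    have "card (c k ` lball m 0 1) \<le> n k" using card_mono[OF _ sub] by simp
    moreover have "(\<epsilon> k) ^ CARD('n) * real (n k) \<le> cover_const TYPE('n) m"
      unfolding n_def using k by (intro cover_num_le_cover_const m \<epsilon>0 \<epsilon>1) auto
    moreover have "(\<epsilon> k) ^ CARD('n) = 2 powr real CARD('n) * r powr (- (real CARD('n) * real k))"
      using r by (simp add: \<epsilon>_def power_mult_distrib powr_power powr_realpow mult.commute)
    ultimately have "2 powr real CARD('n) * r powr (- (real CARD('n) * real k)) * real (card (c k ` lball m 0 1))
        \<le> cover_const TYPE('n) m"
      by (smt (verit) mult_left_mono of_nat_mono powr_ge_zero mult_nonneg_nonneg)
    then show "real (card (c k ` lball m 0 1)) \<le> cover_const TYPE('n) m * 2 powr (- real CARD('n)) * r powr (real CARD('n) * real k)"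
      using r by (simp add: powr_minus field_simps)
  next
    fix k and x y :: "real ^ 'n" assume k: "k \<le> L" and xy: "x \<in> lball m 0 1" "y \<in> lball m 0 1" "c k x = c k y"
    show "lnorm m (x - y) \<le> 4 * r / (r - 1) * r powr - real k"
    proof (cases "k = 0")
      case True
      have "lnorm m (x - y) \<le> lnorm m (x - 0) + lnorm m (0 - y)" by (rule lnorm_triangle_diff[OF m])
      also have "\<dots> \<le> 2" using xy by (simp add: in_unit_lball lnorm_minus)
      also have "2 \<le> 4 * r / (r - 1)" using r by (simp add: field_simps)
      finally show ?thesis using True r by simp
    next
      case False
      then have k1: "k \<in> {1..L}" using k by simp
      have "lnorm m (x - y) \<le> lnorm m (x - P k (c k x)) + lnorm m (P k (c k x) - y)"
        by (rule lnorm_triangle_diff[OF m])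
      also have "\<dots> \<le> \<epsilon> k * (r / (r - 1)) + \<epsilon> k * (r / (r - 1))"
        using c_prop(2)[OF k1 xy(1)] c_prop(2)[OF k1 xy(2)] xy(3)
        by (intro add_mono) (simp_all add: lnorm_minus_commute)
      also have "\<dots> = 4 * r / (r - 1) * r powr - real k" by (simp add: \<epsilon>_def)
      finally show ?thesis .
    qed
  qed (simp add: c_def)
  then show ?thesis by blast
qed

section \<open>Sums over the levels of a partition\<close>

text \<open>Weighted arithmetic-geometric mean: on \<open>[0,1]\<close> the convex function \<open>u \<mapsto> z\<^sup>u\<close> lies below its chord. It controls
  the rounding of a real crossing level to an integer.\<close>

lemma powr_le_chord:
  fixes z u :: real
  assumes "z > 0" "0 \<le> u" "u \<le> 1"
  shows "z powr u \<le> 1 + u * (z - 1)"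
  using Youngs_inequality_0[of u "1 - u" z 1] assms by (simp add: algebra_simps)

text \<open>The cost of an annulus, up to a factor: \<open>\<rho>\<^sup>k - \<rho>\<^sup>k\<^sup>+\<^sup>1\<close> is the price difference between two levels, and
  \<open>min 1 (c R\<^sup>k)\<close> bounds the proportion of mass that is left over.\<close>

definition level_sum :: "real \<Rightarrow> real \<Rightarrow> real \<Rightarrow> nat \<Rightarrow> real" where
  "level_sum \<rho> R c L = (\<Sum>k<L. (\<rho> ^ k - \<rho> ^ Suc k) * min 1 (c * R ^ k))"

text \<open>Above any level \<open>n\<close> the bound \<open>1\<close> for the proportion makes the sum telescope.\<close>

lemma level_sum_truncate:
  assumes \<rho>: "0 < \<rho>" "\<rho> < 1" and "R > 0" "c > 0"
  shows "level_sum \<rho> R c L \<le> c * (1 - \<rho>) * (\<Sum>k<n. (\<rho> * R) ^ k) + \<rho> ^ n"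
proof -
  define w where "w k = \<rho> ^ k - \<rho> ^ Suc k" for k
  have w: "w k \<ge> 0" for k using \<rho> by (simp add: w_def mult_left_le_one_le)
  have "level_sum \<rho> R c L = (\<Sum>k<L. w k * min 1 (c * R ^ k))" by (simp add: level_sum_def w_def)
  also have "\<dots> \<le> (\<Sum>k<max L n. w k * min 1 (c * R ^ k))"
    using w assms by (intro sum_mono2) auto
  also have "\<dots> = (\<Sum>k<n. w k * min 1 (c * R ^ k)) + (\<Sum>k\<in>{n..<max L n}. w k * min 1 (c * R ^ k))"
    using sum.atLeastLessThan_concat[of 0 n "max L n" "\<lambda>k. w k * min 1 (c * R ^ k)"]
    by (simp add: lessThan_atLeast0)
  also have "(\<Sum>k<n. w k * min 1 (c * R ^ k)) \<le> (\<Sum>k<n. w k * (c * R ^ k))"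
    using w by (intro sum_mono mult_left_mono) auto
  also have "\<dots> = c * (1 - \<rho>) * (\<Sum>k<n. (\<rho> * R) ^ k)"
    by (simp add: w_def sum_distrib_left power_mult_distrib algebra_simps)
  also have "(\<Sum>k\<in>{n..<max L n}. w k * min 1 (c * R ^ k)) \<le> (\<Sum>k\<in>{n..<max L n}. w k * 1)"
    using w by (intro sum_mono mult_left_mono) auto
  also have "\<dots> = \<rho> ^ n - \<rho> ^ max L n"
    using sum_Suc_diff'[of n "max L n" "\<lambda>k. - (\<rho> ^ k)"] by (simp add: w_def algebra_simps)
  also have "\<dots> \<le> \<rho> ^ n" using \<rho> by simp
  finally show ?thesis by simp
qed

lemma level_sum_supercritical:
  assumes \<rho>: "0 < \<rho>" "\<rho> < 1" and R: "R > 0" "\<rho> * R < 1" and c: "c > 0"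
  shows "level_sum \<rho> R c L \<le> c / (1 - \<rho> * R)"
proof -
  have "level_sum \<rho> R c L \<le> (\<Sum>k<L. \<rho> ^ k * (c * R ^ k))"
    unfolding level_sum_def using \<rho> R c
    by (intro sum_mono mult_mono) (auto simp: mult_left_le_one_le)
  also have "\<dots> = c * (\<Sum>k<L. (\<rho> * R) ^ k)"
    by (simp add: sum_distrib_left power_mult_distrib algebra_simps)
  also have "(\<Sum>k<L. (\<rho> * R) ^ k) = (1 - (\<rho> * R) ^ L) / (1 - \<rho> * R)"
    using R by (subst sum_gp_strict) auto
  also have "c * \<dots> \<le> c * (1 / (1 - \<rho> * R))"
    using c \<rho> R by (intro mult_left_mono divide_right_mono) auto
  finally show ?thesis by simp
qed

text \<open>For \<open>\<rho> R = 1\<close> all levels below the cut cost the same. Cutting at the real number \<open>l\<close> with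
  \<open>\<rho>\<^sup>l = c / (1 - \<rho>)\<close> would give the claim; the loss \<open>c u\<close> by rounding \<open>l\<close> up is regained in the tail, by the
  chord bound.\<close>

lemma level_sum_critical:
  assumes \<rho>: "0 < \<rho>" "\<rho> < 1" and R: "\<rho> * R = 1" and c: "c > 0"
  shows "level_sum \<rho> R c L \<le> c * (max 0 (ln ((1 - \<rho>) / c) / (- ln \<rho>)) + 1 / (1 - \<rho>))"
proof -
  have R0: "R > 0" using R \<rho> by (metis zero_less_mult_pos zero_less_one)
  define l where "l = ln ((1 - \<rho>) / c) / (- ln \<rho>)"
  show ?thesis
  proof (cases "l \<le> 0")
    case True
    have "ln ((1 - \<rho>) / c) \<le> 0" using True \<rho> by (simp add: l_def field_simps zero_le_divide_iff divide_le_0_iff)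
    then have "(1 - \<rho>) / c \<le> 1" using \<rho> c by simp
    then have "1 \<le> c / (1 - \<rho>)" using \<rho> c by (simp add: field_simps)
    moreover have "level_sum \<rho> R c L \<le> 1"
      using level_sum_truncate[OF \<rho> R0 c, of L 0] by simp
    ultimately show ?thesis unfolding l_def[symmetric] using True by (simp add: max_absorb1)
  next
    case False
    define n where "n = nat \<lceil>l\<rceil>"
    define u where "u = real n - l"
    have n: "real n = of_int \<lceil>l\<rceil>" using False by (simp add: n_def)
    have u: "0 \<le> u" "u \<le> 1" unfolding u_def n by linarith+
    have "\<rho> powr l = c / (1 - \<rho>)"
    proof -
      have "\<rho> powr l = exp (- ln ((1 - \<rho>) / c))" using \<rho> by (simp add: powr_def l_def)
      also have "\<dots> = c / (1 - \<rho>)" using \<rho> c by (simp add: exp_minus)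
      finally show ?thesis .
    qed
    moreover have "\<rho> ^ n = \<rho> powr l * \<rho> powr u"
      using \<rho> by (simp add: u_def flip: powr_add powr_realpow)
    ultimately have "\<rho> ^ n = c / (1 - \<rho>) * \<rho> powr u" by simp
    also have "\<dots> \<le> c / (1 - \<rho>) * (1 + u * (\<rho> - 1))"
      using \<rho> c u by (intro mult_left_mono powr_le_chord) auto
    also have "\<dots> = c / (1 - \<rho>) - c * u" using \<rho> by (simp add: field_simps)
    finally have pn: "\<rho> ^ n \<le> c / (1 - \<rho>) - c * u" .
    have "level_sum \<rho> R c L \<le> c * (1 - \<rho>) * real n + \<rho> ^ n"
      using level_sum_truncate[OF \<rho> R0 c, of L n] R by simp
    also have "c * (1 - \<rho>) * real n \<le> c * real n"
      using \<rho> c by (intro mult_right_mono mult_right_le_one_le) auto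
    also have "c * real n = c * l + c * u" by (simp add: u_def algebra_simps)
    finally have "level_sum \<rho> R c L \<le> c * (l + 1 / (1 - \<rho>))" using pn by (simp add: algebra_simps)
    then show ?thesis unfolding l_def[symmetric] using False by (simp add: max_absorb2)
  qed
qed

text \<open>The cut is at the crossing level \<open>x\<close>, given by \<open>R\<^sup>x = 1/c\<close>, rounded up by some \<open>u\<close> in \<open>[0,1]\<close>. Head and tail are
  both convex in \<open>u\<close>, and their chords have opposite slopes, so that the sum of the two bounds is free of \<open>u\<close>.
  For \<open>c \<ge> 1\<close> there is no crossing and the sum is at most \<open>1\<close>.\<close>

lemma level_sum_subcritical:
  assumes R: "R > 1" and \<gamma>: "0 < \<gamma>" "\<gamma> < 1" and c: "c > 0"
  shows "level_sum (R powr (- \<gamma>)) R c L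
           \<le> c powr \<gamma> * ((1 - 1 / R) powr (1 - \<gamma>) / (1 - R powr (\<gamma> - 1)))"
proof -
  define \<rho> where "\<rho> = R powr (- \<gamma>)"
  have \<rho>: "0 < \<rho>" "\<rho> < 1" using R \<gamma> powr_less_one[of R "- \<gamma>"] by (auto simp: \<rho>_def)
  define z where "z = \<rho> * R"
  have z_powr: "z = R powr (1 - \<gamma>)"
  proof -
    have "R powr (- \<gamma>) * R powr 1 = R powr (- \<gamma> + 1)" by (rule powr_add[symmetric])
    also have "R powr 1 = R" using R by simp
    also have "- \<gamma> + 1 = 1 - \<gamma>" by simp
    finally show ?thesis by (simp only: z_def \<rho>_def)
  qed
  have z: "z > 1" unfolding z_powr using R \<gamma> by (simp add: gr_one_powr)
  have inv: "R powr (\<gamma> - 1) = 1 / z"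
    unfolding z_powr by (metis minus_diff_eq powr_minus_divide)
  have zR: "z \<le> R" unfolding z_def using \<rho> R by simp
  have base: "0 < 1 - 1 / R" "1 - 1 / R \<le> 1" using R by auto
  have wk: "1 - 1 / R \<le> (1 - 1 / R) powr (1 - \<gamma>)"
    using powr_mono'[of "1 - \<gamma>" 1 "1 - 1 / R"] base \<gamma> by simp
  have den: "0 < 1 - 1 / z" using z by simp
  have goal: "level_sum \<rho> R c L \<le> c powr \<gamma> * ((1 - 1 / R) / (1 - 1 / z)) \<or> 1 \<le> c \<and> level_sum \<rho> R c L \<le> 1"
  proof (cases "1 \<le> c")
    case True
    then show ?thesis using level_sum_truncate[OF \<rho> _ c, of R L 0] R by simp
  next
    case False
    define x where "x = - ln c / ln R"
    have "ln c < 0" using False c by simp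
    then have x: "x > 0" using R by (simp add: x_def divide_neg_pos)
    have Rx: "R powr x = 1 / c" using R c by (simp add: powr_def x_def exp_minus inverse_eq_divide)
    have \<rho>x: "\<rho> powr x = c powr \<gamma>"
    proof -
      have "\<rho> powr x = exp (- (\<gamma> * (x * ln R)))" using R by (simp add: \<rho>_def powr_powr powr_def mult.assoc)
      also have "x * ln R = - ln c" using R by (simp add: x_def)
      finally show ?thesis using c by (simp add: powr_def)
    qed
    define n where "n = nat \<lceil>x\<rceil>"
    define u where "u = real n - x"
    have n: "real n = of_int \<lceil>x\<rceil>" using x by (simp add: n_def)
    have u: "0 \<le> u" "u \<le> 1" unfolding u_def n by linarith+
    have \<rho>n: "\<rho> ^ n = c powr \<gamma> * \<rho> powr u"
    proof -
      have "\<rho> ^ n = \<rho> powr (x + u)" using \<rho> by (simp add: u_def powr_realpow)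
      then show ?thesis by (simp add: powr_add \<rho>x)
    qed
    have factor: "a * (g * b) + g * b' = g * (a * b + b')" for a b b' g :: real
      by (simp add: algebra_simps)
    have zn: "c * z ^ n = c powr \<gamma> * z powr u"
    proof -
      have "z ^ n = z powr (x + u)" using z by (simp add: u_def powr_realpow)
      then have "z ^ n = z powr x * z powr u" by (simp add: powr_add)
      moreover have "z powr x = \<rho> powr x * R powr x" using \<rho> R by (simp add: z_def powr_mult)
      ultimately show ?thesis using c by (simp add: \<rho>x Rx)
    qed
    have "level_sum \<rho> R c L \<le> c * (1 - \<rho>) * (\<Sum>k<n. z ^ k) + \<rho> ^ n"
      unfolding z_def using level_sum_truncate[OF \<rho> _ c, of R L n] R by simp
    also have "(\<Sum>k<n. z ^ k) = (z ^ n - 1) / (z - 1)"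
      using z minus_divide_divide[of "z ^ n - 1" "z - 1"] by (simp add: sum_gp_strict)
    also have "c * (1 - \<rho>) * ((z ^ n - 1) / (z - 1)) \<le> c * (1 - \<rho>) * (z ^ n / (z - 1))"
      using c \<rho> z by (intro mult_left_mono divide_right_mono) auto
    also have "\<dots> = (1 - \<rho>) / (z - 1) * (c powr \<gamma> * z powr u)"
      unfolding zn[symmetric] by simp
    also have "\<dots> \<le> (1 - \<rho>) / (z - 1) * (c powr \<gamma> * (1 + u * (z - 1)))"
      using \<rho> z u by (intro mult_left_mono powr_le_chord) auto
    also have "\<rho> ^ n \<le> c powr \<gamma> * (1 + u * (\<rho> - 1))"
      unfolding \<rho>n using \<rho> u by (intro mult_left_mono powr_le_chord) auto
    also have "(1 - \<rho>) / (z - 1) * (c powr \<gamma> * (1 + u * (z - 1))) + c powr \<gamma> * (1 + u * (\<rho> - 1))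
        = c powr \<gamma> * ((1 - \<rho>) / (z - 1) * (1 + u * (z - 1)) + (1 + u * (\<rho> - 1)))"
      by (simp only: factor)
    finally have "level_sum \<rho> R c L \<le>
        c powr \<gamma> * ((1 - \<rho>) / (z - 1) * (1 + u * (z - 1)) + (1 + u * (\<rho> - 1)))"
      by simp
    also have "(1 - \<rho>) / (z - 1) * (1 + u * (z - 1)) + (1 + u * (\<rho> - 1)) = (z - \<rho>) / (z - 1)"
    proof -
      have "(1 - \<rho>) / (z - 1) * (1 + u * (z - 1)) = (1 - \<rho>) / (z - 1) + (1 - \<rho>) * u"
        using z by (simp add: distrib_left)
      moreover have "(z - \<rho>) / (z - 1) = (1 - \<rho>) / (z - 1) + 1" using z by (simp add: field_simps)
      ultimately show ?thesis by (simp add: algebra_simps)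
    qed
    also have "\<dots> = (1 - 1 / R) / (1 - 1 / z)"
    proof -
      have "z - \<rho> = z * (1 - 1 / R)" using R by (simp add: z_def algebra_simps)
      moreover have "z - 1 = z * (1 - 1 / z)" using z by (simp add: algebra_simps)
      ultimately show ?thesis using z by simp
    qed
    finally show ?thesis by simp
  qed
  have big: "1 \<le> c powr \<gamma> * ((1 - 1 / R) powr (1 - \<gamma>) / (1 - 1 / z))" if "1 \<le> c"
  proof -
    have "1 - 1 / z \<le> (1 - 1 / R) powr (1 - \<gamma>)" using wk frac_le[of 1 1 z R] zR z by simp
    then have "1 \<le> (1 - 1 / R) powr (1 - \<gamma>) / (1 - 1 / z)" using den by (simp add: le_divide_eq)
    moreover have "1 \<le> c powr \<gamma>" using that \<gamma> by (simp add: ge_one_powr_ge_zero)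
    ultimately have "1 * 1 \<le> c powr \<gamma> * ((1 - 1 / R) powr (1 - \<gamma>) / (1 - 1 / z))"
      by (intro mult_mono) auto
    then show ?thesis by simp
  qed
  have "c powr \<gamma> * ((1 - 1 / R) / (1 - 1 / z)) \<le> c powr \<gamma> * ((1 - 1 / R) powr (1 - \<gamma>) / (1 - 1 / z))"
    using wk den by (intro mult_left_mono divide_right_mono) auto
  then have "level_sum \<rho> R c L \<le> c powr \<gamma> * ((1 - 1 / R) powr (1 - \<gamma>) / (1 - 1 / z))"
    using goal big by linarith
  then show ?thesis unfolding inv unfolding \<rho>_def .
qed

section \<open>Decomposition into annuli\<close>

definition annulus :: "ereal \<Rightarrow> real \<Rightarrow> real \<Rightarrow> nat \<Rightarrow> (real ^ 'n::finite) set" where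
  "annulus m t a i = {x. lnorm m x < t * a ^ i \<and> (\<forall>j<i. t * a ^ j \<le> lnorm m x)}"

definition annulus_index :: "ereal \<Rightarrow> real \<Rightarrow> real \<Rightarrow> real ^ 'n::finite \<Rightarrow> nat" where
  "annulus_index m t a x = (LEAST i. lnorm m x < t * a ^ i)"

lemma lnorm_less_radius:
  assumes "t > 0" "a > 1"
  shows "lnorm m x < t * a ^ annulus_index m t a x"
proof -
  obtain n where "lnorm m x / t < a ^ n" using real_arch_pow[OF assms(2)] by blast
  then have "lnorm m x < t * a ^ n" using assms by (simp add: field_simps)
  then show ?thesis unfolding annulus_index_def by (rule LeastI)
qed

lemma annulus_index_eq_iff:
  assumes "t > 0" "a > 1"
  shows "annulus_index m t a x = i \<longleftrightarrow> x \<in> annulus m t a i"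
proof
  assume i: "annulus_index m t a x = i"
  have "t * a ^ j \<le> lnorm m x" if "j < i" for j
    using not_less_Least[of j "\<lambda>i. lnorm m x < t * a ^ i"] that i
    by (simp add: annulus_index_def not_less)
  then show "x \<in> annulus m t a i" using lnorm_less_radius[OF assms, of m x] i by (simp add: annulus_def)
next
  assume "x \<in> annulus m t a i"
  then show "annulus_index m t a x = i"
    unfolding annulus_index_def annulus_def
    by (intro Least_equality) (auto simp: not_less[symmetric])
qed

lemma annulus_measurable [measurable]: "annulus m t a i \<in> sets borel"
  unfolding annulus_def by measurable

lemma annulus_index_measurable [measurable]:
  "annulus_index m t a \<in> measurable borel (count_space UNIV)"
  unfolding annulus_index_def[abs_def] by measurable

text \<open>The factor \<open>2\<^sup>p eps_p p\<close> is \<open>max 1 (2\<^sup>p\<^sup>-\<^sup>1)\<close>: subadditivity for \<open>p \<le> 1\<close>, convexity for \<open>p \<ge> 1\<close>.\<close>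

lemma powr_sum_le:
  fixes x y b c p :: real
  assumes p: "p > 0" and "0 \<le> x" "x \<le> b" "0 \<le> y" "y \<le> c"
  shows "(x + y) powr p \<le> 2 powr p * eps_p p * (b powr p + c powr p)"
proof -
  have bc: "0 \<le> b" "0 \<le> c" using assms by auto
  have "(x + y) powr p \<le> (b + c) powr p" using assms by (intro powr_mono2) auto
  also have "\<dots> \<le> 2 powr p * eps_p p * (b powr p + c powr p)"
  proof (cases "p \<ge> 1")
    case True
    have "(b + c) powr p = 2 powr p * (1 / 2 * b + (1 - 1 / 2) * c) powr p"
    proof -
      have "b + c = 2 * (1 / 2 * b + (1 - 1 / 2) * c)" by simp
      then have "(b + c) powr p = (2 * (1 / 2 * b + (1 - 1 / 2) * c)) powr p" by (rule arg_cong)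
      also have "\<dots> = 2 powr p * (1 / 2 * b + (1 - 1 / 2) * c) powr p" using bc by (intro powr_mult)
      finally show ?thesis .
    qed
    also have "\<dots> \<le> 2 powr p * (1 / 2 * b powr p + (1 - 1 / 2) * c powr p)"
      using bc True by (intro mult_left_mono powr_convex_nonneg) auto
    also have "\<dots> = 2 powr p * (1 / 2) * (b powr p + c powr p)" by (simp add: algebra_simps)
    also have "\<dots> \<le> 2 powr p * eps_p p * (b powr p + c powr p)"
    proof (intro mult_right_mono mult_left_mono)
      have "2 powr (- 1) = (1 / 2 :: real)" by (simp add: powr_minus)
      moreover have "2 powr (- 1) \<le> eps_p p" unfolding eps_p_def by (rule max.cobounded1)
      ultimately show "1 / 2 \<le> eps_p p" by simp
    qed auto
    finally show ?thesis .
  next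
    case False
    have sub: "(b + c) powr p \<le> b powr p + c powr p"
    proof (cases "b + c = 0")
      case True
      then show ?thesis using bc by simp
    next
      case nz: False
      then have s: "b + c > 0" using bc by simp
      have le: "w / (b + c) \<le> (w / (b + c)) powr p" if "0 \<le> w" "w \<le> b + c" for w
        using powr_mono'[of p 1 "w / (b + c)"] that s False p by simp
      have "1 = b / (b + c) + c / (b + c)" using s by (simp flip: add_divide_distrib)
      also have "\<dots> \<le> (b / (b + c)) powr p + (c / (b + c)) powr p"
        using bc by (intro add_mono le) auto
      also have "\<dots> = (b powr p + c powr p) / (b + c) powr p"
        using bc s by (simp add: powr_divide add_divide_distrib)
      finally show ?thesis using s by (simp add: le_divide_eq)
    qed
    have "1 = 2 powr p * 2 powr (- p)" by (simp flip: powr_add)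
    also have "\<dots> \<le> 2 powr p * eps_p p" by (intro mult_left_mono) (simp_all add: eps_p_def)
    finally have "1 * (b powr p + c powr p) \<le> 2 powr p * eps_p p * (b powr p + c powr p)"
      by (intro mult_right_mono) auto
    then have "b powr p + c powr p \<le> 2 powr p * eps_p p * (b powr p + c powr p)" by (simp only: mult_1)
    with sub show ?thesis by (rule order_trans)
  qed
  finally show ?thesis .
qed

definition deviation :: "nat \<Rightarrow> real \<Rightarrow> real" where
  "deviation N x = min x (sqrt (x / real N) / 2)"

lemma deviation_nonneg: "0 \<le> x \<Longrightarrow> 0 \<le> deviation N x"
  by (simp add: deviation_def)

text \<open>The number of cells enters through Cauchy-Schwarz, applied to the square roots of their masses.\<close>

lemma (in prob_space) sum_deviation_le:
  assumes J: "finite J" and S: "\<And>j. S j \<in> events" "disjoint_family S" "\<And>j. S j \<subseteq> G" "G \<in> events"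
    and out: "\<And>j. j \<notin> J \<Longrightarrow> S j = {}" and card: "real (card J) \<le> n"
  shows "(\<integral>\<^sup>+ j. ennreal (deviation N (prob (S j))) \<partial>count_space UNIV)
           \<le> ennreal (min (prob G) (sqrt (n * prob G / real N) / 2))"
proof -
  have sum: "(\<Sum>j\<in>J. prob (S j)) \<le> prob G"
  proof -
    have "(\<Sum>j\<in>J. prob (S j)) = prob (\<Union>j\<in>J. S j)"
      using S J by (intro finite_measure_finite_Union[symmetric])
        (auto simp: disjoint_family_on_def)
    also have "\<dots> \<le> prob G" using S by (intro finite_measure_mono) auto
    finally show ?thesis .
  qed
  have sqrt_sum: "(\<Sum>j\<in>J. sqrt (prob (S j) / real N)) \<le> sqrt (n * prob G / real N)"
  proof (rule real_le_rsqrt)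
    have "(\<Sum>j\<in>J. sqrt (prob (S j) / real N))\<^sup>2 \<le> (\<Sum>j\<in>J. (sqrt (prob (S j) / real N))\<^sup>2) * real (card J)"
      by (rule sum_squared_le_sum_of_squares)
    also have "(\<Sum>j\<in>J. (sqrt (prob (S j) / real N))\<^sup>2) = (\<Sum>j\<in>J. prob (S j)) / real N"
      by (simp add: sum_divide_distrib)
    also have "\<dots> * real (card J) \<le> (prob G / real N) * n"
      using sum card by (intro mult_mono divide_right_mono) auto
    finally show "(\<Sum>j\<in>J. sqrt (prob (S j) / real N))\<^sup>2 \<le> n * prob G / real N" by (simp add: mult.commute)
  qed
  have "(\<integral>\<^sup>+ j. ennreal (deviation N (prob (S j))) \<partial>count_space UNIV)
      = (\<Sum>j\<in>J. ennreal (deviation N (prob (S j))))"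
    using J out by (intro nn_integral_count_space') (auto simp: deviation_def)
  also have "\<dots> = ennreal (\<Sum>j\<in>J. deviation N (prob (S j)))"
    by (intro sum_ennreal) (simp add: deviation_nonneg)
  also have "\<dots> \<le> ennreal (min (prob G) (sqrt (n * prob G / real N) / 2))"
  proof (intro ennreal_leI min.boundedI)
    have "(\<Sum>j\<in>J. deviation N (prob (S j))) \<le> (\<Sum>j\<in>J. prob (S j))"
      by (intro sum_mono) (simp add: deviation_def)
    then show "(\<Sum>j\<in>J. deviation N (prob (S j))) \<le> prob G" using sum by linarith
    have "(\<Sum>j\<in>J. deviation N (prob (S j))) \<le> (\<Sum>j\<in>J. sqrt (prob (S j) / real N) / 2)"
      by (intro sum_mono) (simp add: deviation_def)
    then show "(\<Sum>j\<in>J. deviation N (prob (S j))) \<le> sqrt (n * prob G / real N) / 2"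
      using sqrt_sum by (simp flip: sum_divide_distrib)
  qed
  finally show ?thesis .
qed

text \<open>The cost of matching, level by level, inside an annulus of mass \<open>x\<close> and outer radius \<open>1\<close>: the price difference
  between levels \<open>k\<close> and \<open>k + 1\<close>, times the bound for the expected mass that is left over after level \<open>k + 1\<close>.\<close>

definition annulus_cost :: "nat \<Rightarrow> real \<Rightarrow> real \<Rightarrow> real \<Rightarrow> real \<Rightarrow> real \<Rightarrow> nat \<Rightarrow> real \<Rightarrow> real" where
  "annulus_cost N D p \<delta> r A L x =
     (\<Sum>k<L. ((\<delta> * r powr (- real k)) powr p - (\<delta> * r powr (- real (Suc k))) powr p) *
        min x (sqrt (A * r powr (D * real (Suc k)) * x / real N) / 2))"

context iid_sample
begin

abbreviation expected_cost :: "real \<Rightarrow> ereal \<Rightarrow> ennreal" where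
  "expected_cost p m \<equiv> (\<integral>\<^sup>+ \<omega>. transport_cost p m (emp \<omega>) \<mu> \<partial>M)"

lemma expected_excess:
  fixes C :: "real ^ 'n \<Rightarrow> 'c::countable"
  assumes C: "C \<in> measurable borel (count_space UNIV)"
  shows "(\<integral>\<^sup>+ \<omega>. excess C \<phi> (emp \<omega>) \<mu> \<partial>M) =
           (\<integral>\<^sup>+ i. \<phi> i * (\<integral>\<^sup>+ \<omega>. emeasure (emp \<omega>) (C -` {i}) - emeasure \<mu> (C -` {i}) \<partial>M) \<partial>count_space UNIV)"
    and "(\<integral>\<^sup>+ \<omega>. excess C \<phi> \<mu> (emp \<omega>) \<partial>M) =
           (\<integral>\<^sup>+ i. \<phi> i * (\<integral>\<^sup>+ \<omega>. emeasure \<mu> (C -` {i}) - emeasure (emp \<omega>) (C -` {i}) \<partial>M) \<partial>count_space UNIV)"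
    and "(\<lambda>\<omega>. excess C \<phi> (emp \<omega>) \<mu>) \<in> borel_measurable M"
    and "(\<lambda>\<omega>. excess C \<phi> \<mu> (emp \<omega>)) \<in> borel_measurable M"
proof -
  have S: "C -` {i} \<in> sets borel" for i
    using measurable_sets[OF C, of "{i}"] by simp
  have up: "(\<lambda>\<omega>. emeasure (emp \<omega>) (C -` {i}) - emeasure \<mu> (C -` {i})) \<in> borel_measurable M" for i
    using emp_measurable[OF S] by (intro borel_measurable_minus_ennreal) simp_all
  have lo: "(\<lambda>\<omega>. emeasure \<mu> (C -` {i}) - emeasure (emp \<omega>) (C -` {i})) \<in> borel_measurable M" for i
    using emp_measurable[OF S] by (intro borel_measurable_minus_ennreal) simp_all
  have up': "(\<lambda>\<omega>. \<phi> i * (emeasure (emp \<omega>) (C -` {i}) - emeasure \<mu> (C -` {i}))) \<in> borel_measurable M" for i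
    using up by (intro borel_measurable_times_ennreal) simp_all
  have lo': "(\<lambda>\<omega>. \<phi> i * (emeasure \<mu> (C -` {i}) - emeasure (emp \<omega>) (C -` {i}))) \<in> borel_measurable M" for i
    using lo by (intro borel_measurable_times_ennreal) simp_all
  show "(\<integral>\<^sup>+ \<omega>. excess C \<phi> (emp \<omega>) \<mu> \<partial>M) =
           (\<integral>\<^sup>+ i. \<phi> i * (\<integral>\<^sup>+ \<omega>. emeasure (emp \<omega>) (C -` {i}) - emeasure \<mu> (C -` {i}) \<partial>M) \<partial>count_space UNIV)"
    unfolding excess_def nn_integral_cmult[OF up, symmetric]
    by (rule nn_integral_count_space_nn_integral) (simp_all add: up')
  show "(\<integral>\<^sup>+ \<omega>. excess C \<phi> \<mu> (emp \<omega>) \<partial>M) =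
           (\<integral>\<^sup>+ i. \<phi> i * (\<integral>\<^sup>+ \<omega>. emeasure \<mu> (C -` {i}) - emeasure (emp \<omega>) (C -` {i}) \<partial>M) \<partial>count_space UNIV)"
    unfolding excess_def nn_integral_cmult[OF lo, symmetric]
    by (rule nn_integral_count_space_nn_integral) (simp_all add: lo')
  have sf: "sigma_finite_measure (count_space (UNIV :: 'c set))"
    by (rule sigma_finite_measure_count_space_countable) simp
  have meas: "(\<lambda>\<omega>. \<integral>\<^sup>+ i. f i \<omega> \<partial>count_space UNIV) \<in> borel_measurable M"
    if f: "\<And>i. f i \<in> borel_measurable M" for f :: "'c \<Rightarrow> 'w \<Rightarrow> ennreal"
  proof (rule sigma_finite_measure.borel_measurable_nn_integral[OF sf])
    have "(\<lambda>z. f (snd z) (fst z)) \<in> borel_measurable (M \<Otimes>\<^sub>M count_space (UNIV :: 'c set))"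
    proof (rule measurable_compose_countable'[where I = UNIV and f = "\<lambda>i z. f i (fst z)"])
      show "(\<lambda>z. f i (fst z)) \<in> borel_measurable (M \<Otimes>\<^sub>M count_space (UNIV :: 'c set))" for i
        by (rule measurable_compose[OF measurable_fst f])
    qed simp_all
    then show "(\<lambda>(\<omega>, i). f i \<omega>) \<in> borel_measurable (M \<Otimes>\<^sub>M count_space (UNIV :: 'c set))"
      by (simp add: case_prod_beta)
  qed
  show "(\<lambda>\<omega>. excess C \<phi> (emp \<omega>) \<mu>) \<in> borel_measurable M"
    unfolding excess_def by (rule meas[OF up'])
  show "(\<lambda>\<omega>. excess C \<phi> \<mu> (emp \<omega>)) \<in> borel_measurable M"
    unfolding excess_def by (rule meas[OF lo'])
qed

end

section \<open>Expected cost over the annuli\<close>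

context iid_sample
begin

text \<open>The labels of the unit ball are transported to every annulus by scaling, so a cell is a pair of an annulus
  index and a label, and the price of a level is \<open>d k\<close> times the \<open>p\<close>-th power of the radius. For the central
  ball the mass exchanged with the other annuli is measured through the complement, whose probability is
  small; this is what keeps the central ball out of the second part of the final bound.\<close>

lemma expected_cost_by_annuli:
  fixes m :: ereal and p t a r A \<delta> :: real and c :: "nat \<Rightarrow> real ^ 'n \<Rightarrow> nat"
  assumes m: "m \<ge> 1" and p: "p > 0" and t: "t > 0" and a: "a > 1" and r: "r > 1"
    and A: "A \<ge> 0" and \<delta>: "\<delta> \<ge> 0" and cells: "nested_cells m r A \<delta> L c"
  defines "d \<equiv> \<lambda>k. (\<delta> * r powr (- real k)) powr p"
    and "mass \<equiv> \<lambda>i. measure \<mu> (annulus m t a i)"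
    and "dmass \<equiv> \<lambda>i. measure \<mu> (if i = 0 then UNIV - annulus m t a 0 else annulus m t a i)"
  shows "expected_cost p m \<le>
     (\<integral>\<^sup>+ i. ennreal ((t * a ^ i) powr p *
        (annulus_cost N (real CARD('n)) p \<delta> r A L (mass i)
         + d L * mass i + 2 powr p * eps_p p * (2 * deviation N (dmass i)))) \<partial>count_space UNIV)"
proof -
  define rad where "rad i = t * a ^ i" for i
  have rad: "rad i > 0" for i using t a by (simp add: rad_def)
  define ann where "ann = (annulus_index m t a :: real ^ 'n \<Rightarrow> nat)"
  have ann_meas [measurable]: "ann \<in> measurable borel (count_space UNIV)" unfolding ann_def by measurable
  have ann_lt: "lnorm m x < rad (ann x)" for x
    unfolding rad_def ann_def by (rule lnorm_less_radius[OF t a])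
  have ann_iff: "ann x = i \<longleftrightarrow> x \<in> annulus m t a i" for x i
    unfolding ann_def by (rule annulus_index_eq_iff[OF t a])
  define sc where "sc x = (1 / rad (ann x)) *\<^sub>R x" for x
  have sc: "sc x \<in> lball m 0 1" for x
    using ann_lt[of x] rad[of "ann x"] by (simp add: in_unit_lball sc_def lnorm_scaleR[OF m] field_simps)
  have sc_meas [measurable]: "sc \<in> measurable borel borel" unfolding sc_def by measurable
  define C where "C k x = (ann x, c k (sc x))" for k x
  note cl = nested_cellsD[OF cells]
  have c_meas [measurable]: "k \<le> L \<Longrightarrow> c k \<in> measurable borel (count_space UNIV)" for k
    by (rule cl(1))
  have C_meas [measurable]: "C k \<in> measurable borel (count_space UNIV)" if "k \<le> L" for k
  proof -
    have "(\<lambda>x. (ann x, c k (sc x))) \<in> measurable borel (count_space UNIV \<Otimes>\<^sub>M count_space UNIV)"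
      using c_meas[OF that] by measurable
    then show ?thesis by (simp add: C_def[abs_def] pair_measure_countable)
  qed
  define G where "G x = ennreal (rad (ann x) powr p)" for x
  define \<phi> where "\<phi> k z = ennreal (rad (fst z) powr p)" for k :: nat and z :: "nat \<times> nat"
  define \<gamma> where "\<gamma> = 2 powr p * eps_p p"
  have \<gamma>: "\<gamma> \<ge> 0" by (simp add: \<gamma>_def eps_p_def)
  define \<psi> where "\<psi> z = ennreal (\<gamma> * rad (fst z) powr p)" for z :: "nat \<times> nat"
  define cst where "cst x y = ennreal (lnorm m (x - y) powr p)" for x y :: "real ^ 'n"
  have d0: "0 \<le> d k" for k by (simp add: d_def)
  have dS: "d (Suc k) \<le> d k" for k
    unfolding d_def using r \<delta> p by (intro powr_mono2 mult_left_mono powr_mono) auto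
  have two: "two_laws (emp \<omega>) \<mu>" for \<omega>
    by (rule two_laws.intro) (simp_all add: prob_law prob_space_empirical_measure[OF N_pos])
  have cost: "transport_cost p m (emp \<omega>) \<mu> \<le> ennreal (d L) * (\<integral>\<^sup>+ x. G x \<partial>emp \<omega>) +
        (\<Sum>j<L. ennreal (d j - d (Suc j)) * excess (C (Suc j)) (\<phi> (Suc j)) (emp \<omega>) \<mu>)
        + excess (C 0) \<psi> (emp \<omega>) \<mu> + excess (C 0) \<psi> \<mu> (emp \<omega>)" (is "_ \<le> ?R \<omega>") for \<omega>
  proof -
    have "\<exists>\<xi>. prob_space \<xi> \<and> sets \<xi> = sets borel \<and> distr \<xi> borel fst = emp \<omega> \<and> distr \<xi> borel snd = \<mu> \<and>
      (\<integral>\<^sup>+ (x, y). cst x y \<partial>\<xi>) \<le> ?R \<omega>"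
    proof (rule two_laws.hierarchical_coupling[OF two])
      show "C k \<in> measurable borel (count_space UNIV)" if "k \<le> L" for k using C_meas[OF that] .
      show "C k x = C k y" if "k < L" "C (Suc k) x = C (Suc k) y" for k x y
      proof -
        have eq: "ann x = ann y" "c (Suc k) (sc x) = c (Suc k) (sc y)" using that(2) by (simp_all add: C_def)
        have "c k (sc x) = c k (sc y)" by (rule cl(3)[OF that(1) sc sc eq(2)])
        then show ?thesis using eq(1) by (simp add: C_def)
      qed
      show "d (Suc k) \<le> d k" for k by (rule dS)
      show "0 \<le> d k" for k by (rule d0)
      show "G x = \<phi> k (C k x)" for k x by (simp add: G_def \<phi>_def C_def)
      show "G \<in> borel_measurable borel" unfolding G_def by measurable
      have "(\<lambda>(x, y). cst x y) \<in> borel_measurable (borel \<Otimes>\<^sub>M borel)" unfolding cst_def by measurable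
      then show "(\<lambda>(x, y). cst x y) \<in> borel_measurable (emp \<omega> \<Otimes>\<^sub>M \<mu>)"
        by (simp cong: measurable_cong_sets sets_pair_measure_cong)
      show "cst x y \<le> ennreal (d k) * G x" if k: "k \<le> L" and eq: "C k x = C k y" for k x y
      proof -
        have eq': "ann x = ann y" "c k (sc x) = c k (sc y)" using eq by (auto simp: C_def)
        have "lnorm m (sc x - sc y) \<le> \<delta> * r powr (- real k)"
          by (rule cl(6)[OF k sc sc eq'(2)])
        moreover have "sc x - sc y = (1 / rad (ann x)) *\<^sub>R (x - y)"
          using eq' by (simp add: sc_def scaleR_diff_right)
        ultimately have "lnorm m ((1 / rad (ann x)) *\<^sub>R (x - y)) \<le> \<delta> * r powr (- real k)" by (simp only:)
        then have "lnorm m (x - y) / rad (ann x) \<le> \<delta> * r powr (- real k)"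
          using rad[of "ann x"] by (simp only: lnorm_scaleR[OF m]) simp
        then have "lnorm m (x - y) \<le> (\<delta> * r powr (- real k)) * rad (ann x)"
          using rad[of "ann x"] by (simp add: divide_le_eq)
        then have "lnorm m (x - y) powr p \<le> ((\<delta> * r powr (- real k)) * rad (ann x)) powr p"
          using p by (intro powr_mono2) (auto simp: lnorm_nonneg)
        also have "\<dots> = d k * rad (ann x) powr p"
          using \<delta> rad[of "ann x"] by (simp add: d_def powr_mult)
        finally show ?thesis using d0[of k] unfolding cst_def G_def by (simp add: ennreal_leI flip: ennreal_mult)
      qed
      show "cst x y \<le> \<psi> (C 0 x) + \<psi> (C 0 y)" for x y
      proof -
        have "lnorm m (x - y) \<le> lnorm m x + lnorm m y"
          using lnorm_triangle[OF m, of x "- y"] by (simp add: lnorm_minus)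
        then have "lnorm m (x - y) powr p \<le> (lnorm m x + lnorm m y) powr p"
          using p by (intro powr_mono2) (auto simp: lnorm_nonneg)
        also have "\<dots> \<le> \<gamma> * (rad (ann x) powr p + rad (ann y) powr p)"
          unfolding \<gamma>_def using ann_lt[of x] ann_lt[of y] by (intro powr_sum_le p) (auto simp: lnorm_nonneg)
        finally show ?thesis using \<gamma> unfolding cst_def \<psi>_def C_def
          by (simp add: ennreal_leI distrib_left flip: ennreal_plus)
      qed
    qed
    then obtain \<xi> where \<xi>: "prob_space \<xi>" "sets \<xi> = sets borel" "distr \<xi> borel fst = emp \<omega>"
      "distr \<xi> borel snd = \<mu>" "(\<integral>\<^sup>+ (x, y). cst x y \<partial>\<xi>) \<le> ?R \<omega>" by (elim exE conjE)
    then have "\<xi> \<in> couplings (emp \<omega>) \<mu>" by (simp add: couplings_def)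
    then have "transport_cost p m (emp \<omega>) \<mu> \<le> (\<integral>\<^sup>+ (x, y). cst x y \<partial>\<xi>)"
      unfolding transport_cost_def cst_def by (rule INF_lower)
    then show ?thesis using \<xi>(5) by (rule order_trans)
  qed
  have split_cells: "(\<integral>\<^sup>+ z. f z \<partial>count_space UNIV) = (\<integral>\<^sup>+ i. \<integral>\<^sup>+ j. f (i, j) \<partial>count_space UNIV \<partial>count_space UNIV)"
    for f :: "nat \<times> nat \<Rightarrow> ennreal"
    by (rule nn_integral_fst_count_space[symmetric])
  define ldev where "ldev k i = min (mass i) (sqrt (A * r powr (real CARD('n) * real k) * mass i / real N) / 2)" for k i
  have ldev0: "0 \<le> ldev k i" for k i using A by (simp add: ldev_def mass_def)
  have dev: "(\<integral>\<^sup>+ \<omega>. emeasure (emp \<omega>) S - emeasure \<mu> S \<partial>M) \<le> ennreal (deviation N (measure \<mu> S))"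
     "(\<integral>\<^sup>+ \<omega>. emeasure \<mu> S - emeasure (emp \<omega>) S \<partial>M) \<le> ennreal (deviation N (measure \<mu> S))"
    if "S \<in> sets borel" for S
    using expected_deviation[OF that] by (simp_all add: deviation_def)
  have level: "(\<integral>\<^sup>+ \<omega>. excess (C k) (\<phi> k) (emp \<omega>) \<mu> \<partial>M)
      \<le> (\<integral>\<^sup>+ i. ennreal (rad i powr p * ldev k i) \<partial>count_space UNIV)" if k: "k \<in> {1..L}" for k
  proof -
    have kL: "k \<le> L" using k by simp
    have S_meas: "C k -` {z} \<in> sets borel" for z
      using measurable_sets[OF C_meas[OF kL], of "{z}"] by simp
    have "(\<integral>\<^sup>+ \<omega>. excess (C k) (\<phi> k) (emp \<omega>) \<mu> \<partial>M)
        \<le> (\<integral>\<^sup>+ z. \<phi> k z * ennreal (deviation N (measure \<mu> (C k -` {z}))) \<partial>count_space UNIV)"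
      unfolding expected_excess(1)[OF C_meas[OF kL]]
      by (intro nn_integral_mono mult_left_mono dev S_meas) auto
    also have "\<dots> = (\<integral>\<^sup>+ i. ennreal (rad i powr p) *
        (\<integral>\<^sup>+ j. ennreal (deviation N (measure \<mu> (C k -` {(i, j)}))) \<partial>count_space UNIV) \<partial>count_space UNIV)"
      unfolding split_cells \<phi>_def by (simp add: nn_integral_cmult)
    also have "\<dots> \<le> (\<integral>\<^sup>+ i. ennreal (rad i powr p) * ennreal (ldev k i) \<partial>count_space UNIV)"
      unfolding ldev_def mass_def
    proof (intro nn_integral_mono mult_left_mono law.sum_deviation_le)
      show "finite (c k ` lball m 0 1)"
        "real (card (c k ` lball m 0 1)) \<le> A * r powr (real CARD('n) * real k)"
        by (rule cl(4)[OF k], rule cl(5)[OF k])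
      show "C k -` {(i, j)} \<in> law.events" for i j using S_meas by simp
      show "disjoint_family (\<lambda>j. C k -` {(i, j)})" for i by (auto simp: disjoint_family_on_def)
      show "C k -` {(i, j)} \<subseteq> annulus m t a i" for i j by (auto simp: C_def ann_iff)
      show "annulus m t a i \<in> law.events" for i by simp
      show "C k -` {(i, j)} = {}" if "j \<notin> c k ` lball m 0 1" for i j using that sc by (auto simp: C_def)
    qed auto
    finally show ?thesis by (simp add: ennreal_mult ldev0)
  qed
  have coarse: "(\<integral>\<^sup>+ z. \<psi> z * F (C 0 -` {z}) \<partial>count_space UNIV)
      \<le> (\<integral>\<^sup>+ i. ennreal (rad i powr p * (\<gamma> * deviation N (dmass i))) \<partial>count_space UNIV)"
    if F: "\<And>i. F (annulus m t a i) \<le> ennreal (deviation N (dmass i))" "F {} = 0" for F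
  proof -
    have C0: "C 0 -` {(i, j)} = (if j = 0 then annulus m t a i else {})" for i j
      using cl(2)[OF sc] by (auto simp: C_def ann_iff)
    have "(\<integral>\<^sup>+ z. \<psi> z * F (C 0 -` {z}) \<partial>count_space UNIV) =
        (\<integral>\<^sup>+ i. \<integral>\<^sup>+ j. ennreal (\<gamma> * rad i powr p) * F (C 0 -` {(i, j)}) \<partial>count_space UNIV \<partial>count_space UNIV)"
      unfolding split_cells by (simp add: \<psi>_def)
    also have "\<dots> = (\<integral>\<^sup>+ i. ennreal (\<gamma> * rad i powr p) * F (annulus m t a i) \<partial>count_space UNIV)"
      by (intro nn_integral_cong, subst nn_integral_count_space'[of "{0}"]) (auto simp: C0 F(2))
    also have "\<dots> \<le> (\<integral>\<^sup>+ i. ennreal (\<gamma> * rad i powr p) * ennreal (deviation N (dmass i)) \<partial>count_space UNIV)"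
      by (intro nn_integral_mono mult_left_mono F(1)) auto
    also have "\<dots> = (\<integral>\<^sup>+ i. ennreal (rad i powr p * (\<gamma> * deviation N (dmass i))) \<partial>count_space UNIV)"
      using \<gamma> by (simp add: ennreal_mult[symmetric] dmass_def deviation_nonneg ac_simps)
    finally show ?thesis .
  qed
  (* The central ball and its complement deviate by the same amount, with opposite signs. *)
  have compl: "emeasure (emp \<omega>) (annulus m t a 0) - emeasure \<mu> (annulus m t a 0) =
      emeasure \<mu> (UNIV - annulus m t a 0) - emeasure (emp \<omega>) (UNIV - annulus m t a 0)"
    "emeasure \<mu> (annulus m t a 0) - emeasure (emp \<omega>) (annulus m t a 0) =
      emeasure (emp \<omega>) (UNIV - annulus m t a 0) - emeasure \<mu> (UNIV - annulus m t a 0)" for \<omega>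
  proof -
    interpret e: prob_space "emp \<omega>" by (rule prob_space_empirical_measure[OF N_pos])
    have sp: "space \<mu> = UNIV" using sets_eq_imp_space_eq[OF sets_law] by simp
    have "e.prob (UNIV - annulus m t a 0) = 1 - e.prob (annulus m t a 0)"
      using e.prob_compl[of "annulus m t a 0"] by simp
    moreover have "law.prob (UNIV - annulus m t a 0) = 1 - law.prob (annulus m t a 0)"
      using law.prob_compl[of "annulus m t a 0"] sp by simp
    ultimately show "emeasure (emp \<omega>) (annulus m t a 0) - emeasure \<mu> (annulus m t a 0) =
      emeasure \<mu> (UNIV - annulus m t a 0) - emeasure (emp \<omega>) (UNIV - annulus m t a 0)"
      "emeasure \<mu> (annulus m t a 0) - emeasure (emp \<omega>) (annulus m t a 0) =
      emeasure (emp \<omega>) (UNIV - annulus m t a 0) - emeasure \<mu> (UNIV - annulus m t a 0)"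
      by (simp_all add: e.emeasure_eq_measure law.emeasure_eq_measure ennreal_minus)
  qed
  have far1: "(\<integral>\<^sup>+ \<omega>. excess (C 0) \<psi> (emp \<omega>) \<mu> \<partial>M)
      \<le> (\<integral>\<^sup>+ i. ennreal (rad i powr p * (\<gamma> * deviation N (dmass i))) \<partial>count_space UNIV)"
    unfolding expected_excess(1)[OF C_meas[OF le0]]
  proof (rule coarse)
    show "(\<integral>\<^sup>+ \<omega>. emeasure (emp \<omega>) (annulus m t a i) - emeasure \<mu> (annulus m t a i) \<partial>M)
        \<le> ennreal (deviation N (dmass i))" for i
      unfolding dmass_def using dev[of "UNIV - annulus m t a 0"] dev[of "annulus m t a i"]
      by (cases "i = 0") (simp_all add: compl)
  qed simp
  have far2: "(\<integral>\<^sup>+ \<omega>. excess (C 0) \<psi> \<mu> (emp \<omega>) \<partial>M)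
      \<le> (\<integral>\<^sup>+ i. ennreal (rad i powr p * (\<gamma> * deviation N (dmass i))) \<partial>count_space UNIV)"
    unfolding expected_excess(2)[OF C_meas[OF le0]]
  proof (rule coarse)
    show "(\<integral>\<^sup>+ \<omega>. emeasure \<mu> (annulus m t a i) - emeasure (emp \<omega>) (annulus m t a i) \<partial>M)
        \<le> ennreal (deviation N (dmass i))" for i
      unfolding dmass_def using dev[of "UNIV - annulus m t a 0"] dev[of "annulus m t a i"]
      by (cases "i = 0") (simp_all add: compl)
  qed simp
  have G_meas [measurable]: "G \<in> borel_measurable borel" unfolding G_def by measurable
  have G_int: "(\<integral>\<^sup>+ x. G x \<partial>\<mu>) = (\<integral>\<^sup>+ i. ennreal (rad i powr p * mass i) \<partial>count_space UNIV)"
  proof -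
    have "(\<integral>\<^sup>+ x. G x \<partial>\<mu>) = (\<integral>\<^sup>+ x. (\<lambda>i. ennreal (rad i powr p)) (ann x) * 1 \<partial>\<mu>)" by (simp add: G_def)
    also have "\<dots> = (\<integral>\<^sup>+ i. ennreal (rad i powr p) * (\<integral>\<^sup>+ x. 1 * indicator (ann -` {i}) x \<partial>\<mu>) \<partial>count_space UNIV)"
      by (rule nn_integral_by_cells) measurable
    also have "\<dots> = (\<integral>\<^sup>+ i. ennreal (rad i powr p * mass i) \<partial>count_space UNIV)"
    proof (intro nn_integral_cong)
      fix i
      have "ann -` {i} = annulus m t a i" by (simp add: set_eq_iff ann_iff)
      then show "ennreal (rad i powr p) * (\<integral>\<^sup>+ x. 1 * indicator (ann -` {i}) x \<partial>\<mu>) = ennreal (rad i powr p * mass i)"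
        by (simp add: mass_def law.emeasure_eq_measure ennreal_mult)
    qed
    finally show ?thesis .
  qed
  have emp_G_meas [measurable]: "(\<lambda>\<omega>. \<integral>\<^sup>+ x. G x \<partial>emp \<omega>) \<in> borel_measurable M"
    by (rule nn_integral_emp_measurable) measurable
  have ex_meas [measurable]: "(\<lambda>\<omega>. excess (C (Suc j)) (\<phi> (Suc j)) (emp \<omega>) \<mu>) \<in> borel_measurable M"
    if "j \<in> {..<L}" for j
    using that by (intro expected_excess C_meas) auto
  have ex_meas0 [measurable]: "(\<lambda>\<omega>. excess (C 0) \<psi> (emp \<omega>) \<mu>) \<in> borel_measurable M"
    "(\<lambda>\<omega>. excess (C 0) \<psi> \<mu> (emp \<omega>)) \<in> borel_measurable M"
    by (intro expected_excess C_meas le0)+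
  have "expected_cost p m \<le> (\<integral>\<^sup>+ \<omega>. ?R \<omega> \<partial>M)"
    by (intro nn_integral_mono cost)
  also have "\<dots> = ennreal (d L) * (\<integral>\<^sup>+ \<omega>. (\<integral>\<^sup>+ x. G x \<partial>emp \<omega>) \<partial>M)
      + (\<Sum>j<L. ennreal (d j - d (Suc j)) * (\<integral>\<^sup>+ \<omega>. excess (C (Suc j)) (\<phi> (Suc j)) (emp \<omega>) \<mu> \<partial>M))
      + (\<integral>\<^sup>+ \<omega>. excess (C 0) \<psi> (emp \<omega>) \<mu> \<partial>M) + (\<integral>\<^sup>+ \<omega>. excess (C 0) \<psi> \<mu> (emp \<omega>) \<partial>M)"
  proof -
    have 1: "(\<lambda>\<omega>. \<Sum>j<L. ennreal (d j - d (Suc j)) * excess (C (Suc j)) (\<phi> (Suc j)) (emp \<omega>) \<mu>) \<in> borel_measurable M"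
      using ex_meas by measurable
    have 2: "(\<lambda>\<omega>. ennreal (d L) * (\<integral>\<^sup>+ x. G x \<partial>emp \<omega>)) \<in> borel_measurable M"
      using emp_G_meas by measurable
    have 3: "(\<integral>\<^sup>+ \<omega>. (\<Sum>j<L. ennreal (d j - d (Suc j)) * excess (C (Suc j)) (\<phi> (Suc j)) (emp \<omega>) \<mu>) \<partial>M)
        = (\<Sum>j<L. ennreal (d j - d (Suc j)) * (\<integral>\<^sup>+ \<omega>. excess (C (Suc j)) (\<phi> (Suc j)) (emp \<omega>) \<mu> \<partial>M))"
      using ex_meas by (simp add: nn_integral_sum nn_integral_cmult)
    show ?thesis
      using 1 2 ex_meas0 by (simp add: nn_integral_add 3 nn_integral_cmult[OF emp_G_meas])
  qed
  also have "\<dots> \<le> ennreal (d L) * (\<integral>\<^sup>+ i. ennreal (rad i powr p * mass i) \<partial>count_space UNIV)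
      + (\<Sum>j<L. ennreal (d j - d (Suc j)) * (\<integral>\<^sup>+ i. ennreal (rad i powr p * ldev (Suc j) i) \<partial>count_space UNIV))
      + (\<integral>\<^sup>+ i. ennreal (rad i powr p * (\<gamma> * deviation N (dmass i))) \<partial>count_space UNIV)
      + (\<integral>\<^sup>+ i. ennreal (rad i powr p * (\<gamma> * deviation N (dmass i))) \<partial>count_space UNIV)"
    using nn_integral_emp[OF G_meas] unfolding G_int
    by (intro add_mono sum_mono mult_left_mono level far1 far2) auto
  also have "\<dots> = (\<integral>\<^sup>+ i. ennreal (d L) * ennreal (rad i powr p * mass i)
      + (\<Sum>j<L. ennreal (d j - d (Suc j)) * ennreal (rad i powr p * ldev (Suc j) i))
      + ennreal (rad i powr p * (\<gamma> * deviation N (dmass i)))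
      + ennreal (rad i powr p * (\<gamma> * deviation N (dmass i))) \<partial>count_space UNIV)"
    by (simp add: nn_integral_add nn_integral_sum nn_integral_cmult)
  also have "\<dots> = (\<integral>\<^sup>+ i. ennreal (rad i powr p * ((\<Sum>k<L. (d k - d (Suc k)) * ldev (Suc k) i) + d L * mass i
        + \<gamma> * (2 * deviation N (dmass i)))) \<partial>count_space UNIV)"
  proof (intro nn_integral_cong)
    fix i
    have nn: "0 \<le> d j - d (Suc j)" "0 \<le> ldev (Suc j) i" "0 \<le> mass i" "0 \<le> deviation N (dmass i)" for j
      using dS[of j] ldev0[of "Suc j" i] by (auto simp: mass_def dmass_def deviation_nonneg)
    have "(\<Sum>j<L. ennreal (d j - d (Suc j)) * ennreal (rad i powr p * ldev (Suc j) i))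
        = ennreal (\<Sum>j<L. (d j - d (Suc j)) * (rad i powr p * ldev (Suc j) i))"
      using nn by (subst sum_ennreal[symmetric]) (auto simp: ennreal_mult)
    moreover have "0 \<le> (\<Sum>j<L. (d j - d (Suc j)) * (rad i powr p * ldev (Suc j) i))"
      using nn by (intro sum_nonneg) auto
    moreover have "rad i powr p * ((\<Sum>k<L. (d k - d (Suc k)) * ldev (Suc k) i) + d L * mass i + \<gamma> * (2 * deviation N (dmass i)))
       = d L * (rad i powr p * mass i) + (\<Sum>j<L. (d j - d (Suc j)) * (rad i powr p * ldev (Suc j) i))
        + rad i powr p * (\<gamma> * deviation N (dmass i)) + rad i powr p * (\<gamma> * deviation N (dmass i))"
      by (simp add: distrib_left sum_distrib_left algebra_simps)
    ultimately show "ennreal (d L) * ennreal (rad i powr p * mass i)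
      + (\<Sum>j<L. ennreal (d j - d (Suc j)) * ennreal (rad i powr p * ldev (Suc j) i))
      + ennreal (rad i powr p * (\<gamma> * deviation N (dmass i)))
      + ennreal (rad i powr p * (\<gamma> * deviation N (dmass i))) =
      ennreal (rad i powr p * ((\<Sum>k<L. (d k - d (Suc k)) * ldev (Suc k) i) + d L * mass i
        + \<gamma> * (2 * deviation N (dmass i))))"
      using nn d0[of L] \<gamma> by (simp add: ennreal_plus[symmetric] ennreal_mult[symmetric] del: ennreal_plus)
  qed
  finally show ?thesis unfolding rad_def ldev_def \<gamma>_def annulus_cost_def d_def by simp
qed

end

section \<open>From a moment to the cost bound\<close>

context iid_sample
begin

text \<open>Markov's inequality.\<close>

lemma moment_tail_bound:
  assumes S [measurable]: "S \<in> sets borel" and far: "\<And>x. x \<in> S \<Longrightarrow> \<rho> \<le> lnorm m x"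
    and \<rho>: "\<rho> > 0" and q: "q > 0" and mom: "moment q m \<mu> = ennreal Mq" and Mq: "0 \<le> Mq"
  shows "measure \<mu> S \<le> Mq * \<rho> powr (- q)"
proof -
  have "ennreal (\<rho> powr q * measure \<mu> S) = (\<integral>\<^sup>+ x. ennreal (\<rho> powr q) * indicator S x \<partial>\<mu>)"
    by (subst nn_integral_cmult_indicator) (simp_all add: law.emeasure_eq_measure ennreal_mult)
  also have "\<dots> \<le> (\<integral>\<^sup>+ x. ennreal (lnorm m x powr q) \<partial>\<mu>)"
  proof (intro nn_integral_mono)
    fix x
    show "ennreal (\<rho> powr q) * indicator S x \<le> ennreal (lnorm m x powr q)"
      using far[of x] \<rho> q by (auto simp: indicator_def intro!: ennreal_leI powr_mono2)
  qed
  also have "\<dots> = ennreal Mq" using mom by (simp add: moment_def)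
  finally have "\<rho> powr q * measure \<mu> S \<le> Mq" using Mq by (simp add: ennreal_le_iff)
  then show ?thesis using \<rho> by (simp add: powr_minus field_simps)
qed

text \<open>The hypotheses \<open>level\<close> and \<open>dev\<close> say that, whatever the regime, an annulus of mass \<open>x\<close> contributes a multiple
  of \<open>x\<^sup>p\<^sup>/\<^sup>s\<close>. By Markov's inequality these contributions decrease geometrically, with ratio \<open>a\<^sup>p\<^sup>-\<^sup>q\<^sup>p\<^sup>/\<^sup>s\<close>; the
  choice \<open>s/q\<close> for this ratio minimizes \<open>a\<^sup>p / (1 - a\<^sup>p\<^sup>-\<^sup>q\<^sup>p\<^sup>/\<^sup>s)\<close>. The depth \<open>L\<close> of the partitions only leaves
  an error proportional to \<open>d L\<close>, which vanishes in the limit.\<close>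

lemma cost_bound_at_scale:
  fixes m :: ereal and p r A \<delta> s q \<kappa> b t Mq :: real
  assumes m: "m \<ge> 1" and p: "p > 0" and r: "r > 1" and A: "A \<ge> 0" and \<delta>: "\<delta> \<ge> 0"
    and cells: "\<And>L. \<exists>c :: nat \<Rightarrow> real ^ 'n \<Rightarrow> nat. nested_cells m r A \<delta> L c"
    and s: "p \<le> s" "s < q" and \<kappa>: "\<kappa> > 0" and b: "b \<ge> 0"
    and level: "\<And>L x. 0 \<le> x \<Longrightarrow> x \<le> 1 \<Longrightarrow>
      annulus_cost N (real CARD('n)) p \<delta> r A L x \<le> 2 powr p * \<kappa> * x powr (p / s)"
    and dev: "\<And>x. 0 \<le> x \<Longrightarrow> x \<le> 1 \<Longrightarrow> 2 * deviation N x \<le> b * x powr (p / s)"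
    and mom: "moment q m \<mu> = ennreal Mq" "0 \<le> Mq" and t: "t > 0"
  defines "x \<equiv> b * eps_p p / \<kappa>"
  shows "expected_cost p m \<le>
     ennreal (2 powr p * \<kappa> * (t powr p * (1 + Mq powr (p / s) * t powr (- q * (p / s)) *
       (x + (1 + x) * ((q / s) powr (q / (q - s)) * (s / (q - s)))))))"
proof -
  have s0: "s > 0" and q0: "q > 0" using s p by auto
  define e where "e = p / s"
  have e: "0 < e" "e \<le> 1" using s p s0 by (auto simp: e_def)
  define z where "z = q / s"
  have z: "z > 1" using s s0 by (simp add: z_def)
  have ex: "q * e - p = p * (q - s) / s" using s0 by (simp add: e_def field_simps)
  then have ex0: "q * e - p > 0" using s s0 p by simp
  (* With this a, the contributions of consecutive annuli have ratio 1 / z = s / q. *)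
  define a where "a = z powr (1 / (q * e - p))"
  have a: "a > 1" unfolding a_def using z ex0 by simp
  have a_z: "a powr (q * e - p) = z" unfolding a_def using z ex0 by (simp add: powr_powr)
  have a_inv: "a powr (p - q * e) = 1 / z"
    by (metis a_z minus_diff_eq powr_minus_divide)
  define Q where "Q = (q / s) powr (q / (q - s)) * (s / (q - s))"
  have Q: "a powr p / (1 - 1 / z) = Q"
  proof -
    have "q * e / (q * e - p) = q / (q - s)" unfolding ex using s s0 p by (simp add: e_def field_simps)
    then have "a powr (q * e) = z powr (q / (q - s))" unfolding a_def by (simp add: powr_powr)
    moreover have "a powr (q * e) = a powr p * z"
      unfolding a_z[symmetric] by (simp flip: powr_add)
    ultimately have "a powr p * z = z powr (q / (q - s))" by simp
    moreover have "a powr p / (1 - 1 / z) = a powr p * z / (z - 1)" using z by (simp add: field_simps)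
    moreover have "z - 1 = (q - s) / s" using s0 by (simp add: z_def field_simps)
    ultimately show ?thesis by (simp add: Q_def z_def)
  qed
  (* W bounds the e-th power of the mass outside the central ball. *)
  define W where "W = Mq powr e * t powr (- q * e)"
  have W: "W \<ge> 0" by (simp add: W_def)
  define d where "d k = (\<delta> * r powr (- real k)) powr p" for k
  define Kp where "Kp = 2 powr p * \<kappa>"
  define E where "E = 2 powr p * eps_p p * b"
  have E: "E \<ge> 0" using b by (simp add: E_def eps_p_def)
  have Kp: "Kp > 0" using \<kappa> by (simp add: Kp_def)
  have d0: "0 \<le> d k" for k by (simp add: d_def)
  define mass where "mass i = measure \<mu> (annulus m t a i)" for i
  define dmass where "dmass i = measure \<mu> (if i = 0 then UNIV - annulus m t a 0 else annulus m t a i)" for i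
  have mass: "0 \<le> mass i" "mass i \<le> 1" "0 \<le> dmass i" "dmass i \<le> 1" for i
    by (auto simp: mass_def dmass_def)
  have tail: "mass (Suc i) \<le> Mq * (t * a ^ i) powr (- q)" for i
    unfolding mass_def using t a
    by (intro moment_tail_bound[OF _ _ _ q0 mom]) (auto simp: annulus_def)
  have tail0: "dmass 0 \<le> Mq * t powr (- q)"
    unfolding dmass_def using t a
    by (intro moment_tail_bound[OF _ _ _ q0 mom]) (auto simp: annulus_def)
  have powr_tail: "(Mq * \<rho> powr (- q)) powr e = Mq powr e * \<rho> powr (- q * e)" if "\<rho> > 0" for \<rho>
    using mom(2) that by (simp add: powr_mult powr_powr)
  have mass_Suc: "(t * a ^ Suc i) powr p * mass (Suc i) powr e \<le> t powr p * a powr p * W * (1 / z) ^ i" for i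
  proof -
    have ai: "a ^ i = a powr real i" using a by (simp add: powr_realpow)
    have "mass (Suc i) powr e \<le> Mq powr e * (t * a ^ i) powr (- q * e)"
      using tail[of i] mass e t a powr_tail[of "t * a ^ i"] by (metis less_imp_le mult_pos_pos order_less_trans powr_mono2 zero_less_one zero_less_power)
    then have "t powr p * a powr p * (a ^ i) powr p * mass (Suc i) powr e
        \<le> t powr p * a powr p * (a ^ i) powr p * (Mq powr e * (t * a ^ i) powr (- q * e))"
      by (rule mult_left_mono) simp
    also have "(t * a ^ i) powr (- q * e) = t powr (- q * e) * (a ^ i) powr (- q * e)"
      using t a by (simp add: powr_mult)
    also have "t powr p * a powr p * (a ^ i) powr p * (Mq powr e * (t powr (- q * e) * (a ^ i) powr (- q * e)))
       = t powr p * a powr p * W * ((a ^ i) powr p * (a ^ i) powr (- q * e))"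
      by (simp add: W_def)
    also have "(a ^ i) powr p * (a ^ i) powr (- q * e) = (a powr (p - q * e)) powr real i"
      unfolding ai by (simp add: powr_powr algebra_simps flip: powr_add)
    also have "\<dots> = (1 / z) ^ i" unfolding a_inv using z by (simp add: powr_realpow)
    finally have "t powr p * a powr p * (a ^ i) powr p * mass (Suc i) powr e \<le> t powr p * a powr p * W * (1 / z) ^ i" .
    moreover have "(t * a ^ Suc i) powr p = t powr p * a powr p * (a ^ i) powr p"
      using t a by (simp add: powr_mult)
    ultimately show ?thesis by (simp only:)
  qed
  have dmass0: "dmass 0 powr e \<le> W"
    using powr_mono2[OF _ _ tail0, of e] mass e powr_tail[OF t] by (simp add: W_def)
  have bound: "expected_cost p m \<le>
      ennreal (t powr p * (Kp + d L + W * (E + (Kp + d L + E) * Q)))" for L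
  proof -
    obtain c :: "nat \<Rightarrow> real ^ 'n \<Rightarrow> nat" where c: "nested_cells m r A \<delta> L c" using cells by blast
    (* Upper bounds for the contributions of the central ball and of the annulus with inner radius t * a ^ n. *)
    define g where "g i = (case i of 0 \<Rightarrow> t powr p * (Kp + d L + E * W)
        | Suc n \<Rightarrow> t powr p * a powr p * W * (Kp + d L + E) * (1 / z) ^ n)" for i
    have g0: "0 \<le> g i" for i
      using W E Kp d0[of L] z by (simp add: g_def split: nat.split)
    have le_g: "(t * a ^ i) powr p * (annulus_cost N (real CARD('n)) p \<delta> r A L (mass i)
         + d L * mass i + 2 powr p * eps_p p * (2 * deviation N (dmass i))) \<le> g i" for i
    proof -
      have 1: "annulus_cost N (real CARD('n)) p \<delta> r A L (mass i) \<le> Kp * mass i powr e"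
        unfolding Kp_def e_def by (rule level[OF mass(1,2)])
      have "mass i \<le> mass i powr e" using powr_mono'[of e 1 "mass i"] mass e by simp
      then have 2: "d L * mass i \<le> d L * mass i powr e" using d0 by (rule mult_left_mono)
      have "2 * deviation N (dmass i) \<le> b * dmass i powr e" unfolding e_def by (rule dev[OF mass(3,4)])
      then have 3: "2 powr p * eps_p p * (2 * deviation N (dmass i)) \<le> E * dmass i powr e"
        unfolding E_def mult.assoc by (intro mult_left_mono) (auto simp: eps_p_def)
      have "(t * a ^ i) powr p * (annulus_cost N (real CARD('n)) p \<delta> r A L (mass i)
         + d L * mass i + 2 powr p * eps_p p * (2 * deviation N (dmass i)))
        \<le> (t * a ^ i) powr p * (Kp * mass i powr e + d L * mass i powr e + E * dmass i powr e)"
        by (rule mult_left_mono[OF add_mono[OF add_mono[OF 1 2] 3]]) simp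
      also have "\<dots> \<le> g i"
      proof (cases i)
        case 0
        have "mass 0 powr e \<le> 1" using mass e by (simp add: powr_le1)
        then have "Kp * mass 0 powr e + d L * mass 0 powr e + E * dmass 0 powr e \<le> Kp * 1 + d L * 1 + E * W"
          using Kp d0[of L] E dmass0 by (intro add_mono mult_left_mono) auto
        then show ?thesis using 0 t by (simp add: g_def mult_left_mono)
      next
        case (Suc n)
        have "dmass i = mass i" using Suc by (simp add: mass_def dmass_def)
        then have "(t * a ^ i) powr p * (Kp * mass i powr e + d L * mass i powr e + E * dmass i powr e)
            = (Kp + d L + E) * ((t * a ^ Suc n) powr p * mass (Suc n) powr e)"
          using Suc by (simp add: algebra_simps)
        also have "\<dots> \<le> (Kp + d L + E) * (t powr p * a powr p * W * (1 / z) ^ n)"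
          using Kp d0[of L] E by (intro mult_left_mono mass_Suc) auto
        finally show ?thesis using Suc by (simp add: g_def ac_simps)
      qed
      finally show ?thesis .
    qed
    have "expected_cost p m \<le> (\<integral>\<^sup>+ i. ennreal ((t * a ^ i) powr p * (annulus_cost N (real CARD('n)) p \<delta> r A L (mass i)
         + d L * mass i + 2 powr p * eps_p p * (2 * deviation N (dmass i)))) \<partial>count_space UNIV)"
      unfolding d_def mass_def dmass_def
      by (rule expected_cost_by_annuli[OF m p t a r A \<delta> c])
    also have "\<dots> \<le> (\<integral>\<^sup>+ i. ennreal (g i) \<partial>count_space UNIV)"
      by (intro nn_integral_mono ennreal_leI le_g)
    also have "\<dots> = (\<Sum>i. ennreal (g i))" by (rule nn_integral_count_space_nat)
    also have "\<dots> = ennreal (t powr p * (Kp + d L + W * (E + (Kp + d L + E) * Q)))"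
    proof -
      have "(\<lambda>n. (1 / z) ^ n) sums (1 / (1 - 1 / z))" using z by (intro geometric_sums) simp
      then have "(\<lambda>n. t powr p * a powr p * W * (Kp + d L + E) * (1 / z) ^ n) sums
          (t powr p * a powr p * W * (Kp + d L + E) * (1 / (1 - 1 / z)))" by (rule sums_mult)
      then have "(\<lambda>n. g (Suc n)) sums (t powr p * W * (Kp + d L + E) * (a powr p / (1 - 1 / z)))"
        by (simp add: g_def ac_simps)
      then have "g sums (t powr p * W * (Kp + d L + E) * Q + g 0)" unfolding Q by (rule sums_Suc)
      moreover have "t powr p * W * (Kp + d L + E) * Q + g 0 = t powr p * (Kp + d L + W * (E + (Kp + d L + E) * Q))"
        by (simp add: g_def algebra_simps)
      ultimately have sg: "summable g" "suminf g = t powr p * (Kp + d L + W * (E + (Kp + d L + E) * Q))"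
        by (simp_all add: sums_iff)
      show ?thesis unfolding suminf_ennreal2[OF g0 sg(1)] sg(2) ..
    qed
    finally show ?thesis .
  qed
  have "d \<longlonglongrightarrow> 0"
  proof -
    have "d = (\<lambda>k. \<delta> powr p * (r powr (- p)) ^ k)"
    proof
      fix k
      have "(r powr (- real k)) powr p = (r powr (- p)) powr real k" by (simp add: powr_powr mult.commute)
      also have "\<dots> = (r powr (- p)) ^ k" using r by (simp add: powr_realpow)
      finally show "d k = \<delta> powr p * (r powr (- p)) ^ k" using \<delta> by (simp add: d_def powr_mult)
    qed
    moreover have "(\<lambda>k. \<delta> powr p * (r powr (- p)) ^ k) \<longlonglongrightarrow> \<delta> powr p * 0"
      using r p powr_less_one[of r "- p"] by (intro tendsto_mult_left LIMSEQ_power_zero) simp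
    ultimately show ?thesis by simp
  qed
  then have "(\<lambda>L. ennreal (t powr p * (Kp + d L + W * (E + (Kp + d L + E) * Q))))
      \<longlonglongrightarrow> ennreal (t powr p * (Kp + 0 + W * (E + (Kp + 0 + E) * Q)))"
    by (intro tendsto_intros)
  then have "expected_cost p m \<le> ennreal (t powr p * (Kp + 0 + W * (E + (Kp + 0 + E) * Q)))"
    by (rule LIMSEQ_le_const) (use bound in auto)
  also have "t powr p * (Kp + 0 + W * (E + (Kp + 0 + E) * Q)) = Kp * (t powr p * (1 + W * (x + (1 + x) * Q)))"
  proof -
    have "E = Kp * x" using \<kappa> by (simp add: E_def Kp_def x_def)
    then show ?thesis by (simp add: algebra_simps)
  qed
  finally show ?thesis unfolding Kp_def W_def e_def Q_def .
qed

text \<open>The bound at scale \<open>t\<close> has the form \<open>t\<^sup>p (1 + M\<^sup>e t\<^sup>-\<^sup>q\<^sup>e Y)\<close> with \<open>e = p/s\<close>; its minimizer satisfies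
  \<open>t\<^sup>q\<^sup>e = Y M\<^sup>e (q - s)/s\<close>, and the minimum is the expression \<open>H\<close>. If the moment vanishes, \<open>t\<close> tends to \<open>0\<close>
  instead.\<close>

lemma cost_bound_from_moment:
  fixes m :: ereal and p r A \<delta> s q \<kappa> b :: real
  assumes m: "m \<ge> 1" and p: "p > 0" and r: "r > 1" and A: "A \<ge> 0" and \<delta>: "\<delta> \<ge> 0"
    and cells: "\<And>L. \<exists>c :: nat \<Rightarrow> real ^ 'n \<Rightarrow> nat. nested_cells m r A \<delta> L c"
    and s: "p \<le> s" "s < q" and \<kappa>: "\<kappa> > 0" and b: "b \<ge> 0"
    and level: "\<And>L x. 0 \<le> x \<Longrightarrow> x \<le> 1 \<Longrightarrow>
      annulus_cost N (real CARD('n)) p \<delta> r A L x \<le> 2 powr p * \<kappa> * x powr (p / s)"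
    and dev: "\<And>x. 0 \<le> x \<Longrightarrow> x \<le> 1 \<Longrightarrow> 2 * deviation N x \<le> b * x powr (p / s)"
  shows "expected_cost p m \<le>
     ennreal (2 powr p * \<kappa>) * ennpowr (moment q m \<mu>) (p / q) * ennreal (H (b * eps_p p / \<kappa>) s q)"
proof -
  have s0: "s > 0" and q0: "q > 0" using s p by auto
  define x where "x = b * eps_p p / \<kappa>"
  have x: "x \<ge> 0" using b \<kappa> by (simp add: x_def eps_p_def)
  define B where "B = (q / s) powr (q / (q - s))"
  have B: "B > 0" using s s0 by (simp add: B_def)
  define Z where "Z = x * ((q - s) / s) + (1 + x) * B"
  have Z: "Z > 0"
  proof -
    have "0 \<le> x * ((q - s) / s)" using x s s0 by simp
    moreover have "0 < (1 + x) * B" using x B by simp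
    ultimately show ?thesis unfolding Z_def by linarith
  qed
  have H_eq: "H x s q = Z powr (s / q) * (q / (q - s))" by (simp add: H_def Z_def B_def)
  have Hpos: "H x s q > 0" unfolding H_eq using Z s q0 by simp
  show ?thesis
  proof (cases "moment q m \<mu> = \<infinity>")
    case True
    have "ennreal (2 powr p * \<kappa>) * ennpowr (moment q m \<mu>) (p / q) * ennreal (H x s q) = \<infinity>"
      using True Hpos \<kappa> by (simp add: ennpowr_def ennreal_mult_top ennreal_top_mult)
    then show ?thesis by (simp add: x_def)
  next
    case False
    then obtain Mq where mom: "moment q m \<mu> = ennreal Mq" "0 \<le> Mq" by (cases "moment q m \<mu>") auto
    have scale: "expected_cost p m \<le>
      ennreal (2 powr p * \<kappa> * (t powr p * (1 + Mq powr (p / s) * t powr (- q * (p / s)) *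
       (x + (1 + x) * ((q / s) powr (q / (q - s)) * (s / (q - s)))))))" if "t > 0" for t
      unfolding x_def
    proof (rule cost_bound_at_scale[OF m p r A \<delta> cells s \<kappa> b _ _ mom that])
    qed (fact level dev)+
    show ?thesis
    proof (cases "Mq = 0")
      case True
      have le: "expected_cost p m \<le> ennreal (2 powr p * \<kappa> * t powr p)" if "t > 0" for t
        using scale[OF that] True p s0 by simp
      have "(\<lambda>n. ennreal (2 powr p * \<kappa> * (1 / real (Suc n)) powr p)) \<longlonglongrightarrow> ennreal (2 powr p * \<kappa> * 0)"
      proof (intro tendsto_ennrealI tendsto_mult_left)
        have "(\<lambda>n. 1 / real (Suc n)) \<longlonglongrightarrow> 0" by (rule LIMSEQ_Suc[OF lim_1_over_n])
        then show "(\<lambda>n. (1 / real (Suc n)) powr p) \<longlonglongrightarrow> 0"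
          using tendsto_powr'[of "\<lambda>n. 1 / real (Suc n)" 0 sequentially "\<lambda>_. p" p] p by simp
      qed
      then have "expected_cost p m \<le> ennreal (2 powr p * \<kappa> * 0)"
        by (rule LIMSEQ_le_const) (intro exI[of _ 0] allI impI le, simp)
      then show ?thesis by simp
    next
      case False
      then have Mq: "Mq > 0" using mom by simp
      define e where "e = p / s"
      have e: "e > 0" using p s0 by (simp add: e_def)
      have qe: "q * e > 0" using q0 e by simp
      define t where "t = (Z * Mq powr e) powr (1 / (q * e))"
      have t: "t > 0" using Z Mq by (simp add: t_def)
      have t1: "t powr (- q * e) = 1 / (Z * Mq powr e)"
      proof -
        have "t powr (q * e) = Z * Mq powr e" unfolding t_def using q0 e Z Mq by (simp add: powr_powr)
        then show ?thesis using powr_minus_divide[of t "q * e"] by (simp only: mult_minus_left)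
      qed
      have t2: "t powr p = Z powr (s / q) * Mq powr (p / q)"
      proof -
        have "1 / (q * e) * p = s / q" using p s0 q0 by (simp add: e_def)
        then have "t powr p = (Z * Mq powr e) powr (s / q)" unfolding t_def powr_powr by simp
        also have "\<dots> = Z powr (s / q) * Mq powr (e * (s / q))" using Z by (simp add: powr_mult powr_powr)
        also have "e * (s / q) = p / q" using s0 by (simp add: e_def)
        finally show ?thesis .
      qed
      have Y: "x + (1 + x) * (B * (s / (q - s))) = Z * (s / (q - s))"
      proof -
        have "x * ((q - s) / s) * (s / (q - s)) = x" using s s0 by simp
        then show ?thesis by (simp only: Z_def distrib_right[of _ _ "s / (q - s)"] mult.assoc)
      qed
      have "1 + Mq powr e * t powr (- q * e) * (x + (1 + x) * (B * (s / (q - s)))) = 1 + s / (q - s)"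
        unfolding t1 Y using Z Mq by simp
      also have "\<dots> = q / (q - s)" using s by (simp add: field_simps)
      finally have "2 powr p * \<kappa> * (t powr p * (1 + Mq powr e * t powr (- q * e) * (x + (1 + x) * (B * (s / (q - s))))))
          = 2 powr p * \<kappa> * Mq powr (p / q) * H x s q"
        unfolding t2 H_eq by simp
      then have "expected_cost p m \<le> ennreal (2 powr p * \<kappa> * Mq powr (p / q) * H x s q)"
        using scale[OF t] unfolding e_def B_def by (simp only:)
      also have "\<dots> = ennreal (2 powr p * \<kappa>) * ennpowr (moment q m \<mu>) (p / q) * ennreal (H x s q)"
        using \<kappa> Hpos mom by (simp add: ennpowr_def ennreal_mult)
      finally show ?thesis by (simp add: x_def)
    qed
  qed
qed

end

section \<open>Contribution of one annulus in the three regimes\<close>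

text \<open>Reduction to \<open>level_sum\<close>: the mass \<open>x\<close> of the annulus is pulled out of the minimum.\<close>

lemma level_cost_eq:
  fixes p r \<delta> A x D :: real
  assumes p: "p > 0" and r: "r > 1" and \<delta>: "\<delta> \<ge> 0" and A: "A > 0" and N: "N \<ge> 1" and x: "x > 0"
  shows "annulus_cost N D p \<delta> r A L x
     = \<delta> powr p * x * level_sum (r powr (- p)) (r powr (D / 2)) (sqrt (A / (real N * x)) * r powr (D / 2) / 2) L"
proof -
  define c where "c = sqrt (A / (real N * x)) * r powr (D / 2) / 2"
  have dk: "(\<delta> * r powr (- real k)) powr p = \<delta> powr p * (r powr (- p)) ^ k" for k
  proof -
    have "(r powr (- real k)) powr p = (r powr (- p)) powr real k" by (simp add: powr_powr mult.commute)
    also have "\<dots> = (r powr (- p)) ^ k" using r by (simp add: powr_realpow)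
    finally show ?thesis using \<delta> by (simp add: powr_mult)
  qed
  have mk: "min x (sqrt (A * r powr (D * real (Suc k)) * x / real N) / 2) = x * min 1 (c * (r powr (D / 2)) ^ k)" for k
  proof -
    define w where "w = (r powr (D / 2)) ^ Suc k"
    have w: "w > 0" using r by (simp add: w_def)
    have "r powr (D * real (Suc k)) = w\<^sup>2"
    proof -
      have "w\<^sup>2 = (r powr (D / 2)) ^ (2 * Suc k)" unfolding w_def by (simp only: power_mult[symmetric] mult.commute)
      also have "\<dots> = (r powr (D / 2)) powr real (2 * Suc k)" using r by (intro powr_realpow[symmetric]) simp
      also have "\<dots> = r powr (D * real (Suc k))"
      proof -
        have "D / 2 * real (2 * Suc k) = D * real (Suc k)" by simp
        then show ?thesis by (simp only: powr_powr)
      qed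
      finally show ?thesis by simp
    qed
    then have "A * r powr (D * real (Suc k)) * x / real N = (A / (real N * x)) * (x * w)\<^sup>2"
      using x N by (simp only:) (simp add: field_simps power2_eq_square)
    then have "sqrt (A * r powr (D * real (Suc k)) * x / real N) = sqrt (A / (real N * x)) * \<bar>x * w\<bar>"
      by (simp only: real_sqrt_mult real_sqrt_abs)
    then have "sqrt (A * r powr (D * real (Suc k)) * x / real N) = sqrt (A / (real N * x)) * (x * w)"
      using x w by simp
    then have "sqrt (A * r powr (D * real (Suc k)) * x / real N) / 2 = x * (c * (r powr (D / 2)) ^ k)"
      by (simp add: c_def w_def)
    moreover have "min x (x * w) = x * min 1 w" for w using x by (simp add: min_mult_distrib_left)
    ultimately show ?thesis by simp
  qed
  have "annulus_cost N D p \<delta> r A L x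
     = (\<Sum>k<L. \<delta> powr p * x * (((r powr (- p)) ^ k - (r powr (- p)) ^ Suc k) * min 1 (c * (r powr (D / 2)) ^ k)))"
    unfolding annulus_cost_def dk mk by (intro sum.cong refl) (simp add: right_diff_distrib left_diff_distrib ac_simps)
  then show ?thesis unfolding level_sum_def c_def[symmetric] by (simp add: sum_distrib_left)
qed

lemma mult_sqrt_divide:
  fixes x a n :: real
  assumes "x > 0"
  shows "x * sqrt (a / (n * x)) = sqrt a * sqrt x / sqrt n"
proof -
  have "x * sqrt (a / (n * x)) = sqrt a / sqrt n * (x / sqrt x)"
    by (simp add: real_sqrt_divide real_sqrt_mult)
  also have "x / sqrt x = sqrt x" using assms by (intro real_div_sqrt) simp
  finally show ?thesis by simp
qed

lemma level_cost_supercritical: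
  fixes p r \<delta> A x D \<kappa> :: real
  assumes p: "p > D / 2" "D > 0" and r: "r > 1" and \<delta>: "\<delta> \<ge> 0" and A: "A > 0" and N: "N \<ge> 1" and x: "0 \<le> x"
    and \<kappa>: "\<delta> powr p * (sqrt A * r powr (D / 2) / 2) / (1 - r powr (D / 2 - p)) = 2 powr p * \<kappa>"
  shows "annulus_cost N D p \<delta> r A L x
     \<le> 2 powr p * (\<kappa> / sqrt (real N)) * sqrt x"
proof (cases "x = 0")
  case True
  then show ?thesis by (simp add: annulus_cost_def)
next
  case False
  then have x: "x > 0" using x by simp
  have p0: "p > 0" using p by simp
  define c where "c = sqrt (A / (real N * x)) * r powr (D / 2) / 2"
  have c: "c > 0" using A N x r by (simp add: c_def)
  have \<rho>: "0 < r powr (- p)" "r powr (- p) < 1" using r p0 powr_less_one[of r "- p"] by auto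
  have \<rho>R: "r powr (- p) * r powr (D / 2) = r powr (D / 2 - p)" by (simp flip: powr_add)
  have lt: "r powr (D / 2 - p) < 1" using r p powr_less_one[of r "D / 2 - p"] by simp
  have "level_sum (r powr (- p)) (r powr (D / 2)) c L \<le> c / (1 - r powr (D / 2 - p))"
    using level_sum_supercritical[OF \<rho> _ _ c, of "r powr (D / 2)" L] r lt unfolding \<rho>R by simp
  then have "\<delta> powr p * x * level_sum (r powr (- p)) (r powr (D / 2)) c L
      \<le> \<delta> powr p * x * (c / (1 - r powr (D / 2 - p)))"
    using x by (intro mult_left_mono) auto
  also have "\<dots> = \<delta> powr p * (sqrt A * r powr (D / 2) / 2) / (1 - r powr (D / 2 - p)) * (sqrt x / sqrt (real N))"
  proof -
    have "x * c = sqrt A * r powr (D / 2) / 2 * (sqrt x / sqrt (real N))"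
    proof -
      have "x * c = (x * sqrt (A / (real N * x))) * (r powr (D / 2) / 2)" by (simp add: c_def)
      then show ?thesis unfolding mult_sqrt_divide[OF x] by (simp add: ac_simps)
    qed
    then have "\<delta> powr p * (x * c) / w = \<delta> powr p * (sqrt A * r powr (D / 2) / 2) / w * (sqrt x / sqrt (real N))" for w
      by (simp only: times_divide_eq_left times_divide_eq_right divide_divide_eq_left ac_simps)
    then show ?thesis by (simp only: times_divide_eq_right mult.assoc)
  qed
  also have "\<dots> = 2 powr p * (\<kappa> / sqrt (real N)) * sqrt x" unfolding \<kappa> by simp
  finally show ?thesis unfolding level_cost_eq[OF p0 r \<delta> A N x] c_def .
qed

text \<open>The logarithm is largest for an annulus of full mass \<open>x = 1\<close>, so its argument can be taken independent of
  the annulus.\<close>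

lemma level_cost_critical:
  fixes p r \<delta> A x D \<kappa> :: real
  assumes p: "p = D / 2" "D > 0" and r: "r > 1" and \<delta>: "\<delta> \<ge> 0" and A: "A > 0" and N: "N \<ge> 1" and x: "0 \<le> x" "x \<le> 1"
    and \<kappa>: "\<delta> powr p * (sqrt A * r powr p / 2) *
       (log_plus (2 * (1 - r powr (- p)) * r powr (- p) * sqrt (real N / A)) / (p * ln r) + 1 / (1 - r powr (- p))) = 2 powr p * \<kappa>"
  shows "annulus_cost N D p \<delta> r A L x
     \<le> 2 powr p * (\<kappa> / sqrt (real N)) * sqrt x"
proof (cases "x = 0")
  case True
  then show ?thesis by (simp add: annulus_cost_def)
next
  case False
  then have x0: "x > 0" using x by simp
  have p0: "p > 0" using p by simp
  define \<rho> where "\<rho> = r powr (- p)"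
  define c where "c = sqrt (A / (real N * x)) * r powr (D / 2) / 2"
  have c: "c > 0" using A N x0 r by (simp add: c_def)
  have \<rho>: "0 < \<rho>" "\<rho> < 1" unfolding \<rho>_def using r p0 powr_less_one[of r "- p"] by auto
  have \<rho>R: "\<rho> * r powr (D / 2) = 1" using r p by (simp add: \<rho>_def flip: powr_add)
  have ln\<rho>: "- ln \<rho> = p * ln r" using r by (simp add: \<rho>_def ln_powr)
  have plr: "p * ln r > 0" using p0 r by simp
  have xc: "x * c = sqrt A * r powr p / 2 * (sqrt x / sqrt (real N))"
  proof -
    have "x * c = (x * sqrt (A / (real N * x))) * (r powr p / 2)" by (simp add: c_def p)
    then show ?thesis unfolding mult_sqrt_divide[OF x0] by (simp add: ac_simps)
  qed
  have logs: "max 0 (ln ((1 - \<rho>) / c) / (- ln \<rho>)) \<le>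
      log_plus (2 * (1 - \<rho>) * \<rho> * sqrt (real N / A)) / (p * ln r)"
  proof -
    have "(1 - \<rho>) / c \<le> 2 * (1 - \<rho>) * \<rho> * sqrt (real N / A)"
    proof -
      have "1 / c = 2 * \<rho> * sqrt (real N * x / A)"
      proof -
        have "r powr (D / 2) = 1 / \<rho>" using \<rho>R \<rho> by (simp add: field_simps)
        moreover have "sqrt (A / (real N * x)) = 1 / sqrt (real N * x / A)" by (simp add: real_sqrt_divide)
        ultimately show ?thesis using \<rho> by (simp add: c_def)
      qed
      also have "\<dots> \<le> 2 * \<rho> * sqrt (real N / A)"
        using \<rho> x A by (intro mult_left_mono real_sqrt_le_mono divide_right_mono) (auto simp: mult_left_le)
      finally have "(1 - \<rho>) * (1 / c) \<le> (1 - \<rho>) * (2 * \<rho> * sqrt (real N / A))"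
        using \<rho> by (intro mult_left_mono) auto
      then show ?thesis by (simp only: times_divide_eq_right mult_1_right ac_simps)
    qed
    moreover have "0 < (1 - \<rho>) / c" using \<rho> c by simp
    ultimately have "ln ((1 - \<rho>) / c) \<le> ln (2 * (1 - \<rho>) * \<rho> * sqrt (real N / A))" by (intro ln_mono) auto
    then have "max 0 (ln ((1 - \<rho>) / c)) \<le> log_plus (2 * (1 - \<rho>) * \<rho> * sqrt (real N / A))"
      unfolding log_plus_def by (simp add: max_def)
    then have "max 0 (ln ((1 - \<rho>) / c)) / (p * ln r) \<le> log_plus (2 * (1 - \<rho>) * \<rho> * sqrt (real N / A)) / (p * ln r)"
      using plr by (intro divide_right_mono) auto
    moreover have "max 0 (ln ((1 - \<rho>) / c) / (- ln \<rho>)) = max 0 (ln ((1 - \<rho>) / c)) / (p * ln r)"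
      unfolding ln\<rho> using plr by (simp add: max_divide_distrib_right)
    ultimately show ?thesis by simp
  qed
  have "level_sum \<rho> (r powr (D / 2)) c L \<le> c * (max 0 (ln ((1 - \<rho>) / c) / (- ln \<rho>)) + 1 / (1 - \<rho>))"
    by (rule level_sum_critical[OF \<rho> \<rho>R c])
  also have "\<dots> \<le> c * (log_plus (2 * (1 - \<rho>) * \<rho> * sqrt (real N / A)) / (p * ln r) + 1 / (1 - \<rho>))"
    using logs c by (intro mult_left_mono add_right_mono) auto
  finally have "\<delta> powr p * x * level_sum \<rho> (r powr (D / 2)) c L \<le>
     \<delta> powr p * x * (c * (log_plus (2 * (1 - \<rho>) * \<rho> * sqrt (real N / A)) / (p * ln r) + 1 / (1 - \<rho>)))"
    using x0 by (intro mult_left_mono) auto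
  also have "\<dots> = \<delta> powr p * (x * c) * (log_plus (2 * (1 - \<rho>) * \<rho> * sqrt (real N / A)) / (p * ln r) + 1 / (1 - \<rho>))"
    by (simp only: mult.assoc)
  also have "\<dots> = 2 powr p * \<kappa> * (sqrt x / sqrt (real N))"
    unfolding xc \<kappa>[symmetric] \<rho>_def by (simp only: ac_simps)
  also have "\<dots> = 2 powr p * (\<kappa> / sqrt (real N)) * sqrt x" by simp
  finally show ?thesis unfolding level_cost_eq[OF p0 r \<delta> A N x0] c_def \<rho>_def .
qed

lemma level_cost_subcritical:
  fixes p r \<delta> A x D \<kappa> :: real
  assumes p: "0 < p" "p < D / 2" and r: "r > 1" and \<delta>: "\<delta> \<ge> 0" and A: "A > 0" and N: "N \<ge> 1" and x: "0 \<le> x"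
    and \<kappa>: "\<delta> powr p * (sqrt A * r powr (D / 2) / 2) powr (2 * p / D) *
       ((1 - r powr (- D / 2)) powr (1 - 2 * p / D) / (1 - r powr (p - D / 2))) = 2 powr p * \<kappa>"
  shows "annulus_cost N D p \<delta> r A L x
     \<le> 2 powr p * (\<kappa> / real N powr (p / D)) * x powr (1 - p / D)"
proof (cases "x = 0")
  case True
  then show ?thesis by (simp add: annulus_cost_def)
next
  case False
  then have x: "x > 0" using x by simp
  have D: "D > 0" using p by simp
  define \<gamma> where "\<gamma> = 2 * p / D"
  have \<gamma>: "0 < \<gamma>" "\<gamma> < 1" using p D by (auto simp: \<gamma>_def)
  define c where "c = sqrt (A / (real N * x)) * r powr (D / 2) / 2"
  have c: "c > 0" using A N x r by (simp add: c_def)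
  define R where "R = r powr (D / 2)"
  have R: "R > 1" unfolding R_def using r D by simp
  have \<rho>: "r powr (- p) = R powr (- \<gamma>)" using D by (simp add: R_def \<gamma>_def powr_powr)
  have R1: "1 / R = r powr (- D / 2)" unfolding R_def using powr_minus_divide[of r "D / 2"] by simp
  have R2: "R powr (\<gamma> - 1) = r powr (p - D / 2)"
  proof -
    have "D / 2 * (\<gamma> - 1) = p - D / 2" using D by (simp add: \<gamma>_def field_simps)
    then show ?thesis by (simp only: R_def powr_powr)
  qed
  define B where "B = (1 - r powr (- D / 2)) powr (1 - \<gamma>) / (1 - r powr (p - D / 2))"
  have "level_sum (r powr (- p)) R c L \<le> c powr \<gamma> * B"
    using level_sum_subcritical[OF R \<gamma> c, of L] unfolding \<rho> R1 R2 B_def .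
  then have "\<delta> powr p * x * level_sum (r powr (- p)) R c L \<le> \<delta> powr p * x * (c powr \<gamma> * B)"
    using x by (intro mult_left_mono) auto
  also have "\<dots> = \<delta> powr p * (sqrt A * r powr (D / 2) / 2) powr \<gamma> * B * (x powr (1 - p / D) / real N powr (p / D))"
  proof -
    have "c = (sqrt A * r powr (D / 2) / 2) * (1 / sqrt (real N)) * (1 / sqrt x)"
      by (simp add: c_def real_sqrt_divide real_sqrt_mult)
    then have "c powr \<gamma> = (sqrt A * r powr (D / 2) / 2) powr \<gamma> * (1 / sqrt (real N)) powr \<gamma> * (1 / sqrt x) powr \<gamma>"
      using A r x by (simp only: powr_mult)
    moreover have s: "(1 / sqrt w) powr \<gamma> = w powr (- (p / D))" if "w > 0" for w
    proof -
      have "1 / sqrt w = w powr (- (1 / 2))"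
        using that powr_minus_divide[of w "1 / 2"] powr_half_sqrt[of w] by simp
      then show ?thesis using D by (simp add: powr_powr \<gamma>_def)
    qed
    moreover have "x * x powr (- (p / D)) = x powr (1 - p / D)"
      using x powr_add[of x 1 "- (p / D)"] by simp
    moreover have "real N powr (- (p / D)) = 1 / real N powr (p / D)" by (rule powr_minus_divide)
    ultimately have xc: "x * c powr \<gamma> = (sqrt A * r powr (D / 2) / 2) powr \<gamma> * (x powr (1 - p / D) / real N powr (p / D))"
      using x N by simp
    have "\<delta> powr p * x * (c powr \<gamma> * B) = \<delta> powr p * (x * c powr \<gamma>) * B" by (simp only: mult.assoc)
    then show ?thesis unfolding xc by (simp only: ac_simps)
  qed
  also have "\<dots> = 2 powr p * \<kappa> * (x powr (1 - p / D) / real N powr (p / D))"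
    unfolding \<kappa>[symmetric] B_def \<gamma>_def ..
  also have "\<dots> = 2 powr p * (\<kappa> / real N powr (p / D)) * x powr (1 - p / D)" by simp
  finally show ?thesis unfolding level_cost_eq[OF p(1) r \<delta> A N x] c_def R_def .
qed

lemma deviation_le_sqrt:
  assumes "0 \<le> x"
  shows "2 * deviation N x \<le> 1 / sqrt (real N) * sqrt x"
  by (simp add: deviation_def real_sqrt_divide min_def)

text \<open>Interpolation of the minimum: \<open>min v w \<le> v\<^sup>1\<^sup>-\<^sup>g w\<^sup>g\<close>. With \<open>g = 2p/d\<close> it yields the
  factor \<open>2\<^sup>1\<^sup>-\<^sup>2\<^sup>p\<^sup>/\<^sup>d\<close>.\<close>

lemma deviation_le_powr:
  fixes x g :: real
  assumes x: "0 \<le> x" and g: "0 < g" "g < 1" and N: "N \<ge> 1"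
  shows "2 * deviation N x \<le> 2 powr (1 - g) / real N powr (g / 2) * x powr (1 - g / 2)"
proof (cases "x = 0")
  case True
  then show ?thesis by (simp add: deviation_def)
next
  case False
  then have x: "x > 0" using x by simp
  define v where "v = min (2 * x) (sqrt (x / real N))"
  have v: "v > 0" using x N by (simp add: v_def)
  have "2 * deviation N x = v" by (simp add: deviation_def v_def min_def)
  also have "v = v powr (1 - g) * v powr g" using v by (simp flip: powr_add)
  also have "\<dots> \<le> (2 * x) powr (1 - g) * (sqrt (x / real N)) powr g"
    using v g by (intro mult_mono powr_mono2) (auto simp: v_def)
  also have "(sqrt (x / real N)) powr g = x powr (g / 2) / real N powr (g / 2)"
    using x N by (simp add: powr_half_sqrt[symmetric] powr_powr powr_divide)
  also have "(2 * x) powr (1 - g) = 2 powr (1 - g) * x powr (1 - g)" using x by (simp add: powr_mult)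
  also have "2 powr (1 - g) * x powr (1 - g) * (x powr (g / 2) / real N powr (g / 2))
      = 2 powr (1 - g) / real N powr (g / 2) * (x powr (1 - g) * x powr (g / 2))" by simp
  also have "x powr (1 - g) * x powr (g / 2) = x powr (1 - g / 2)" by (simp flip: powr_add)
  finally show ?thesis .
qed

section \<open>Cost bounds and the constants\<close>

context iid_sample
begin

text \<open>For \<open>p \<ge> d/2\<close> both the matching inside an annulus and the exchange between annuli are of order \<open>sqrt (x/N)\<close>,
  so that \<open>p / s = 1/2\<close>.\<close>

lemma cost_bound_sqrt_rate:
  fixes m :: ereal and p q r A \<delta> \<kappa> :: real
  assumes p: "p > 0" and q: "q > 2 * p" and m: "m \<ge> 1"
    and r: "r > 1" and A: "A > 0" and \<delta>: "\<delta> \<ge> 0" and \<kappa>: "\<kappa> > 0"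
    and cells: "\<And>L. \<exists>c :: nat \<Rightarrow> real ^ 'n \<Rightarrow> nat. nested_cells m r A \<delta> L c"
    and level: "\<And>L x. 0 \<le> x \<Longrightarrow> x \<le> 1 \<Longrightarrow>
      annulus_cost N (real CARD('n)) p \<delta> r A L x \<le> 2 powr p * (\<kappa> / sqrt (real N)) * sqrt x"
  shows "expected_cost p m \<le>
     ennreal (2 powr p * (\<kappa> / sqrt (real N))) * ennpowr (moment q m \<mu>) (p / q) * ennreal (H (eps_p p / \<kappa>) (2 * p) q)"
proof -
  have N: "sqrt (real N) > 0" using N_pos by simp
  have half: "p / (2 * p) = 1 / 2" using p by simp
  have "expected_cost p m \<le>
     ennreal (2 powr p * (\<kappa> / sqrt (real N))) * ennpowr (moment q m \<mu>) (p / q) *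
     ennreal (H (1 / sqrt (real N) * eps_p p / (\<kappa> / sqrt (real N))) (2 * p) q)"
  proof (rule cost_bound_from_moment[OF m p r less_imp_le[OF A] \<delta> cells _ q])
    show "annulus_cost N (real CARD('n)) p \<delta> r A L x \<le> 2 powr p * (\<kappa> / sqrt (real N)) * x powr (p / (2 * p))"
      if "0 \<le> x" "x \<le> 1" for L x
      unfolding half powr_half_sqrt[OF that(1)] by (rule level[OF that])
    show "2 * deviation N x \<le> 1 / sqrt (real N) * x powr (p / (2 * p))" if "0 \<le> x" for x
      unfolding half powr_half_sqrt[OF that] by (rule deviation_le_sqrt[OF that])
  qed (use p \<kappa> N in auto)
  moreover have "1 / sqrt (real N) * eps_p p / (\<kappa> / sqrt (real N)) = eps_p p / \<kappa>" using N by simp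
  ultimately show ?thesis by (simp only:)
qed

lemma cost_bound_supercritical:
  fixes m :: ereal and p q r A \<delta> \<kappa> :: real
  assumes p: "p > real CARD('n) / 2" and q: "q > 2 * p" and m: "m \<ge> 1"
    and r: "r > 1" and A: "A > 0" and \<delta>: "\<delta> \<ge> 0" and \<kappa>: "\<kappa> > 0"
    and cells: "\<And>L. \<exists>c :: nat \<Rightarrow> real ^ 'n \<Rightarrow> nat. nested_cells m r A \<delta> L c"
    and \<kappa>_eq: "\<delta> powr p * (sqrt A * r powr (real CARD('n) / 2) / 2) / (1 - r powr (real CARD('n) / 2 - p)) = 2 powr p * \<kappa>"
  shows "expected_cost p m \<le>
     ennreal (2 powr p * (\<kappa> / sqrt (real N))) * ennpowr (moment q m \<mu>) (p / q) * ennreal (H (eps_p p / \<kappa>) (2 * p) q)"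
proof -
  have D: "real CARD('n) > 0" by simp
  have "p > 0" using p D by linarith
  then show ?thesis
    by (rule cost_bound_sqrt_rate[OF _ q m r A \<delta> \<kappa> cells])
      (rule level_cost_supercritical[OF p D r \<delta> A N_pos _ \<kappa>_eq])
qed

lemma cost_bound_critical:
  fixes m :: ereal and p q r A \<delta> \<kappa> :: real
  assumes p: "p = real CARD('n) / 2" and q: "q > 2 * p" and m: "m \<ge> 1"
    and r: "r > 1" and A: "A > 0" and \<delta>: "\<delta> \<ge> 0" and \<kappa>: "\<kappa> > 0"
    and cells: "\<And>L. \<exists>c :: nat \<Rightarrow> real ^ 'n \<Rightarrow> nat. nested_cells m r A \<delta> L c"
    and \<kappa>_eq: "\<delta> powr p * (sqrt A * r powr p / 2) *
       (log_plus (2 * (1 - r powr (- p)) * r powr (- p) * sqrt (real N / A)) / (p * ln r) + 1 / (1 - r powr (- p))) = 2 powr p * \<kappa>"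
  shows "expected_cost p m \<le>
     ennreal (2 powr p * (\<kappa> / sqrt (real N))) * ennpowr (moment q m \<mu>) (p / q) * ennreal (H (eps_p p / \<kappa>) (2 * p) q)"
proof -
  have D: "real CARD('n) > 0" by simp
  have "p > 0" using p D by linarith
  then show ?thesis
    by (rule cost_bound_sqrt_rate[OF _ q m r A \<delta> \<kappa> cells])
      (rule level_cost_critical[OF p D r \<delta> A N_pos _ _ \<kappa>_eq])
qed

lemma cost_bound_subcritical:
  fixes m :: ereal and p q r A \<delta> \<kappa> :: real
  defines "D \<equiv> real CARD('n)"
  assumes p: "0 < p" "p < D / 2" and q: "q > D * p / (D - p)" and m: "m \<ge> 1"
    and r: "r > 1" and A: "A > 0" and \<delta>: "\<delta> \<ge> 0" and \<kappa>: "\<kappa> > 0"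
    and cells: "\<And>L. \<exists>c :: nat \<Rightarrow> real ^ 'n \<Rightarrow> nat. nested_cells m r A \<delta> L c"
    and \<kappa>_eq: "\<delta> powr p * (sqrt A * r powr (D / 2) / 2) powr (2 * p / D) *
       ((1 - r powr (- D / 2)) powr (1 - 2 * p / D) / (1 - r powr (p - D / 2))) = 2 powr p * \<kappa>"
  shows "expected_cost p m \<le>
     ennreal (2 powr p * (\<kappa> / real N powr (p / D))) * ennpowr (moment q m \<mu>) (p / q) *
     ennreal (H (2 powr (1 - 2 * p / D) * eps_p p / \<kappa>) (D * p / (D - p)) q)"
proof -
  have D: "D > 0" by (simp add: D_def)
  have Dp: "D - p > 0" using p by linarith
  have N: "real N powr (p / D) > 0" using N_pos by simp
  have e: "p / (D * p / (D - p)) = 1 - p / D" using p Dp D by (simp add: field_simps)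
  have g: "0 < 2 * p / D" "2 * p / D < 1" "2 * p / D / 2 = p / D" using p D by auto
  have s: "p \<le> D * p / (D - p)" using p Dp by (simp add: le_divide_eq mult_mono)
  have "expected_cost p m \<le>
     ennreal (2 powr p * (\<kappa> / real N powr (p / D))) * ennpowr (moment q m \<mu>) (p / q) *
     ennreal (H (2 powr (1 - 2 * p / D) / real N powr (p / D) * eps_p p / (\<kappa> / real N powr (p / D))) (D * p / (D - p)) q)"
  proof (rule cost_bound_from_moment[OF m p(1) r less_imp_le[OF A] \<delta> cells s q])
    show "annulus_cost N (real CARD('n)) p \<delta> r A L x
       \<le> 2 powr p * (\<kappa> / real N powr (p / D)) * x powr (p / (D * p / (D - p)))"
      if "0 \<le> x" for L x
      unfolding e D_def[symmetric] by (rule level_cost_subcritical[OF p r \<delta> A N_pos that \<kappa>_eq])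
    show "2 * deviation N x \<le> 2 powr (1 - 2 * p / D) / real N powr (p / D) * x powr (p / (D * p / (D - p)))"
      if "0 \<le> x" for x
      using deviation_le_powr[OF that g(1,2) N_pos] unfolding e g(3) .
  qed (use \<kappa> N in auto)
  moreover have "2 powr (1 - 2 * p / D) / real N powr (p / D) * eps_p p / (\<kappa> / real N powr (p / D))
      = 2 powr (1 - 2 * p / D) * eps_p p / \<kappa>" using N by simp
  ultimately show ?thesis by (simp only:)
qed

end

text \<open>The upper bounds depend continuously on \<open>\<kappa> > 0\<close>, so a bound that holds for every member of a family of
  constants holds for their infimum, provided that the infimum is positive.\<close>

lemma bound_at_Inf:
  fixes f :: "'r \<Rightarrow> real" and X Y :: ennreal
  assumes S: "S \<noteq> {}" and l: "0 < l" "\<And>r. r \<in> S \<Longrightarrow> l \<le> f r"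
    and C: "C \<ge> 0" "n > 0" and c: "c \<ge> 0" and s: "0 < s" "s < q"
    and bound: "\<And>r. r \<in> S \<Longrightarrow> X \<le> ennreal (C * (f r / n)) * Y * ennreal (H (c / f r) s q)"
  shows "X \<le> ennreal (C * ((INF r\<in>S. f r) / n)) * Y * ennreal (H (c / (INF r\<in>S. f r)) s q)"
proof -
  define k where "k = (INF r\<in>S. f r)"
  have k: "l \<le> k" unfolding k_def using S l(2) by (intro cINF_greatest) auto
  have k0: "k > 0" using k l by linarith
  have "k \<in> closure (f ` S)"
    unfolding k_def using S l(2) by (intro closure_contains_Inf) (auto intro!: bdd_belowI[of _ l])
  then obtain u where u: "\<And>i. u i \<in> f ` S" "u \<longlonglongrightarrow> k" unfolding closure_sequential by blast
  have base: "0 < c / k * ((q - s) / s) + (1 + c / k) * (q / s) powr (q / (q - s))"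
  proof -
    have "0 \<le> c / k * ((q - s) / s)" using c k0 s by simp
    moreover have "0 < (1 + c / k) * (q / s) powr (q / (q - s))"
      using c k0 s by (intro mult_pos_pos add_pos_nonneg) auto
    ultimately show ?thesis by linarith
  qed
  have Hk: "(\<lambda>i. H (c / u i) s q) \<longlonglongrightarrow> H (c / k) s q"
    unfolding H_def using k0 base by (intro tendsto_intros u(2)) auto
  have le: "X \<le> ennreal (C * (u i / n)) * Y * ennreal (H (c / u i) s q)" for i
    using u(1)[of i] bound by auto
  show ?thesis
  proof (cases "Y = \<infinity>")
    case True
    show ?thesis
    proof (cases "C = 0")
      case True
      then show ?thesis using le[of 0] by simp
    next
      case False
      have "H (c / k) s q > 0" unfolding H_def using base s by simp
      then have "ennreal (C * (k / n)) * Y * ennreal (H (c / k) s q) = \<infinity>"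
        using True False C k0 by (simp add: ennreal_mult_top ennreal_top_mult)
      then show ?thesis unfolding k_def by simp
    qed
  next
    case False
    then obtain y where y: "Y = ennreal y" "0 \<le> y" by (cases Y) auto
    have "(\<lambda>i. ennreal (C * (u i / n)) * Y * ennreal (H (c / u i) s q)) \<longlonglongrightarrow> ennreal (C * (k / n)) * Y * ennreal (H (c / k) s q)"
    proof -
      have Hnn: "0 \<le> H x s q" for x using s by (simp add: H_def)
      have eq: "ennreal (C * (w / n)) * Y * ennreal (H (c / w) s q) = ennreal (C * (w / n) * y * H (c / w) s q)"
        if "w > 0" for w
      proof -
        have "0 \<le> C * (w / n)" using that C by simp
        then show ?thesis unfolding y(1) using y(2) Hnn by (simp only: ennreal_mult mult_nonneg_nonneg)
      qed
      have pos: "u i > 0" for i using u(1)[of i] l by force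
      show ?thesis unfolding eq[OF pos] eq[OF k0]
        by (intro tendsto_intros u(2) Hk) (use C in auto)
    qed
    then show ?thesis unfolding k_def[symmetric]
      by (rule LIMSEQ_le_const) (use le in auto)
  qed
qed

lemma one_le_div_powr:
  fixes r p :: real
  assumes "r \<ge> 2" "p > 0"
  shows "1 \<le> r powr p / (r - 1) powr p"
proof -
  have "(r - 1) powr p \<le> r powr p" using assms by (intro powr_mono2) auto
  then show ?thesis using assms by (simp add: le_divide_eq)
qed

text \<open>The covering partitions have \<open>A = K 2\<^sup>-\<^sup>d\<close> and \<open>\<delta> = 4r/(r-1)\<close>; with these values the general constant is
  \<open>\<kappa>\<close>. The lower bound keeps the infimum over \<open>r\<close> away from \<open>0\<close>. The same holds for the next two lemmas.\<close>

lemma kappa_super_r_eq: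
  fixes p r :: real and m :: ereal
  defines "D \<equiv> real CARD('n::finite)"
  assumes p: "p > D / 2" and r: "r \<ge> 2" and m: "m \<ge> 1"
  shows "(4 * r / (r - 1)) powr p * (sqrt (cover_const TYPE('n) m * 2 powr (- D)) * r powr (D / 2) / 2) / (1 - r powr (D / 2 - p))
      = 2 powr p * kappa_super_r TYPE('n) p m r"
    and "sqrt (cover_const TYPE('n) m) * 2 powr (p - 1 - D / 2) \<le> kappa_super_r TYPE('n) p m r"
proof -
  define K where "K = cover_const TYPE('n) m"
  have K: "K > 0" using cover_const_ge_1[OF m, where 'n='n] by (simp add: K_def)
  have e1: "(4 * r / (r - 1)) powr p = 2 powr p * 2 powr p * (r powr p / (r - 1) powr p)"
    using r powr_mult[of 2 2 p] by (simp add: powr_mult powr_divide)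
  have e2: "sqrt (K * 2 powr (- D)) = sqrt K * 2 powr (- D / 2)"
    by (simp add: real_sqrt_mult powr_half_sqrt[symmetric] powr_powr)
  have e3: "2 powr (p - 1 - D / 2) = 2 powr p * 2 powr (- D / 2) / 2"
  proof -
    have "p - 1 - D / 2 = p + - D / 2 - 1" by simp
    then show ?thesis by (simp only: powr_add powr_diff) simp
  qed
  have e4: "T * T * (a / b) * (u * U * e / 2) / v = T * (u * (T * U / 2 * (a * e) / (b * v)))"
    for T U a b e u v :: real
    by (simp add: ac_simps)
  show "(4 * r / (r - 1)) powr p * (sqrt (cover_const TYPE('n) m * 2 powr (- D)) * r powr (D / 2) / 2) / (1 - r powr (D / 2 - p))
      = 2 powr p * kappa_super_r TYPE('n) p m r"
    unfolding K_def[symmetric] kappa_super_r_def Let_def D_def[symmetric] e1 e2 e3 powr_add[of r] by (rule e4)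
  have D: "D > 0" by (simp add: D_def)
  have p0: "p > 0" using p D by linarith
  define v where "v = 1 - r powr (D / 2 - p)"
  have v: "0 < v" "v \<le> 1" unfolding v_def using r p powr_less_one[of r "D / 2 - p"] by auto
  have "1 * 1 \<le> (r powr p / (r - 1) powr p) * (r powr (D / 2) / v)"
  proof (intro mult_mono one_le_div_powr r p0)
    have "1 \<le> r powr (D / 2)" using r D by (intro ge_one_powr_ge_zero) auto
    then show "1 \<le> r powr (D / 2) / v" using v by (simp add: le_divide_eq)
  qed auto
  then have "sqrt K * 2 powr (p - 1 - D / 2) * 1 \<le> sqrt K * 2 powr (p - 1 - D / 2) * ((r powr p / (r - 1) powr p) * (r powr (D / 2) / v))"
    using K by (intro mult_left_mono) auto
  then show "sqrt (cover_const TYPE('n) m) * 2 powr (p - 1 - D / 2) \<le> kappa_super_r TYPE('n) p m r"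
    unfolding K_def[symmetric] kappa_super_r_def Let_def D_def[symmetric] v_def[symmetric] by (simp add: powr_add ac_simps)
qed

lemma kappa_crit_r_eq:
  fixes p r :: real and m :: ereal
  defines "D \<equiv> real CARD('n::finite)"
  assumes p: "p = D / 2" and r: "r \<ge> 2" and m: "m \<ge> 1"
  shows "(4 * r / (r - 1)) powr p * (sqrt (cover_const TYPE('n) m * 2 powr (- D)) * r powr p / 2) *
       (log_plus (2 * (1 - r powr (- p)) * r powr (- p) * sqrt (real N / (cover_const TYPE('n) m * 2 powr (- D)))) / (p * ln r)
         + 1 / (1 - r powr (- p))) = 2 powr p * kappa_crit_r TYPE('n) p N m r"
    and "sqrt (cover_const TYPE('n) m) / 2 \<le> kappa_crit_r TYPE('n) p N m r"
proof -
  define K where "K = cover_const TYPE('n) m"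
  have K: "K > 0" using cover_const_ge_1[OF m, where 'n='n] by (simp add: K_def)
  have D: "D > 0" by (simp add: D_def)
  have p0: "p > 0" using p D by linarith
  define R where "R = r powr p"
  have R: "R > 1" unfolding R_def using r p0 by simp
  have Ri: "r powr (- p) = 1 / R" unfolding R_def by (rule powr_minus_divide)
  have R2: "r powr (2 * p) = R * R" unfolding R_def by (simp flip: powr_add)
  have R3: "r powr (3 * p) = R * R * R" unfolding R_def by (simp flip: powr_add)
  have Ri2: "r powr (- 2 * p) = 1 / (R * R)" using powr_minus_divide[of r "2 * p"] R2 by simp
  define T where "T = 2 powr p"
  have T: "T > 0" by (simp add: T_def)
  have d: "(4 * r / (r - 1)) powr p = T * T * (R / (r - 1) powr p)"
    using r powr_mult[of 2 2 p] by (simp add: powr_mult powr_divide T_def R_def)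
  have TD: "2 powr (- D) = 1 / (T * T)"
  proof -
    have "- D = - (p + p)" by (simp add: p)
    then have "2 powr (- D) = 1 / 2 powr (p + p)" by (simp only: powr_minus_divide)
    then show ?thesis by (simp only: powr_add T_def)
  qed
  have sA: "sqrt (K * 2 powr (- D)) = sqrt K / T"
    unfolding TD using T by (simp add: real_sqrt_divide)
  have sN: "sqrt (real N / (K * 2 powr (- D))) = T * sqrt (real N / K)"
  proof -
    have "real N / (K * 2 powr (- D)) = (T * T) * (real N / K)" unfolding TD by simp
    then show ?thesis using T by (simp only: real_sqrt_mult) (simp add: real_sqrt_mult[symmetric])
  qed
  have arg: "2 * (1 - r powr (- p)) * r powr (- p) * sqrt (real N / (K * 2 powr (- D)))
      = 2 powr (p + 1) * (r powr (- p) - r powr (- 2 * p)) * sqrt (real N / K)"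
    unfolding sN Ri Ri2 by (simp add: powr_add T_def algebra_simps)
  define W where "W = log_plus (2 powr (p + 1) * (r powr (- p) - r powr (- 2 * p)) * sqrt (real N / K))"
  define V where "V = (r - 1) powr p"
  have V: "V > 0" using r by (simp add: V_def)
  have kap: "kappa_crit_r TYPE('n) p N m r = sqrt K / 2 * (R * R / (V * p * ln r)) * W + sqrt K / 2 * (R * R * R / (V * (R - 1)))"
    unfolding kappa_crit_r_def Let_def K_def[symmetric] W_def V_def R2 R3 R_def[symmetric] ..
  have lr: "p * ln r > 0" using p0 r by simp
  have inv: "1 / (1 - 1 / R) = R / (R - 1)" using R by (simp add: field_simps)
  have "T * T * (R / V) * (sqrt K / T * R / 2) * (W / (p * ln r) + R / (R - 1))
      = T * (sqrt K / 2 * (R * R / (V * p * ln r)) * W + sqrt K / 2 * (R * R * R / (V * (R - 1))))"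
  proof -
    have "T * T * (R / V) * (sqrt K / T * R / 2) = T * (sqrt K / 2 * (R * R / V))"
      using T by (simp add: ac_simps)
    then have "T * T * (R / V) * (sqrt K / T * R / 2) * (W / (p * ln r) + R / (R - 1))
       = T * (sqrt K / 2 * (R * R / V) * (W / (p * ln r)) + sqrt K / 2 * (R * R / V) * (R / (R - 1)))"
      by (simp only: distrib_left mult.assoc)
    also have "\<dots> = T * (sqrt K / 2 * (R * R / (V * p * ln r)) * W + sqrt K / 2 * (R * R * R / (V * (R - 1))))"
      by (simp add: ac_simps)
    finally show ?thesis .
  qed
  then show "(4 * r / (r - 1)) powr p * (sqrt (cover_const TYPE('n) m * 2 powr (- D)) * r powr p / 2) *
       (log_plus (2 * (1 - r powr (- p)) * r powr (- p) * sqrt (real N / (cover_const TYPE('n) m * 2 powr (- D)))) / (p * ln r)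
         + 1 / (1 - r powr (- p))) = 2 powr p * kappa_crit_r TYPE('n) p N m r"
    unfolding K_def[symmetric] arg W_def[symmetric] kap
    unfolding d sA Ri inv V_def[symmetric] R_def[symmetric] T_def[symmetric] .
  have "1 * 1 \<le> (R / V) * (R * R / (R - 1))"
  proof (intro mult_mono)
    show "1 \<le> R / V" unfolding R_def V_def by (rule one_le_div_powr[OF r p0])
    have "R \<le> R * R" using R by simp
    then have "R - 1 \<le> R * R" by linarith
    then show "1 \<le> R * R / (R - 1)" using R by (simp add: le_divide_eq)
  qed (use R V in auto)
  then have "sqrt K / 2 * 1 \<le> sqrt K / 2 * ((R / V) * (R * R / (R - 1)))" using K by (intro mult_left_mono) auto
  moreover have "(R / V) * (R * R / (R - 1)) = R * R * R / (V * (R - 1))" by simp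
  ultimately have low: "sqrt K / 2 \<le> sqrt K / 2 * (R * R * R / (V * (R - 1)))" by (simp only: mult_1_right)
  have "0 \<le> sqrt K / 2 * (R * R / (V * p * ln r)) * W"
    using K R V p0 r by (auto simp: W_def log_plus_def)
  then show "sqrt (cover_const TYPE('n) m) / 2 \<le> kappa_crit_r TYPE('n) p N m r"
    unfolding kap K_def[symmetric] using low by (rule add_increasing)
qed

lemma kappa_sub_r_eq:
  fixes p r :: real and m :: ereal
  defines "D \<equiv> real CARD('n::finite)"
  assumes p: "0 < p" "p < D / 2" and r: "r \<ge> 2" and m: "m \<ge> 1"
  shows "(4 * r / (r - 1)) powr p * (sqrt (cover_const TYPE('n) m * 2 powr (- D)) * r powr (D / 2) / 2) powr (2 * p / D) *
       ((1 - r powr (- D / 2)) powr (1 - 2 * p / D) / (1 - r powr (p - D / 2))) = 2 powr p * kappa_sub_r TYPE('n) p m r"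
    and "(cover_const TYPE('n) m / 4) powr (p / D) \<le> kappa_sub_r TYPE('n) p m r"
proof -
  define K where "K = cover_const TYPE('n) m"
  have K: "K > 0" using cover_const_ge_1[OF m, where 'n='n] by (simp add: K_def)
  have D: "D > 0" by (simp add: D_def)
  define V where "V = (r - 1) powr p"
  have V: "V > 0" using r by (simp add: V_def)
  define B where "B = (1 - r powr (- D / 2)) powr (1 - 2 * p / D)"
  define E where "E = 1 - r powr (p - D / 2)"
  have d: "(4 * r / (r - 1)) powr p = 2 powr p * 2 powr p * (r powr p / V)"
    using r powr_mult[of 2 2 p] by (simp add: powr_mult powr_divide V_def)
  have c: "(sqrt (K * 2 powr (- D)) * r powr (D / 2) / 2) powr (2 * p / D) = (K / 4) powr (p / D) * (r powr p / 2 powr p)"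
  proof -
    have "sqrt (K * 2 powr (- D)) * r powr (D / 2) / 2 = sqrt (K / 4 * (2 powr (- D) * r powr D))"
    proof -
      have "r powr (D / 2) = sqrt (r powr D)" by (simp add: powr_half_sqrt[symmetric] powr_powr)
      moreover have "sqrt 4 = (2 :: real)" using real_sqrt_abs[of 2] by simp
      ultimately show ?thesis by (simp add: real_sqrt_mult real_sqrt_divide)
    qed
    also have "\<dots> = (K / 4 * (2 powr (- D) * r powr D)) powr (1 / 2)" using K by (simp add: powr_half_sqrt)
    finally have "(sqrt (K * 2 powr (- D)) * r powr (D / 2) / 2) powr (2 * p / D)
       = (K / 4 * (2 powr (- D) * r powr D)) powr (p / D)" by (simp add: powr_powr)
    also have "\<dots> = (K / 4) powr (p / D) * ((2 powr (- D)) powr (p / D) * (r powr D) powr (p / D))"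
      using K by (simp only: powr_mult)
    also have "(r powr D) powr (p / D) = r powr p" using D by (simp add: powr_powr)
    also have "(2 powr (- D)) powr (p / D) = 1 / 2 powr p"
      using D powr_minus_divide[of 2 p] by (simp add: powr_powr)
    finally show ?thesis by simp
  qed
  have r2: "r powr (2 * p) = r powr p * r powr p" by (simp flip: powr_add)
  have kap: "kappa_sub_r TYPE('n) p m r = (K / 4) powr (p / D) * (r powr p * r powr p * B / (V * E))"
    unfolding kappa_sub_r_def Let_def K_def[symmetric] D_def[symmetric] B_def E_def V_def r2 ..
  have "2 powr p * 2 powr p * (r powr p / V) * ((K / 4) powr (p / D) * (r powr p / 2 powr p)) * (B / E)
      = 2 powr p * ((K / 4) powr (p / D) * (r powr p * r powr p * B / (V * E)))"
    by (simp add: ac_simps)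
  then show "(4 * r / (r - 1)) powr p * (sqrt (cover_const TYPE('n) m * 2 powr (- D)) * r powr (D / 2) / 2) powr (2 * p / D) *
       ((1 - r powr (- D / 2)) powr (1 - 2 * p / D) / (1 - r powr (p - D / 2))) = 2 powr p * kappa_sub_r TYPE('n) p m r"
    unfolding K_def[symmetric] c d kap B_def[symmetric] E_def[symmetric] .
  have E0: "E > 0" unfolding E_def using r p powr_less_one[of r "p - D / 2"] by simp
  have b: "0 < 1 - r powr (- D / 2)" using r D powr_less_one[of r "- D / 2"] by simp
  have "E \<le> 1 - r powr (- D / 2)" unfolding E_def using r p by (simp add: powr_mono)
  also have "\<dots> = (1 - r powr (- D / 2)) powr 1" using b by simp
  also have "\<dots> \<le> B" unfolding B_def using b p D by (intro powr_mono') auto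
  finally have EB: "1 \<le> B / E" using E0 by (simp add: le_divide_eq)
  have "1 * 1 * 1 \<le> (r powr p / V) * r powr p * (B / E)"
  proof (intro mult_mono EB)
    show "1 \<le> r powr p / V" unfolding V_def by (rule one_le_div_powr[OF r p(1)])
    show "1 \<le> r powr p" using r p by (intro ge_one_powr_ge_zero) auto
  qed (use V in auto)
  then have "(K / 4) powr (p / D) * 1 \<le> (K / 4) powr (p / D) * ((r powr p / V) * r powr p * (B / E))"
    by (intro mult_left_mono) auto
  then show "(cover_const TYPE('n) m / 4) powr (p / D) \<le> kappa_sub_r TYPE('n) p m r"
    unfolding K_def[symmetric] kap by simp
qed

section \<open>Explicit bounds for the empirical measure\<close>

theorem theorem1:
  fixes \<mu> :: "(real ^ 'n::finite) measure"
    and M :: "'w measure"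
    and X :: "nat \<Rightarrow> 'w \<Rightarrow> real ^ 'n"
    and p :: real
  assumes "p > 0"
    and "prob_space \<mu>" and "sets \<mu> = sets borel"
    and "prob_space M"
    and "prob_space.indep_vars M (\<lambda>_. borel) X {1..}"
    and "\<And>k. k \<ge> 1 \<Longrightarrow> distr M borel (X k) = \<mu>"
  shows
    "(p > real CARD('n) / 2 \<longrightarrow>
       (\<forall>q::real. q > 2 * p \<longrightarrow> (\<forall>m::ereal. m \<ge> 1 \<longrightarrow> (\<forall>N::nat. N \<ge> 1 \<longrightarrow>
          (\<integral>\<^sup>+ \<omega>. transport_cost p m (empirical_measure N (\<lambda>k. X k \<omega>)) \<mu> \<partial>M)
            \<le> ennreal (2 powr p * (kappa_super TYPE('n) p m / sqrt (real N)))
                * ennpowr (moment q m \<mu>) (p / q) * ennreal (theta_super TYPE('n) p q m)))))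
     \<and>
     (p = real CARD('n) / 2 \<longrightarrow>
       (\<forall>q::real. q > 2 * p \<longrightarrow> (\<forall>m::ereal. m \<ge> 1 \<longrightarrow> (\<forall>N::nat. N \<ge> 1 \<longrightarrow>
          (\<integral>\<^sup>+ \<omega>. transport_cost p m (empirical_measure N (\<lambda>k. X k \<omega>)) \<mu> \<partial>M)
            \<le> ennreal (2 powr p * (kappa_crit TYPE('n) p N m / sqrt (real N)))
                * ennpowr (moment q m \<mu>) (p / q) * ennreal (theta_crit TYPE('n) p q N m)))))
     \<and>
     (p < real CARD('n) / 2 \<longrightarrow>
       (\<forall>q::real. q > real CARD('n) * p / (real CARD('n) - p) \<longrightarrow>
          (\<forall>m::ereal. m \<ge> 1 \<longrightarrow> (\<forall>N::nat. N \<ge> 1 \<longrightarrow>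
          (\<integral>\<^sup>+ \<omega>. transport_cost p m (empirical_measure N (\<lambda>k. X k \<omega>)) \<mu> \<partial>M)
            \<le> ennreal (2 powr p * (kappa_sub TYPE('n) p m / real N powr (p / real CARD('n))))
                * ennpowr (moment q m \<mu>) (p / q) * ennreal (theta_sub TYPE('n) p q m)))))"
proof -
  have p0: "p > 0" by (fact assms)
  have sample: "iid_sample M X \<mu> N" if "N \<ge> 1" for N
    using assms(2-6) that by (simp add: iid_sample_def iid_sample_axioms_def)
  have cover_pos: "cover_const TYPE('n) m > 0" if "m \<ge> 1" for m
    using cover_const_ge_1[OF that, where 'n='n] by linarith
  have scaled_pos: "cover_const TYPE('n) m * 2 powr (- real CARD('n)) > 0" if "m \<ge> 1" for m
    using cover_pos[OF that] by simp
  have eps0: "eps_p p \<ge> 0" by (simp add: eps_p_def)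
  have D: "real CARD('n) > 0" by simp
  have super: "(\<integral>\<^sup>+ \<omega>. transport_cost p m (empirical_measure N (\<lambda>k. X k \<omega>)) \<mu> \<partial>M)
            \<le> ennreal (2 powr p * (kappa_super TYPE('n) p m / sqrt (real N)))
                * ennpowr (moment q m \<mu>) (p / q) * ennreal (theta_super TYPE('n) p q m)"
    if p: "p > real CARD('n) / 2" and q: "q > 2 * p" and m: "m \<ge> 1" and N: "N \<ge> 1" for q m N
  proof -
    interpret iid_sample M X \<mu> N by (rule sample[OF N])
    show ?thesis
    proof (cases "m = \<infinity>")
      case True
      have lt: "2 powr (real CARD('n) / 2 - p) < 1" using p powr_less_one[of 2 "real CARD('n) / 2 - p"] by simp
      have eq: "2 powr p * (sqrt 1 * 2 powr (real CARD('n) / 2) / 2) / (1 - 2 powr (real CARD('n) / 2 - p))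
          = 2 powr p * kappa_super TYPE('n) p \<infinity>"
        by (simp add: kappa_super_def powr_diff Let_def)
      have pos: "kappa_super TYPE('n) p \<infinity> > 0" using lt by (simp add: kappa_super_def Let_def)
      show ?thesis unfolding True theta_super_def
        by (rule cost_bound_supercritical[OF p q _ _ _ _ pos dyadic_cells eq]) simp_all
    next
      case False
      have kap: "kappa_super TYPE('n) p m = (INF r\<in>{2..}. kappa_super_r TYPE('n) p m r)"
        using False by (simp add: kappa_super_def Let_def)
      (* A positive lower bound for the constants, uniform in r. *)
      define l where "l = sqrt (cover_const TYPE('n) m) * 2 powr (p - 1 - real CARD('n) / 2)"
      have l: "0 < l" "\<And>r. r \<in> {2..} \<Longrightarrow> l \<le> kappa_super_r TYPE('n) p m r"
        using cover_pos[OF m] kappa_super_r_eq(2)[OF p _ m] by (simp_all add: l_def)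
      show ?thesis unfolding theta_super_def kap
      proof (rule bound_at_Inf[OF _ l])
        fix r :: real assume r: "r \<in> {2..}"
        show "expected_cost p m
            \<le> ennreal (2 powr p * (kappa_super_r TYPE('n) p m r / sqrt (real N)))
                * ennpowr (moment q m \<mu>) (p / q) * ennreal (H (eps_p p / kappa_super_r TYPE('n) p m r) (2 * p) q)"
        proof (rule cost_bound_supercritical[OF p q m _ scaled_pos[OF m] _ less_le_trans[OF l(1) l(2)[OF r]] cover_cells[OF m]])
          show "(4 * r / (r - 1)) powr p * (sqrt (cover_const TYPE('n) m * 2 powr (- real CARD('n))) * r powr (real CARD('n) / 2) / 2)
              / (1 - r powr (real CARD('n) / 2 - p)) = 2 powr p * kappa_super_r TYPE('n) p m r"
            by (rule kappa_super_r_eq(1)[OF p _ m]) (use r in simp)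
        qed (use r in auto)
      qed (use N p0 q eps0 in auto)
    qed
  qed
  have crit: "(\<integral>\<^sup>+ \<omega>. transport_cost p m (empirical_measure N (\<lambda>k. X k \<omega>)) \<mu> \<partial>M)
            \<le> ennreal (2 powr p * (kappa_crit TYPE('n) p N m / sqrt (real N)))
                * ennpowr (moment q m \<mu>) (p / q) * ennreal (theta_crit TYPE('n) p q N m)"
    if p: "p = real CARD('n) / 2" and q: "q > 2 * p" and m: "m \<ge> 1" and N: "N \<ge> 1" for q m N
  proof -
    interpret iid_sample M X \<mu> N by (rule sample[OF N])
    show ?thesis
    proof (cases "m = \<infinity>")
      case True
      have lt: "2 powr (- p) < 1" using p0 powr_less_one[of 2 "- p"] by simp
      have arg: "2 * (1 - 2 powr (- p)) * 2 powr (- p) = 2 powr (1 - p) - 2 powr (1 - 2 * p)"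
      proof -
        have "2 powr (1 - p) = 2 * 2 powr (- p)" using powr_add[of 2 1 "- p"] by simp
        moreover have "2 powr (1 - 2 * p) = 2 * (2 powr (- p) * 2 powr (- p))"
          using powr_add[of 2 1 "- p + - p"] powr_add[of 2 "- p" "- p"] by simp
        ultimately show ?thesis by (simp add: algebra_simps)
      qed
      have eq: "2 powr p * (sqrt 1 * 2 powr p / 2) *
         (log_plus (2 * (1 - 2 powr (- p)) * 2 powr (- p) * sqrt (real N / 1)) / (p * ln 2) + 1 / (1 - 2 powr (- p)))
          = 2 powr p * kappa_crit TYPE('n) p N \<infinity>"
        unfolding arg by (simp add: kappa_crit_def powr_diff distrib_left)
      have "0 \<le> 2 powr (p - 1) / (p * ln 2) * log_plus ((2 powr (1 - p) - 2 powr (1 - 2 * p)) * sqrt (real N))"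
        using p0 by (simp add: log_plus_def)
      moreover have "0 < 2 powr (p - 1) / (1 - 2 powr (- p))" using lt by simp
      ultimately have pos: "kappa_crit TYPE('n) p N \<infinity> > 0" unfolding kappa_crit_def by simp
      show ?thesis unfolding True theta_crit_def
        by (rule cost_bound_critical[OF p q _ _ _ _ pos dyadic_cells eq]) simp_all
    next
      case False
      have kap: "kappa_crit TYPE('n) p N m = (INF r\<in>{2..}. kappa_crit_r TYPE('n) p N m r)"
        using False by (simp add: kappa_crit_def)
      define l where "l = sqrt (cover_const TYPE('n) m) / 2"
      have l: "0 < l" "\<And>r. r \<in> {2..} \<Longrightarrow> l \<le> kappa_crit_r TYPE('n) p N m r"
        using cover_pos[OF m] kappa_crit_r_eq(2)[OF p _ m] by (simp_all add: l_def)
      show ?thesis unfolding theta_crit_def kap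
      proof (rule bound_at_Inf[OF _ l])
        fix r :: real assume r: "r \<in> {2..}"
        show "expected_cost p m
            \<le> ennreal (2 powr p * (kappa_crit_r TYPE('n) p N m r / sqrt (real N)))
                * ennpowr (moment q m \<mu>) (p / q) * ennreal (H (eps_p p / kappa_crit_r TYPE('n) p N m r) (2 * p) q)"
        proof (rule cost_bound_critical[OF p q m _ scaled_pos[OF m] _ less_le_trans[OF l(1) l(2)[OF r]] cover_cells[OF m]])
          show "(4 * r / (r - 1)) powr p * (sqrt (cover_const TYPE('n) m * 2 powr (- real CARD('n))) * r powr p / 2) *
            (log_plus (2 * (1 - r powr (- p)) * r powr (- p) * sqrt (real N / (cover_const TYPE('n) m * 2 powr (- real CARD('n))))) / (p * ln r)
              + 1 / (1 - r powr (- p))) = 2 powr p * kappa_crit_r TYPE('n) p N m r"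
            by (rule kappa_crit_r_eq(1)[OF p _ m]) (use r in simp)
        qed (use r in auto)
      qed (use N p0 q eps0 in auto)
    qed
  qed
  have sub: "(\<integral>\<^sup>+ \<omega>. transport_cost p m (empirical_measure N (\<lambda>k. X k \<omega>)) \<mu> \<partial>M)
            \<le> ennreal (2 powr p * (kappa_sub TYPE('n) p m / real N powr (p / real CARD('n))))
                * ennpowr (moment q m \<mu>) (p / q) * ennreal (theta_sub TYPE('n) p q m)"
    if p: "p < real CARD('n) / 2" and q: "q > real CARD('n) * p / (real CARD('n) - p)" and m: "m \<ge> 1" and N: "N \<ge> 1" for q m N
  proof -
    interpret iid_sample M X \<mu> N by (rule sample[OF N])
    show ?thesis
    proof (cases "m = \<infinity>")
      case True
      have lt: "2 powr (p - real CARD('n) / 2) < 1" using p powr_less_one[of 2 "p - real CARD('n) / 2"] by simp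
      have lt2: "2 powr (- real CARD('n) / 2) < 1" using powr_less_one[of 2 "- real CARD('n) / 2"] by simp
      have half: "(sqrt 1 * 2 powr (real CARD('n) / 2) / 2) powr (2 * p / real CARD('n)) = 2 powr (p - 2 * p / real CARD('n))"
      proof -
        have "sqrt 1 * 2 powr (real CARD('n) / 2) / 2 = 2 powr (real CARD('n) / 2 - 1)" by (simp add: powr_diff)
        moreover have "(real CARD('n) / 2 - 1) * (2 * p / real CARD('n)) = p - 2 * p / real CARD('n)"
          using D by (simp add: field_simps)
        ultimately show ?thesis by (simp only: powr_powr)
      qed
      have eq: "2 powr p * (sqrt 1 * 2 powr (real CARD('n) / 2) / 2) powr (2 * p / real CARD('n)) *
         ((1 - 2 powr (- real CARD('n) / 2)) powr (1 - 2 * p / real CARD('n)) / (1 - 2 powr (p - real CARD('n) / 2)))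
          = 2 powr p * kappa_sub TYPE('n) p \<infinity>"
        unfolding half by (simp add: kappa_sub_def Let_def)
      have pos: "kappa_sub TYPE('n) p \<infinity> > 0" using lt lt2 by (simp add: kappa_sub_def Let_def)
      show ?thesis unfolding True theta_sub_def Let_def
        by (rule cost_bound_subcritical[OF p0 p q _ _ _ _ pos dyadic_cells eq]) simp_all
    next
      case False
      have kap: "kappa_sub TYPE('n) p m = (INF r\<in>{2..}. kappa_sub_r TYPE('n) p m r)"
        using False by (simp add: kappa_sub_def Let_def)
      define l where "l = (cover_const TYPE('n) m / 4) powr (p / real CARD('n))"
      have l: "0 < l" "\<And>r. r \<in> {2..} \<Longrightarrow> l \<le> kappa_sub_r TYPE('n) p m r"
        using cover_pos[OF m] kappa_sub_r_eq(2)[OF p0 p _ m] by (simp_all add: l_def)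
      have Dp: "real CARD('n) - p > 0" using p p0 by linarith
      have s0: "0 < real CARD('n) * p / (real CARD('n) - p)" using Dp p0 D by simp
      show ?thesis unfolding theta_sub_def Let_def kap
      proof (rule bound_at_Inf[OF _ l])
        fix r :: real assume r: "r \<in> {2..}"
        show "expected_cost p m
            \<le> ennreal (2 powr p * (kappa_sub_r TYPE('n) p m r / real N powr (p / real CARD('n))))
                * ennpowr (moment q m \<mu>) (p / q) *
              ennreal (H (2 powr (1 - 2 * p / real CARD('n)) * eps_p p / kappa_sub_r TYPE('n) p m r)
                (real CARD('n) * p / (real CARD('n) - p)) q)"
        proof (rule cost_bound_subcritical[OF p0 p q m _ scaled_pos[OF m] _ less_le_trans[OF l(1) l(2)[OF r]] cover_cells[OF m]])
          show "(4 * r / (r - 1)) powr p * (sqrt (cover_const TYPE('n) m * 2 powr (- real CARD('n))) * r powr (real CARD('n) / 2) / 2) powr (2 * p / real CARD('n)) *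
            ((1 - r powr (- real CARD('n) / 2)) powr (1 - 2 * p / real CARD('n)) / (1 - r powr (p - real CARD('n) / 2))) = 2 powr p * kappa_sub_r TYPE('n) p m r"
            by (rule kappa_sub_r_eq(1)[OF p0 p _ m]) (use r in simp)
        qed (use r in auto)
      qed (use N p0 q eps0 s0 in auto)
    qed
  qed
  show ?thesis by (intro conjI impI allI super crit sub)
qed

end
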